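(* Let $n\ge 3$, $p\ge 1$, $c\neq 0$, and let $M^n$ be a weakly Einstein submanifold, satisfying Chen's equality, of a nonflat space form $\overline{M}^{n+p}(c)$ of constant curvature $c$. Let $a,b$ denote the entries of the shape operator $A_1$ in the normal form of the shape operators described in the context. When $p=1$ (i.e. when $M^n$ is a hypersurface): (i) if $c>0$, then either (i.a) $M^n$ is a space of constant curvature $c$, or (i.b) $M^n$ is minimal of non-negative Ricci curvature, and $(a,b)=(\pm\sqrt{2c},\mp\sqrt{2c})$; (ii) if $c<0$, then either (ii.a) $M^n$ is a space of constant curvature $c$, or (ii.b) either $n=3$ or $n=4$, and then $a=b=\pm\sqrt{-\frac{c(4n-10)}{12n-33}}$, or (ii.c) $b=-a\pm\sqrt{-2c}$. When $p\ge 2$: (iii) if $c>0$, then either (iii.a) $M^n$ is a space of constant curvature $c$, or (iii.b) $M^n$ is minimal of non-negative Ricci curvature, or (iii.c) either $n=3$ or $n=4$; (iv) if $c<0$, then either (iv.a) $M^n$ is a space of constant curvature $c$, or (iv.b) either $n=3$ or $n=4$, or (iv.c) $b=-a\pm\sqrt{-2c}$.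
   Context: Conventions: $R(X,Y)=[\nabla_X,\nabla_Y]-\nabla_{[X,Y]}$ and $R(X,Y,Z,W)=\langle R(X,Y)Z,W\rangle$. The Ricci tensor is $\rho(X,Y)=\mathrm{Tr}(Z\mapsto R(Z,X)Y)$, and $\tau=\mathrm{Tr}_g\rho$ is the scalar curvature. The sectional curvature of $\pi=X\wedge Y$ is $K(\pi)=R(X,Y,Y,X)/(\langle X,X\rangle\langle Y,Y\rangle-\langle X,Y\rangle^2)$, and $(\inf K)(x)=\inf\{K(\pi):\pi \text{ a plane in } T_xM\}$. An $n$-dimensional Riemannian manifold $(M,g)$ is weakly Einstein if $\check R(X,Y)=\frac{\|R\|^2}{n}g(X,Y)$ for all vector fields $X,Y$, where $\check R(X,Y)=\sum_{i,j,k=1}^n R(X,e_i,e_j,e_k)R(Y,e_i,e_j,e_k)$ for a local orthonormal frame $\{e_i\}$. Submanifolds are immersed and carry the induced metric. $h$ is the second fundamental form, $H=\frac1n\mathrm{Tr}\,h$ is the mean curvature vector ($M$ is minimal if $H\equiv0$), and the shape operator $A_\xi$ in the normal direction $\xi$ is given by $\langle A_\xi X,Y\rangle=\langle h(X,Y),\xi\rangle$. A submanifold $M^n$ of a space form $\overline M^{n+p}(c)$ always satisfies Chen's inequality $\frac12\tau-\inf K\le \frac{n^2(n-2)}{2(n-1)}\|H\|^2+(n+1)(n-2)\frac c2$. It is said to satisfy Chen's equality if equality holds at every point. Normal form: equality holds at a point $x$ if and only if, with respect to suitable orthonormal frames $\{e_i\}_{i=1}^n$ of the tangent space and $\{\xi_t\}_{t=1}^p$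 of the normal space, the shape operators $A_t:=A_{\xi_t}$ are as follows. $A_1=\mathrm{diag}(a,b,\mu,\dots,\mu)$ with $\mu=a+b$. For $t\ge 2$, $A_t$ has upper-left $2\times2$ block $\begin{pmatrix} c_t & d_t\\ d_t & -c_t\end{pmatrix}$ and all other entries zero. The letters $a,b$ refer to this normal form. *)

theory Defs
  imports "HOL-Analysis.Analysis"
begin

section \<open>Smooth maps between open subsets of Euclidean spaces\<close>

abbreviation dderiv ::
  "('a::real_normed_vector \<Rightarrow> 'b::real_normed_vector) \<Rightarrow> 'a \<Rightarrow> 'a \<Rightarrow> 'b"
  where "dderiv f u v \<equiv> frechet_derivative f (at u) v"

primrec Ck_on ::
  "nat \<Rightarrow> 'a::real_normed_vector set \<Rightarrow> ('a \<Rightarrow> 'b::real_normed_vector) \<Rightarrow> bool" where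
  "Ck_on 0 S f \<longleftrightarrow> continuous_on S f"
| "Ck_on (Suc k) S f \<longleftrightarrow> f differentiable_on S \<and> (\<forall>v. Ck_on k S (\<lambda>u. dderiv f u v))"

text \<open>Only used for open sets; this is then the usual notion of a \<open>C\<^sup>\<infinity>\<close> map.\<close>

definition smooth_on ::
  "'a::real_normed_vector set \<Rightarrow> ('a \<Rightarrow> 'b::real_normed_vector) \<Rightarrow> bool"
  where "smooth_on S f \<longleftrightarrow> (\<forall>k. Ck_on k S f)"

section \<open>Riemannian geometry in one coordinate chart\<close>

text \<open>
  A metric in coordinates assigns to each point \<open>u\<close> of the coordinate domain a bilinear form
  \<open>g u\<close> on the model space; vector fields are functions on the model space. All expressions
  below at \<open>u\<close> depend only on the germs of their arguments at \<open>u\<close>.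
\<close>

type_synonym 'a coord_metric = "'a \<Rightarrow> 'a \<Rightarrow> 'a \<Rightarrow> real"

text \<open>The Christoffel symbols, given by the Koszul formula for constant coordinate fields.\<close>

definition christoffel :: "'a::euclidean_space coord_metric \<Rightarrow> 'a \<Rightarrow> 'a \<Rightarrow> 'a \<Rightarrow> 'a" where
  "christoffel g u x y = (THE w. \<forall>z. g u w z =
     (dderiv (\<lambda>q. g q y z) u x + dderiv (\<lambda>q. g q x z) u y - dderiv (\<lambda>q. g q x y) u z) / 2)"

definition levi_civita ::
  "'a::euclidean_space coord_metric \<Rightarrow> ('a \<Rightarrow> 'a) \<Rightarrow> ('a \<Rightarrow> 'a) \<Rightarrow> 'a \<Rightarrow> 'a" where
  "levi_civita g X Y u = dderiv Y u (X u) + christoffel g u (X u) (Y u)"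

definition lie_bracket :: "('a::real_normed_vector \<Rightarrow> 'a) \<Rightarrow> ('a \<Rightarrow> 'a) \<Rightarrow> 'a \<Rightarrow> 'a" where
  "lie_bracket X Y u = dderiv Y u (X u) - dderiv X u (Y u)"

definition curv_op ::
  "'a::euclidean_space coord_metric \<Rightarrow> ('a \<Rightarrow> 'a) \<Rightarrow> ('a \<Rightarrow> 'a) \<Rightarrow> ('a \<Rightarrow> 'a) \<Rightarrow> 'a \<Rightarrow> 'a" where
  "curv_op g X Y Z u = levi_civita g X (levi_civita g Y Z) u
     - levi_civita g Y (levi_civita g X Z) u - levi_civita g (lie_bracket X Y) Z u"

text \<open>
  The values of tensors on tangent vectors at \<open>u\<close> are obtained by extending the vectors to
  constant coordinate fields.
\<close>

definition riem :: "'a::euclidean_space coord_metric \<Rightarrow> 'a \<Rightarrow> 'a \<Rightarrow> 'a \<Rightarrow> 'a \<Rightarrow> 'a" where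
  "riem g u x y z = curv_op g (\<lambda>_. x) (\<lambda>_. y) (\<lambda>_. z) u"

definition riem4 ::
  "'a::euclidean_space coord_metric \<Rightarrow> 'a \<Rightarrow> 'a \<Rightarrow> 'a \<Rightarrow> 'a \<Rightarrow> 'a \<Rightarrow> real" where
  "riem4 g u x y z w = g u (riem g u x y z) w"

definition orthonormal_frame ::
  "'a::euclidean_space coord_metric \<Rightarrow> 'a \<Rightarrow> (nat \<Rightarrow> 'a) \<Rightarrow> bool" where
  "orthonormal_frame g u e \<longleftrightarrow>
     (\<forall>i\<in>{1..DIM('a)}. \<forall>j\<in>{1..DIM('a)}. g u (e i) (e j) = (if i = j then 1 else 0))"

text \<open>An arbitrary orthonormal frame, for contractions that do not depend on the frame.\<close>

definition some_frame :: "'a::euclidean_space coord_metric \<Rightarrow> 'a \<Rightarrow> nat \<Rightarrow> 'a" where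
  "some_frame g u = (SOME e. orthonormal_frame g u e)"

definition metric_trace ::
  "'a::euclidean_space coord_metric \<Rightarrow> 'a \<Rightarrow> ('a \<Rightarrow> 'a \<Rightarrow> 'v::real_vector) \<Rightarrow> 'v" where
  "metric_trace g u B = (\<Sum>i = 1..DIM('a). B (some_frame g u i) (some_frame g u i))"

definition lin_trace :: "('a::euclidean_space \<Rightarrow> 'a) \<Rightarrow> real" where
  "lin_trace L = (\<Sum>b\<in>Basis. L b \<bullet> b)"

definition ricci :: "'a::euclidean_space coord_metric \<Rightarrow> 'a \<Rightarrow> 'a \<Rightarrow> 'a \<Rightarrow> real" where
  "ricci g u x y = lin_trace (\<lambda>z. riem g u z x y)"

definition scalar_curv :: "'a::euclidean_space coord_metric \<Rightarrow> 'a \<Rightarrow> real" where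
  "scalar_curv g u = metric_trace g u (ricci g u)"

text \<open>A plane is given by a basis \<open>x, y\<close>, i.e. by two distinct independent vectors.\<close>

definition spans_plane :: "'a::real_vector \<Rightarrow> 'a \<Rightarrow> bool" where
  "spans_plane x y \<longleftrightarrow> x \<noteq> y \<and> independent {x, y}"

definition sec_curv :: "'a::euclidean_space coord_metric \<Rightarrow> 'a \<Rightarrow> 'a \<Rightarrow> 'a \<Rightarrow> real" where
  "sec_curv g u x y = riem4 g u x y y x / (g u x x * g u y y - (g u x y)\<^sup>2)"

definition inf_sec_curv :: "'a::euclidean_space coord_metric \<Rightarrow> 'a \<Rightarrow> real" where
  "inf_sec_curv g u = Inf {sec_curv g u x y | x y. spans_plane x y}"

definition riem_check :: "'a::euclidean_space coord_metric \<Rightarrow> 'a \<Rightarrow> 'a \<Rightarrow> 'a \<Rightarrow> real" where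
  "riem_check g u x y = (let e = some_frame g u in
     \<Sum>i = 1..DIM('a). \<Sum>j = 1..DIM('a). \<Sum>k = 1..DIM('a).
       riem4 g u x (e i) (e j) (e k) * riem4 g u y (e i) (e j) (e k))"

definition riem_norm_sq :: "'a::euclidean_space coord_metric \<Rightarrow> 'a \<Rightarrow> real" where
  "riem_norm_sq g u = (let e = some_frame g u in
     \<Sum>i = 1..DIM('a). \<Sum>j = 1..DIM('a). \<Sum>k = 1..DIM('a). \<Sum>l = 1..DIM('a).
       (riem4 g u (e i) (e j) (e k) (e l))\<^sup>2)"

section \<open>Submanifold geometry in coordinates\<close>

text \<open>
  \<open>F\<close> is the coordinate expression of an isometric immersion, \<open>g\<close> the induced metric in the
  coordinates of the submanifold and \<open>gb\<close> the metric in the coordinates of the ambient space.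
  Fields along \<open>F\<close> are functions \<open>V\<close> with \<open>V u\<close> a tangent vector of the ambient space at \<open>F u\<close>.
\<close>

definition ambient_nabla ::
  "'b::euclidean_space coord_metric \<Rightarrow> ('a::euclidean_space \<Rightarrow> 'b) \<Rightarrow> ('a \<Rightarrow> 'a) \<Rightarrow> ('a \<Rightarrow> 'b)
     \<Rightarrow> 'a \<Rightarrow> 'b" where
  "ambient_nabla gb F X V u =
     dderiv V u (X u) + christoffel gb (F u) (dderiv F u (X u)) (V u)"

text \<open>The Gauss formula: \<open>h(X,Y)\<close> is the ambient \<open>\<nabla>\<^sub>X Y\<close> minus the intrinsic one.\<close>

definition second_ff ::
  "'a::euclidean_space coord_metric \<Rightarrow> 'b::euclidean_space coord_metric \<Rightarrow> ('a \<Rightarrow> 'b)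
     \<Rightarrow> 'a \<Rightarrow> 'a \<Rightarrow> 'a \<Rightarrow> 'b" where
  "second_ff g gb F u x y = ambient_nabla gb F (\<lambda>_. x) (\<lambda>q. dderiv F q y) u
     - dderiv F u (levi_civita g (\<lambda>_. x) (\<lambda>_. y) u)"

definition mean_curv ::
  "'a::euclidean_space coord_metric \<Rightarrow> 'b::euclidean_space coord_metric \<Rightarrow> ('a \<Rightarrow> 'b)
     \<Rightarrow> 'a \<Rightarrow> 'b" where
  "mean_curv g gb F u = (1 / real DIM('a)) *\<^sub>R metric_trace g u (second_ff g gb F u)"

definition shape_op ::
  "'a::euclidean_space coord_metric \<Rightarrow> 'b::euclidean_space coord_metric \<Rightarrow> ('a \<Rightarrow> 'b)
     \<Rightarrow> 'a \<Rightarrow> 'b \<Rightarrow> 'a \<Rightarrow> 'a" where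
  "shape_op g gb F u xi x = (THE w. \<forall>y. g u w y = gb (F u) (second_ff g gb F u x y) xi)"

definition normal_frame ::
  "'b::euclidean_space coord_metric \<Rightarrow> ('a::euclidean_space \<Rightarrow> 'b) \<Rightarrow> 'a \<Rightarrow> (nat \<Rightarrow> 'b)
     \<Rightarrow> bool" where
  "normal_frame gb F u xi \<longleftrightarrow> (let p = DIM('b) - DIM('a) in
     (\<forall>t\<in>{1..p}. \<forall>x. gb (F u) (xi t) (dderiv F u x) = 0) \<and>
     (\<forall>s\<in>{1..p}. \<forall>t\<in>{1..p}. gb (F u) (xi s) (xi t) = (if s = t then 1 else 0)))"

text \<open>
  \<open>normal_form g gb F u a b\<close>: \<open>a\<close> and \<open>b\<close> are the first two entries of \<open>A\<^sub>1\<close> in some normal form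
  of the shape operators at \<open>u\<close>.
\<close>

definition normal_form ::
  "'a::euclidean_space coord_metric \<Rightarrow> 'b::euclidean_space coord_metric \<Rightarrow> ('a \<Rightarrow> 'b)
     \<Rightarrow> 'a \<Rightarrow> real \<Rightarrow> real \<Rightarrow> bool" where
  "normal_form g gb F u a b \<longleftrightarrow>
     (\<exists>e xi c d. orthonormal_frame g u e \<and> normal_frame gb F u xi \<and>
        shape_op g gb F u (xi 1) (e 1) = a *\<^sub>R e 1 \<and>
        shape_op g gb F u (xi 1) (e 2) = b *\<^sub>R e 2 \<and>
        (\<forall>i\<in>{3..DIM('a)}. shape_op g gb F u (xi 1) (e i) = (a + b) *\<^sub>R e i) \<and>
        (\<forall>t\<in>{2..DIM('b) - DIM('a)}.
           shape_op g gb F u (xi t) (e 1) = c t *\<^sub>R e 1 + d t *\<^sub>R e 2 \<and>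
           shape_op g gb F u (xi t) (e 2) = d t *\<^sub>R e 1 - c t *\<^sub>R e 2 \<and>
           (\<forall>i\<in>{3..DIM('a)}. shape_op g gb F u (xi t) (e i) = 0)))"

section \<open>Manifolds\<close>

text \<open>A chart is a pair of a domain and a coordinate map.\<close>

type_synonym ('m, 'a) chart = "'m set \<times> ('m \<Rightarrow> 'a)"

definition coord_range :: "('m, 'a) chart \<Rightarrow> 'a set" where
  "coord_range \<kappa> = snd \<kappa> ` fst \<kappa>"

text \<open>The coordinate expression of a map \<open>f\<close> with respect to charts \<open>\<kappa>\<close> and \<open>\<kappa>'\<close>.\<close>

definition coord_map ::
  "('m, 'a) chart \<Rightarrow> ('q, 'b) chart \<Rightarrow> ('m \<Rightarrow> 'q) \<Rightarrow> 'a \<Rightarrow> 'b" where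
  "coord_map \<kappa> \<kappa>' f = snd \<kappa>' \<circ> f \<circ> inv_into (fst \<kappa>) (snd \<kappa>)"

record ('m, 'a) riem_space =
  top_of :: "'m topology"
  atlas :: "('m, 'a) chart set"
  metric :: "('m, 'a) chart \<Rightarrow> 'a coord_metric"

definition smooth_map ::
  "('m, 'a::euclidean_space) riem_space \<Rightarrow> ('q, 'b::euclidean_space) riem_space
     \<Rightarrow> ('m \<Rightarrow> 'q) \<Rightarrow> bool" where
  "smooth_map M N f \<longleftrightarrow> continuous_map (top_of M) (top_of N) f \<and>
     (\<forall>\<kappa>\<in>atlas M. \<forall>\<kappa>'\<in>atlas N.
        smooth_on (snd \<kappa> ` {x \<in> fst \<kappa>. f x \<in> fst \<kappa>'}) (coord_map \<kappa> \<kappa>' f))"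

text \<open>Manifolds are Hausdorff, second countable and connected.\<close>

definition smooth_manifold :: "('m, 'a::euclidean_space) riem_space \<Rightarrow> bool" where
  "smooth_manifold M \<longleftrightarrow>
     Hausdorff_space (top_of M) \<and> second_countable (top_of M) \<and> connected_space (top_of M) \<and>
     (\<Union>\<kappa>\<in>atlas M. fst \<kappa>) = topspace (top_of M) \<and>
     (\<forall>\<kappa>\<in>atlas M. openin (top_of M) (fst \<kappa>) \<and> open (coord_range \<kappa>) \<and>
        homeomorphic_map (subtopology (top_of M) (fst \<kappa>)) (top_of_set (coord_range \<kappa>)) (snd \<kappa>)) \<and>
     (\<forall>\<kappa>\<in>atlas M. \<forall>\<kappa>'\<in>atlas M.
        smooth_on (snd \<kappa> ` (fst \<kappa> \<inter> fst \<kappa>')) (coord_map \<kappa> \<kappa>' id))"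

definition riemannian_manifold :: "('m, 'a::euclidean_space) riem_space \<Rightarrow> bool" where
  "riemannian_manifold M \<longleftrightarrow> smooth_manifold M \<and>
     (\<forall>\<kappa>\<in>atlas M.
        (\<forall>u\<in>coord_range \<kappa>. bilinear (metric M \<kappa> u) \<and>
           (\<forall>x y. metric M \<kappa> u x y = metric M \<kappa> u y x) \<and>
           (\<forall>x. x \<noteq> 0 \<longrightarrow> metric M \<kappa> u x x > 0)) \<and>
        (\<forall>x y. smooth_on (coord_range \<kappa>) (\<lambda>u. metric M \<kappa> u x y))) \<and>
     (\<forall>\<kappa>\<in>atlas M. \<forall>\<kappa>'\<in>atlas M. \<forall>m\<in>fst \<kappa> \<inter> fst \<kappa>'. \<forall>x y.
        metric M \<kappa> (snd \<kappa> m) x y =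
          metric M \<kappa>' (snd \<kappa>' m) (dderiv (coord_map \<kappa> \<kappa>' id) (snd \<kappa> m) x)
                                 (dderiv (coord_map \<kappa> \<kappa>' id) (snd \<kappa> m) y))"

text \<open>\<open>f\<close> is an immersion and \<open>M\<close> carries the metric induced by \<open>f\<close>.\<close>

definition isometric_immersion ::
  "('m, 'a::euclidean_space) riem_space \<Rightarrow> ('q, 'b::euclidean_space) riem_space
     \<Rightarrow> ('m \<Rightarrow> 'q) \<Rightarrow> bool" where
  "isometric_immersion M N f \<longleftrightarrow> smooth_map M N f \<and>
     (\<forall>\<kappa>\<in>atlas M. \<forall>\<kappa>'\<in>atlas N. \<forall>m\<in>fst \<kappa>. f m \<in> fst \<kappa>' \<longrightarrow>
        inj (dderiv (coord_map \<kappa> \<kappa>' f) (snd \<kappa> m)) \<and>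
        (\<forall>x y. metric M \<kappa> (snd \<kappa> m) x y =
           metric N \<kappa>' (snd \<kappa>' (f m)) (dderiv (coord_map \<kappa> \<kappa>' f) (snd \<kappa> m) x)
                                      (dderiv (coord_map \<kappa> \<kappa>' f) (snd \<kappa> m) y)))"

text \<open>
  Pointwise properties, required at every point and in all charts around it. The properties used
  below do not depend on the charts.
\<close>

definition at_every_point ::
  "('m, 'a::euclidean_space) riem_space \<Rightarrow> ('a coord_metric \<Rightarrow> 'a \<Rightarrow> bool) \<Rightarrow> bool" where
  "at_every_point M P \<longleftrightarrow> (\<forall>\<kappa>\<in>atlas M. \<forall>u\<in>coord_range \<kappa>. P (metric M \<kappa>) u)"

definition at_every_point_of_immersion ::
  "('m, 'a::euclidean_space) riem_space \<Rightarrow> ('q, 'b::euclidean_space) riem_space \<Rightarrow> ('m \<Rightarrow> 'q)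
     \<Rightarrow> ('a coord_metric \<Rightarrow> 'b coord_metric \<Rightarrow> ('a \<Rightarrow> 'b) \<Rightarrow> 'a \<Rightarrow> bool) \<Rightarrow> bool" where
  "at_every_point_of_immersion M N f P \<longleftrightarrow>
     (\<forall>\<kappa>\<in>atlas M. \<forall>\<kappa>'\<in>atlas N. \<forall>m\<in>fst \<kappa>. f m \<in> fst \<kappa>' \<longrightarrow>
        P (metric M \<kappa>) (metric N \<kappa>') (coord_map \<kappa> \<kappa>' f) (snd \<kappa> m))"

section \<open>The conditions on the manifolds and the immersion\<close>

definition constant_curvature :: "('m, 'a::euclidean_space) riem_space \<Rightarrow> real \<Rightarrow> bool" where
  "constant_curvature M c \<longleftrightarrow>
     at_every_point M (\<lambda>g u. \<forall>x y. spans_plane x y \<longrightarrow> sec_curv g u x y = c)"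

text \<open>Completeness and simple connectedness are not required.\<close>

definition space_form :: "('m, 'a::euclidean_space) riem_space \<Rightarrow> real \<Rightarrow> bool" where
  "space_form M c \<longleftrightarrow> riemannian_manifold M \<and> constant_curvature M c"

definition weakly_einstein :: "('m, 'a::euclidean_space) riem_space \<Rightarrow> bool" where
  "weakly_einstein M \<longleftrightarrow> at_every_point M (\<lambda>g u. \<forall>x y.
     riem_check g u x y = riem_norm_sq g u / real DIM('a) * g u x y)"

definition nonneg_ricci :: "('m, 'a::euclidean_space) riem_space \<Rightarrow> bool" where
  "nonneg_ricci M \<longleftrightarrow> at_every_point M (\<lambda>g u. \<forall>x. ricci g u x x \<ge> 0)"

definition minimal_immersion ::
  "('m, 'a::euclidean_space) riem_space \<Rightarrow> ('q, 'b::euclidean_space) riem_space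
     \<Rightarrow> ('m \<Rightarrow> 'q) \<Rightarrow> bool" where
  "minimal_immersion M N f \<longleftrightarrow>
     at_every_point_of_immersion M N f (\<lambda>g gb F u. mean_curv g gb F u = 0)"

definition chen_equality ::
  "('m, 'a::euclidean_space) riem_space \<Rightarrow> ('q, 'b::euclidean_space) riem_space
     \<Rightarrow> ('m \<Rightarrow> 'q) \<Rightarrow> real \<Rightarrow> bool" where
  "chen_equality M N f c \<longleftrightarrow> (let n = real DIM('a) in
     at_every_point_of_immersion M N f (\<lambda>g gb F u.
       scalar_curv g u / 2 - inf_sec_curv g u =
         n\<^sup>2 * (n - 2) / (2 * (n - 1)) * gb (F u) (mean_curv g gb F u) (mean_curv g gb F u)
         + (n + 1) * (n - 2) * c / 2))"

text \<open>
  At each point a normal form exists, and \<open>P a b\<close> holds for the entries \<open>a, b\<close> of \<open>A\<^sub>1\<close> in every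
  normal form (neither the frames nor, in general, \<open>a\<close> and \<open>b\<close> are unique).
\<close>

definition normal_form_entries ::
  "('m, 'a::euclidean_space) riem_space \<Rightarrow> ('q, 'b::euclidean_space) riem_space \<Rightarrow> ('m \<Rightarrow> 'q)
     \<Rightarrow> (real \<Rightarrow> real \<Rightarrow> bool) \<Rightarrow> bool" where
  "normal_form_entries M N f P \<longleftrightarrow> at_every_point_of_immersion M N f (\<lambda>g gb F u.
     (\<exists>a b. normal_form g gb F u a b) \<and> (\<forall>a b. normal_form g gb F u a b \<longrightarrow> P a b))"

end

theory Submission
  imports Defs
begin

text \<open>
  In the normal form the Gauss equation makes every curvature component a polynomial in \<open>c\<close>, \<open>a\<close>, \<open>b\<close> and
  \<open>s = \<Sum>\<^sub>t (c\<^sub>t\<^sup>2 + d\<^sub>t\<^sup>2)\<close>, and the weakly Einstein condition becomes two equations: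
  \<open>(c + a\<mu>)\<^sup>2 = (c + b\<mu>)\<^sup>2\<close>, so that \<open>\<mu> = 0\<close>, \<open>\<mu>\<^sup>2 = - 2c\<close> or \<open>a = b\<close>, and a relation that determines
  \<open>c + ab - s\<close> up to sign. For \<open>p = 1\<close> we have \<open>s = 0\<close>, and \<open>a = b\<close> leaves only one value of \<open>a\<^sup>2\<close>.

  In dimension \<open>n \<ge> 5\<close> the points where \<open>\<mu>\<^sup>2\<close> is neither \<open>0\<close> nor \<open>- 2c\<close> form an open set, on which
  \<open>a = b\<close>. By the second Bianchi identity the distribution spanned by \<open>e\<^sub>1\<close> and \<open>e\<^sub>2\<close> is parallel there,
  so \<open>c + a\<mu> = 0\<close>, i.e. \<open>\<mu>\<^sup>2 = - 2c\<close>, and the set is empty.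

  The cases do not mix. Chen's equality expresses \<open>\<mu>\<^sup>2\<close>, a multiple of \<open>\<parallel>H\<parallel>\<^sup>2\<close>, through the scalar and the
  sectional curvatures, so it is a continuous function on the connected manifold \<open>M\<close>, and for \<open>p = 1\<close> or
  \<open>n \<ge> 5\<close> it takes finitely many values. Minimal points of hypersurfaces are separated by the scalar curvature.
\<close>

section \<open>Calculus of smooth maps\<close>

text \<open>The frames of a normal form are chosen point by point and need not vary smoothly,
  whereas parallelism is a statement about derivatives. On the umbilic set the projection
  \<open>P\<close> onto the plane of \<open>e 1\<close> and \<open>e 2\<close> and the curvature of
  that plane are therefore recovered from smooth tensors: \<open>P\<close> from the component of the
  second fundamental form along the mean curvature vector, the curvature as a quotient near a given
  point. The bound n \<ge> 5 enters because the Bianchi identity couples pairs of directions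
  orthogonal to the plane: with three such directions the equations can be solved for each of them,
  with two they leave the unknowns undetermined. The constant of the hypersurface case comes from a
  = b and s = 0 in the second weakly Einstein equation, (c + a^2)^2 + (n - 4)(c + 2a^2)^2 = (n -
  3)(c + 4a^2)^2, whose terms free of a cancel, so that a factor a^2 splits off. Whatever is defined
  through \<open>THE\<close> or through an arbitrary frame inherits its smoothness from the dual
  vectors \<open>sharp\<close>.\<close>

lemma dderiv_eq:
  assumes "(f has_derivative f') (at u)"
  shows "frechet_derivative f (at u) = f'" and "f differentiable at u"
  using assms frechet_derivative_at by (blast, auto simp: differentiable_def)

lemma Ck_on_Suc_open:
  assumes "open S"
  shows "Ck_on (Suc k) S f \<longleftrightarrow>
    (\<forall>u\<in>S. f differentiable at u) \<and> (\<forall>v. Ck_on k S (\<lambda>u. dderiv f u v))"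
  using assms by (simp add: differentiable_on_eq_differentiable_at)

lemma dderiv_cong:
  assumes "open S" "u \<in> S" "\<And>q. q \<in> S \<Longrightarrow> f q = g q" "f differentiable at u"
  shows "frechet_derivative f (at u) = frechet_derivative g (at u)"
  using frechet_derivative_transform_within_open[of f u S g] assms by simp

lemma differentiable_cong:
  assumes "open S" "u \<in> S" "\<And>q. q \<in> S \<Longrightarrow> f q = g q"
  shows "f differentiable at u \<longleftrightarrow> g differentiable at u"
  using assms unfolding differentiable_def
  by (metis has_derivative_transform_within_open)

lemma Ck_on_cong:
  assumes "open S" "\<And>q. q \<in> S \<Longrightarrow> f q = g q"
  shows "Ck_on k S f \<longleftrightarrow> Ck_on k S g"
  using assms(2)
proof (induction k arbitrary: f g)
  case 0
  then show ?case by (simp cong: continuous_on_cong)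
next
  case (Suc k)
  have "(\<forall>u\<in>S. f differentiable at u) \<longleftrightarrow> (\<forall>u\<in>S. g differentiable at u)"
    using differentiable_cong[OF assms(1)] Suc.prems by blast
  moreover have "Ck_on k S (\<lambda>u. dderiv f u v) \<longleftrightarrow> Ck_on k S (\<lambda>u. dderiv g u v)"
    if "\<forall>u\<in>S. f differentiable at u" for v
    by (rule Suc.IH) (simp add: dderiv_cong[OF assms(1) _ Suc.prems] that)
  ultimately show ?case unfolding Ck_on_Suc_open[OF assms(1)] by blast
qed

lemma Ck_on_congI:
  "open S \<Longrightarrow> Ck_on k S g \<Longrightarrow> (\<And>q. q \<in> S \<Longrightarrow> f q = g q) \<Longrightarrow> Ck_on k S f"
  using Ck_on_cong[of S f g k] by blast

lemma Ck_on_Suc_imp: "Ck_on (Suc k) S f \<Longrightarrow> Ck_on k S f"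
proof (induction k arbitrary: f)
  case 0
  then show ?case by (simp add: differentiable_imp_continuous_on)
next
  case (Suc k)
  then show ?case by (metis Ck_on.simps(2))
qed

lemma Ck_on_subset:
  assumes "open S" "open T" "T \<subseteq> S"
  shows "Ck_on k S f \<Longrightarrow> Ck_on k T f"
proof (induction k arbitrary: f)
  case 0
  then show ?case using assms by (auto intro: continuous_on_subset)
next
  case (Suc k)
  then show ?case using assms unfolding Ck_on_Suc_open[OF assms(1)] Ck_on_Suc_open[OF assms(2)]
    by blast
qed

lemma Ck_on_const: "open S \<Longrightarrow> Ck_on k S (\<lambda>u. c)"
proof (induction k arbitrary: c)
  case (Suc k)
  then show ?case unfolding Ck_on_Suc_open[OF Suc.prems] by simp
qed auto

lemma dderiv_linear:
  assumes "bounded_linear L" "f differentiable at u"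
  shows "dderiv (\<lambda>q. L (f q)) u v = L (dderiv f u v)"
    and "(\<lambda>q. L (f q)) differentiable at u"
proof -
  have "((\<lambda>q. L (f q)) has_derivative (\<lambda>v. L (dderiv f u v))) (at u)"
    using assms by (auto intro: bounded_linear.has_derivative simp: frechet_derivative_works)
  then show "dderiv (\<lambda>q. L (f q)) u v = L (dderiv f u v)"
    and "(\<lambda>q. L (f q)) differentiable at u"
    by (simp_all add: dderiv_eq)
qed

lemma Ck_on_linear:
  assumes "open S" "bounded_linear L"
  shows "Ck_on k S f \<Longrightarrow> Ck_on k S (\<lambda>u. L (f u))"
proof (induction k arbitrary: f)
  case 0
  then show ?case using assms by (auto intro: bounded_linear.continuous_on)
next
  case (Suc k)
  then have d: "\<forall>u\<in>S. f differentiable at u" and *: "\<And>v. Ck_on k S (\<lambda>u. dderiv f u v)"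
    unfolding Ck_on_Suc_open[OF assms(1)] by auto
  have "Ck_on k S (\<lambda>u. dderiv (\<lambda>q. L (f q)) u v)" for v
    by (rule Ck_on_congI[OF assms(1) Suc.IH[OF *[of v]]])
      (simp add: dderiv_linear(1)[OF assms(2)] d)
  then show ?case unfolding Ck_on_Suc_open[OF assms(1)] using dderiv_linear(2)[OF assms(2)] d by blast
qed

lemma dderiv_add:
  assumes "f differentiable at u" "g differentiable at u"
  shows "dderiv (\<lambda>q. f q + g q) u v = dderiv f u v + dderiv g u v"
    and "(\<lambda>q. f q + g q) differentiable at u"
proof -
  have "((\<lambda>q. f q + g q) has_derivative (\<lambda>v. dderiv f u v + dderiv g u v)) (at u)"
    using assms by (auto intro: has_derivative_add simp: frechet_derivative_works)
  then show "dderiv (\<lambda>q. f q + g q) u v = dderiv f u v + dderiv g u v"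
    and "(\<lambda>q. f q + g q) differentiable at u"
    by (simp_all add: dderiv_eq)
qed

lemma Ck_on_add:
  assumes "open S"
  shows "Ck_on k S f \<Longrightarrow> Ck_on k S g \<Longrightarrow> Ck_on k S (\<lambda>u. f u + g u)"
proof (induction k arbitrary: f g)
  case 0
  then show ?case by (auto intro: continuous_on_add)
next
  case (Suc k)
  then have d: "\<forall>u\<in>S. f differentiable at u" "\<forall>u\<in>S. g differentiable at u"
    and *: "\<And>v. Ck_on k S (\<lambda>u. dderiv f u v)" "\<And>v. Ck_on k S (\<lambda>u. dderiv g u v)"
    unfolding Ck_on_Suc_open[OF assms(1)] by auto
  have "Ck_on k S (\<lambda>u. dderiv (\<lambda>q. f q + g q) u v)" for v
    by (rule Ck_on_congI[OF assms(1) Suc.IH[OF *(1)[of v] *(2)[of v]]])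
      (simp add: dderiv_add(1) d)
  then show ?case unfolding Ck_on_Suc_open[OF assms(1)] using dderiv_add(2) d by blast
qed

lemma dderiv_bilinear:
  assumes "bounded_bilinear B" "f differentiable at u" "g differentiable at u"
  shows "dderiv (\<lambda>q. B (f q) (g q)) u v = B (f u) (dderiv g u v) + B (dderiv f u v) (g u)"
    and "(\<lambda>q. B (f q) (g q)) differentiable at u"
proof -
  have "((\<lambda>q. B (f q) (g q)) has_derivative (\<lambda>v. B (f u) (dderiv g u v) + B (dderiv f u v) (g u))) (at u)"
    using assms by (auto intro: bounded_bilinear.FDERIV simp: frechet_derivative_works)
  then show "dderiv (\<lambda>q. B (f q) (g q)) u v = B (f u) (dderiv g u v) + B (dderiv f u v) (g u)"
    and "(\<lambda>q. B (f q) (g q)) differentiable at u"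
    by (simp_all add: dderiv_eq)
qed

lemma Ck_on_bilinear:
  assumes "open S" "bounded_bilinear B"
  shows "Ck_on k S f \<Longrightarrow> Ck_on k S g \<Longrightarrow> Ck_on k S (\<lambda>u. B (f u) (g u))"
proof (induction k arbitrary: f g)
  case 0
  then show ?case using assms by (auto intro: bounded_bilinear.continuous_on)
next
  case (Suc k)
  then have d: "\<forall>u\<in>S. f differentiable at u" "\<forall>u\<in>S. g differentiable at u"
    and *: "\<And>v. Ck_on k S (\<lambda>u. dderiv f u v)" "\<And>v. Ck_on k S (\<lambda>u. dderiv g u v)"
    unfolding Ck_on_Suc_open[OF assms(1)] by auto
  \<comment> \<open>The product rule keeps one factor undifferentiated, so the induction hypothesis
    also needs \<open>f\<close> and \<open>g\<close> themselves at order \<open>k\<close>.\<close>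
  have "Ck_on k S f" "Ck_on k S g" using Suc.prems Ck_on_Suc_imp by auto
  then have b: "Ck_on k S (\<lambda>u. B (f u) (dderiv g u v) + B (dderiv f u v) (g u))" for v
    using Suc.IH * Ck_on_add[OF assms(1)] by metis
  have "Ck_on k S (\<lambda>u. dderiv (\<lambda>q. B (f q) (g q)) u v)" for v
    by (rule Ck_on_congI[OF assms(1) b]) (simp add: dderiv_bilinear(1)[OF assms(2)] d)
  then show ?case unfolding Ck_on_Suc_open[OF assms(1)] using dderiv_bilinear(2)[OF assms(2)] d by blast
qed

lemma Ck_on_sum:
  assumes "open S" "\<And>i. i \<in> I \<Longrightarrow> Ck_on k S (f i)"
  shows "Ck_on k S (\<lambda>u. \<Sum>i\<in>I. f i u)"
  using assms(2)
  by (induction I rule: infinite_finite_induct) (auto simp: Ck_on_const[OF assms(1)] intro!: Ck_on_add[OF assms(1)])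

lemma dderiv_inverse:
  fixes f :: "'a::real_normed_vector \<Rightarrow> real"
  assumes "f differentiable at u" "f u \<noteq> 0"
  shows "dderiv (\<lambda>q. inverse (f q)) u v = - (inverse (f u) * inverse (f u) * dderiv f u v)"
    and "(\<lambda>q. inverse (f q)) differentiable at u"
proof -
  have "((\<lambda>q. inverse (f q)) has_derivative (\<lambda>v. - (inverse (f u) * dderiv f u v * inverse (f u)))) (at u)"
    using assms by (auto intro: has_derivative_inverse simp: frechet_derivative_works)
  then show "dderiv (\<lambda>q. inverse (f q)) u v = - (inverse (f u) * inverse (f u) * dderiv f u v)"
    and "(\<lambda>q. inverse (f q)) differentiable at u"
    by (simp_all add: dderiv_eq)
qed

lemma Ck_on_mult:
  fixes f g :: "'a::real_normed_vector \<Rightarrow> real"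
  shows "open S \<Longrightarrow> Ck_on k S f \<Longrightarrow> Ck_on k S g \<Longrightarrow> Ck_on k S (\<lambda>u. f u * g u)"
  by (rule Ck_on_bilinear[OF _ bounded_bilinear_mult])

lemma Ck_on_inverse:
  fixes f :: "'a::real_normed_vector \<Rightarrow> real"
  assumes "open S" "\<And>u. u \<in> S \<Longrightarrow> f u \<noteq> 0"
  shows "Ck_on k S f \<Longrightarrow> Ck_on k S (\<lambda>u. inverse (f u))"
proof (induction k)
  case 0
  then show ?case using assms by (auto intro: continuous_on_inverse)
next
  case (Suc k)
  then have d: "\<forall>u\<in>S. f differentiable at u"
    and *: "\<And>v. Ck_on k S (\<lambda>u. dderiv f u v)"
    unfolding Ck_on_Suc_open[OF assms(1)] by auto
  have "Ck_on k S (\<lambda>u. inverse (f u))" using Suc Ck_on_Suc_imp by auto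
  then have b: "Ck_on k S (\<lambda>u. - (inverse (f u) * inverse (f u) * dderiv f u v))" for v
    by (intro Ck_on_linear[OF assms(1) bounded_linear_minus[OF bounded_linear_ident]] Ck_on_mult assms *)
  have "Ck_on k S (\<lambda>u. dderiv (\<lambda>q. inverse (f q)) u v)" for v
    by (rule Ck_on_congI[OF assms(1) b]) (simp add: dderiv_inverse(1) d assms(2))
  then show ?case unfolding Ck_on_Suc_open[OF assms(1)] using dderiv_inverse(2) d assms(2) by blast
qed

lemma dderiv_compose:
  assumes "F differentiable at u" "f differentiable at (F u)"
  shows "dderiv (\<lambda>q. f (F q)) u v = dderiv f (F u) (dderiv F u v)"
    and "(\<lambda>q. f (F q)) differentiable at u"
proof -
  have "((\<lambda>q. f (F q)) has_derivative (\<lambda>v. dderiv f (F u) (dderiv F u v))) (at u)"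
    using assms by (auto intro: has_derivative_compose simp: frechet_derivative_works)
  then show "dderiv (\<lambda>q. f (F q)) u v = dderiv f (F u) (dderiv F u v)"
    and "(\<lambda>q. f (F q)) differentiable at u"
    by (simp_all add: dderiv_eq)
qed

lemma linear_Basis_expand:
  fixes T :: "'b::euclidean_space \<Rightarrow> 'c::real_vector"
  assumes "linear T"
  shows "T w = (\<Sum>b\<in>Basis. (w \<bullet> b) *\<^sub>R T b)"
proof -
  interpret linear T by fact
  have "T w = T (\<Sum>b\<in>Basis. (w \<bullet> b) *\<^sub>R b)" by (simp add: euclidean_representation)
  also have "\<dots> = (\<Sum>b\<in>Basis. (w \<bullet> b) *\<^sub>R T b)" by (simp add: sum scale)
  finally show ?thesis .
qed

lemma dderiv_linear_expand:
  fixes f :: "'b::euclidean_space \<Rightarrow> 'c::real_normed_vector"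
  shows "f differentiable at u \<Longrightarrow> dderiv f u v = (\<Sum>b\<in>Basis. (v \<bullet> b) *\<^sub>R dderiv f u b)"
  by (rule linear_Basis_expand[OF linear_frechet_derivative])

text \<open>The chain rule differentiates \<open>f\<close> in the moving direction
  \<open>dderiv F u v\<close>, while \<open>Ck_on\<close> controls fixed directions only. Expanding
  that direction in \<open>Basis\<close> turns the derivative into a finite sum of products, to
  which the induction hypothesis applies.\<close>

lemma Ck_on_compose:
  fixes F :: "'a::real_normed_vector \<Rightarrow> 'b::euclidean_space"
  assumes "open S" "open T" "F ` S \<subseteq> T"
  shows "Ck_on k S F \<Longrightarrow> Ck_on k T f \<Longrightarrow> Ck_on k S (\<lambda>u. f (F u))"
proof (induction k arbitrary: f)
  case 0
  then show ?case using assms(3) by (auto intro: continuous_on_compose2)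
next
  case (Suc k)
  have d: "\<forall>u\<in>S. F differentiable at u" "\<forall>u\<in>T. f differentiable at u"
    and *: "\<And>v. Ck_on k S (\<lambda>u. dderiv F u v)" "\<And>v. Ck_on k T (\<lambda>u. dderiv f u v)"
    using Suc.prems unfolding Ck_on_Suc_open[OF assms(1)] Ck_on_Suc_open[OF assms(2)] by auto
  have 0: "Ck_on k S F" using Suc.prems Ck_on_Suc_imp by auto
  have b: "Ck_on k S (\<lambda>u. \<Sum>b\<in>Basis. (dderiv F u v \<bullet> b) *\<^sub>R dderiv f (F u) b)" for v
    by (intro Ck_on_sum Ck_on_bilinear[OF _ bounded_bilinear_scaleR]
        Ck_on_linear[OF _ bounded_linear_inner_left] assms * Suc.IH 0)
  have "dderiv (\<lambda>q. f (F q)) u v = (\<Sum>b\<in>Basis. (dderiv F u v \<bullet> b) *\<^sub>R dderiv f (F u) b)"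
    if "u \<in> S" for u v
  proof -
    from that assms(3) d have "F differentiable at u" "f differentiable at (F u)" by auto
    then show ?thesis using dderiv_compose(1) dderiv_linear_expand by metis
  qed
  then have "Ck_on k S (\<lambda>u. dderiv (\<lambda>q. f (F q)) u v)" for v
    by (intro Ck_on_congI[OF assms(1) b])
  moreover have "\<forall>u\<in>S. (\<lambda>q. f (F q)) differentiable at u"
    using d assms(3) dderiv_compose(2) by (metis image_subset_iff)
  ultimately show ?case unfolding Ck_on_Suc_open[OF assms(1)] by blast
qed

lemma smooth_on_differentiable: "smooth_on S f \<Longrightarrow> open S \<Longrightarrow> u \<in> S \<Longrightarrow> f differentiable at u"
  unfolding smooth_on_def using Ck_on_Suc_open by blast

lemma smooth_on_has_derivative:
  "smooth_on S f \<Longrightarrow> open S \<Longrightarrow> u \<in> S \<Longrightarrow> (f has_derivative dderiv f u) (at u)"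
  using smooth_on_differentiable frechet_derivative_works by blast

lemma smooth_on_dderiv: "smooth_on S f \<Longrightarrow> open S \<Longrightarrow> smooth_on S (\<lambda>u. dderiv f u v)"
  unfolding smooth_on_def using Ck_on_Suc_open by blast

lemma smooth_on_continuous_on: "smooth_on S f \<Longrightarrow> continuous_on S f"
  unfolding smooth_on_def by (metis Ck_on.simps(1))

lemma linear_dderiv: "smooth_on S f \<Longrightarrow> open S \<Longrightarrow> u \<in> S \<Longrightarrow> linear (dderiv f u)"
  by (rule linear_frechet_derivative[OF smooth_on_differentiable])

lemma smooth_on_cong:
  "open S \<Longrightarrow> (\<And>q. q \<in> S \<Longrightarrow> f q = g q) \<Longrightarrow> smooth_on S f \<longleftrightarrow> smooth_on S g"
  unfolding smooth_on_def using Ck_on_cong by metis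

lemma smooth_on_congI:
  "open S \<Longrightarrow> smooth_on S g \<Longrightarrow> (\<And>q. q \<in> S \<Longrightarrow> f q = g q) \<Longrightarrow> smooth_on S f"
  using smooth_on_cong[of S f g] by blast

lemma smooth_on_subset: "open S \<Longrightarrow> open T \<Longrightarrow> T \<subseteq> S \<Longrightarrow> smooth_on S f \<Longrightarrow> smooth_on T f"
  unfolding smooth_on_def using Ck_on_subset by blast

lemma smooth_on_const: "open S \<Longrightarrow> smooth_on S (\<lambda>u. c)"
  unfolding smooth_on_def by (simp add: Ck_on_const)

lemma smooth_on_linear: "open S \<Longrightarrow> bounded_linear L \<Longrightarrow> smooth_on S f \<Longrightarrow> smooth_on S (\<lambda>u. L (f u))"
  unfolding smooth_on_def by (simp add: Ck_on_linear)

lemma smooth_on_add: "open S \<Longrightarrow> smooth_on S f \<Longrightarrow> smooth_on S g \<Longrightarrow> smooth_on S (\<lambda>u. f u + g u)"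
  unfolding smooth_on_def by (simp add: Ck_on_add)

lemma smooth_on_minus: "open S \<Longrightarrow> smooth_on S f \<Longrightarrow> smooth_on S (\<lambda>u. - f u)"
  by (rule smooth_on_linear[OF _ bounded_linear_minus[OF bounded_linear_ident]])

lemma smooth_on_diff: "open S \<Longrightarrow> smooth_on S f \<Longrightarrow> smooth_on S g \<Longrightarrow> smooth_on S (\<lambda>u. f u - g u)"
  using smooth_on_add[of S f "\<lambda>u. - g u"] smooth_on_minus[of S g] by simp

lemma smooth_on_bilinear:
  "open S \<Longrightarrow> bounded_bilinear B \<Longrightarrow> smooth_on S f \<Longrightarrow> smooth_on S g \<Longrightarrow> smooth_on S (\<lambda>u. B (f u) (g u))"
  unfolding smooth_on_def by (simp add: Ck_on_bilinear)

lemma smooth_on_mult: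
  fixes f g :: "'a::real_normed_vector \<Rightarrow> real"
  shows "open S \<Longrightarrow> smooth_on S f \<Longrightarrow> smooth_on S g \<Longrightarrow> smooth_on S (\<lambda>u. f u * g u)"
  by (rule smooth_on_bilinear[OF _ bounded_bilinear_mult])

lemma smooth_on_scaleR:
  "open S \<Longrightarrow> smooth_on S f \<Longrightarrow> smooth_on S g \<Longrightarrow> smooth_on S (\<lambda>u. f u *\<^sub>R g u)"
  by (rule smooth_on_bilinear[OF _ bounded_bilinear_scaleR])

lemma smooth_on_inner:
  "open S \<Longrightarrow> smooth_on S f \<Longrightarrow> smooth_on S g \<Longrightarrow> smooth_on S (\<lambda>u. f u \<bullet> g u)"
  by (rule smooth_on_bilinear[OF _ bounded_bilinear_inner])

lemma smooth_on_inverse: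
  fixes f :: "'a::real_normed_vector \<Rightarrow> real"
  shows "open S \<Longrightarrow> (\<And>u. u \<in> S \<Longrightarrow> f u \<noteq> 0) \<Longrightarrow> smooth_on S f \<Longrightarrow> smooth_on S (\<lambda>u. inverse (f u))"
  unfolding smooth_on_def by (simp add: Ck_on_inverse)

lemma smooth_on_divide:
  fixes f :: "'a::real_normed_vector \<Rightarrow> real"
  shows "open S \<Longrightarrow> (\<And>u. u \<in> S \<Longrightarrow> g u \<noteq> 0) \<Longrightarrow> smooth_on S f \<Longrightarrow> smooth_on S g \<Longrightarrow> smooth_on S (\<lambda>u. f u / g u)"
  unfolding divide_inverse by (intro smooth_on_mult smooth_on_inverse)

lemma smooth_on_sum:
  "open S \<Longrightarrow> (\<And>i. i \<in> I \<Longrightarrow> smooth_on S (f i)) \<Longrightarrow> smooth_on S (\<lambda>u. \<Sum>i\<in>I. f i u)"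
  unfolding smooth_on_def by (simp add: Ck_on_sum)

lemma smooth_on_compose:
  fixes F :: "'a::real_normed_vector \<Rightarrow> 'b::euclidean_space"
  shows "open S \<Longrightarrow> open T \<Longrightarrow> F ` S \<subseteq> T \<Longrightarrow> smooth_on S F \<Longrightarrow> smooth_on T f \<Longrightarrow> smooth_on S (\<lambda>u. f (F u))"
  unfolding smooth_on_def by (simp add: Ck_on_compose)

lemmas smooth_intros = smooth_on_const smooth_on_add smooth_on_minus smooth_on_diff smooth_on_mult
  smooth_on_scaleR smooth_on_inner smooth_on_sum smooth_on_dderiv

text \<open>Tensors are known to be smooth only for constant arguments; the \<open>Basis\<close>
  expansion of the moving argument carries this over to fields.\<close>

lemma smooth_on_family:
  fixes T :: "'a::real_normed_vector \<Rightarrow> 'b::euclidean_space \<Rightarrow> 'c::real_normed_vector"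
  assumes "open S" "\<And>u. u \<in> S \<Longrightarrow> linear (T u)" "\<And>z. smooth_on S (\<lambda>u. T u z)" "smooth_on S W"
  shows "smooth_on S (\<lambda>u. T u (W u))"
proof -
  have "smooth_on S (\<lambda>u. \<Sum>b\<in>Basis. (W u \<bullet> b) *\<^sub>R T u b)"
    by (intro smooth_intros assms)
  moreover have "T u (W u) = (\<Sum>b\<in>Basis. (W u \<bullet> b) *\<^sub>R T u b)" if "u \<in> S" for u
    by (rule linear_Basis_expand[OF assms(2)[OF that]])
  ultimately show ?thesis by (rule smooth_on_congI[OF assms(1)])
qed

text \<open>Product rule for a tensor applied to a field. The first summand freezes the field at
  \<open>u\<close>, which is the form in which derivatives of constant coordinate fields occur
  later.\<close>

lemma dderiv_family:
  fixes T :: "'a::real_normed_vector \<Rightarrow> 'b::euclidean_space \<Rightarrow> 'c::real_normed_vector"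
  assumes "open S" "\<And>u. u \<in> S \<Longrightarrow> linear (T u)" "\<And>z. smooth_on S (\<lambda>u. T u z)" "smooth_on S W"
    and "u \<in> S"
  shows "dderiv (\<lambda>q. T q (W q)) u v = dderiv (\<lambda>q. T q (W u)) u v + T u (dderiv W u v)"
proof -
  note hd = smooth_on_has_derivative[OF _ assms(1,5)]
  have 1: "((\<lambda>q. \<Sum>b\<in>Basis. (W q \<bullet> b) *\<^sub>R T q b) has_derivative
     (\<lambda>v. \<Sum>b\<in>Basis. (W u \<bullet> b) *\<^sub>R dderiv (\<lambda>q. T q b) u v + (dderiv W u v \<bullet> b) *\<^sub>R T u b)) (at u)"
    by (intro has_derivative_sum has_derivative_scaleR has_derivative_inner_left hd assms)
  have 2: "((\<lambda>q. \<Sum>b\<in>Basis. (W u \<bullet> b) *\<^sub>R T q b) has_derivative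
     (\<lambda>v. \<Sum>b\<in>Basis. (W u \<bullet> b) *\<^sub>R dderiv (\<lambda>q. T q b) u v)) (at u)"
    by (intro has_derivative_sum has_derivative_scaleR_right hd assms)
  have 3: "((\<lambda>q. T q (W q)) has_derivative
     (\<lambda>v. \<Sum>b\<in>Basis. (W u \<bullet> b) *\<^sub>R dderiv (\<lambda>q. T q b) u v + (dderiv W u v \<bullet> b) *\<^sub>R T u b)) (at u)"
    by (rule has_derivative_transform_within_open[OF 1 assms(1,5)])
      (rule linear_Basis_expand[OF assms(2), symmetric])
  have 4: "((\<lambda>q. T q (W u)) has_derivative
     (\<lambda>v. \<Sum>b\<in>Basis. (W u \<bullet> b) *\<^sub>R dderiv (\<lambda>q. T q b) u v)) (at u)"
    by (rule has_derivative_transform_within_open[OF 2 assms(1,5)])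
      (rule linear_Basis_expand[OF assms(2), symmetric])
  show ?thesis
    unfolding dderiv_eq(1)[OF 3] dderiv_eq(1)[OF 4]
      linear_Basis_expand[OF assms(2)[OF assms(5)], of "dderiv W u v"]
    by (simp add: sum.distrib)
qed

lemma linear_dderiv_family:
  fixes T :: "'a::real_normed_vector \<Rightarrow> 'b::euclidean_space \<Rightarrow> 'c::real_normed_vector"
  assumes "open S" "\<And>u. u \<in> S \<Longrightarrow> linear (T u)" "\<And>z. smooth_on S (\<lambda>u. T u z)" "u \<in> S"
  shows "linear (\<lambda>z. dderiv (\<lambda>q. T q z) u v)"
proof
  fix y z :: 'b and r :: real
  note d = smooth_on_differentiable[OF assms(3) assms(1,4)]
  have "dderiv (\<lambda>q. T q (y + z)) u v = dderiv (\<lambda>q. T q y + T q z) u v"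
    using dderiv_cong[OF assms(1,4), of "\<lambda>q. T q (y + z)" "\<lambda>q. T q y + T q z"] d
      linear_add[OF assms(2)] by simp
  then show "dderiv (\<lambda>q. T q (y + z)) u v = dderiv (\<lambda>q. T q y) u v + dderiv (\<lambda>q. T q z) u v"
    using dderiv_add(1)[OF d d] by simp
  have "dderiv (\<lambda>q. T q (r *\<^sub>R z)) u v = dderiv (\<lambda>q. r *\<^sub>R T q z) u v"
    using dderiv_cong[OF assms(1,4), of "\<lambda>q. T q (r *\<^sub>R z)" "\<lambda>q. r *\<^sub>R T q z"] d
      linear_scale[OF assms(2)] by simp
  then show "dderiv (\<lambda>q. T q (r *\<^sub>R z)) u v = r *\<^sub>R dderiv (\<lambda>q. T q z) u v"
    using dderiv_linear(1)[OF bounded_linear_scaleR_right d] by simp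
qed

section \<open>Symmetry of second derivatives\<close>

lemma directional_has_real_derivative:
  fixes f :: "'a::real_normed_vector \<Rightarrow> real"
  assumes "f differentiable at (p + s *\<^sub>R v)"
  shows "((\<lambda>s. f (p + s *\<^sub>R v)) has_real_derivative dderiv f (p + s *\<^sub>R v) v) (at s)"
proof -
  have f: "(f has_derivative dderiv f (p + s *\<^sub>R v)) (at (p + s *\<^sub>R v))"
    using assms by (simp add: frechet_derivative_works)
  have "((\<lambda>s. p + s *\<^sub>R v) has_derivative (\<lambda>h. h *\<^sub>R v)) (at s)"
    by (auto intro!: derivative_eq_intros)
  from has_derivative_compose[OF this f]
  have "((\<lambda>s. f (p + s *\<^sub>R v)) has_derivative (\<lambda>h. dderiv f (p + s *\<^sub>R v) (h *\<^sub>R v))) (at s)" .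
  moreover have "dderiv f (p + s *\<^sub>R v) (h *\<^sub>R v) = dderiv f (p + s *\<^sub>R v) v * h" for h
    using linear_scale[OF linear_frechet_derivative[OF assms]] by simp
  ultimately show ?thesis by (simp add: has_field_derivative_def)
qed

text \<open>Two applications of the mean value theorem to the second difference over a
  parallelogram, along \<open>v\<close> and then along \<open>w\<close>. The difference itself is
  symmetric in \<open>v\<close> and \<open>w\<close>, the right-hand side is not yet.\<close>

lemma mixed_difference:
  fixes f :: "'a::real_normed_vector \<Rightarrow> real"
  assumes "open S" "smooth_on S f" "t > 0"
    and inS: "\<And>s r. 0 \<le> s \<Longrightarrow> s \<le> t \<Longrightarrow> 0 \<le> r \<Longrightarrow> r \<le> t \<Longrightarrow> u + s *\<^sub>R v + r *\<^sub>R w \<in> S"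
  shows "\<exists>s r. 0 \<le> s \<and> s \<le> t \<and> 0 \<le> r \<and> r \<le> t \<and>
    f (u + t *\<^sub>R v + t *\<^sub>R w) - f (u + t *\<^sub>R v) - f (u + t *\<^sub>R w) + f u =
      t * t * dderiv (\<lambda>q. dderiv f q v) (u + s *\<^sub>R v + r *\<^sub>R w) w"
proof -
  note d = smooth_on_differentiable[OF assms(2,1)]
  note d' = smooth_on_differentiable[OF smooth_on_dderiv[OF assms(2,1)] assms(1)]
  let ?\<phi> = "\<lambda>s. f ((u + t *\<^sub>R w) + s *\<^sub>R v) - f (u + s *\<^sub>R v)"
  have "(?\<phi> has_real_derivative (dderiv f ((u + t *\<^sub>R w) + s *\<^sub>R v) v - dderiv f (u + s *\<^sub>R v) v)) (at s)"
    if "0 \<le> s" "s \<le> t" for s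
    using inS[OF that, of t] inS[OF that, of 0] assms(3)
    by (intro DERIV_diff directional_has_real_derivative d) (simp_all add: algebra_simps)
  from MVT2[OF assms(3) this] obtain s where s: "0 < s" "s < t"
    "?\<phi> t - ?\<phi> 0 = t * (dderiv f ((u + t *\<^sub>R w) + s *\<^sub>R v) v - dderiv f (u + s *\<^sub>R v) v)"
    by auto
  let ?\<psi> = "\<lambda>r. dderiv f ((u + s *\<^sub>R v) + r *\<^sub>R w) v"
  have "(?\<psi> has_real_derivative dderiv (\<lambda>q. dderiv f q v) ((u + s *\<^sub>R v) + r *\<^sub>R w) w) (at r)"
    if "0 \<le> r" "r \<le> t" for r
    using inS[of s r] s that
    by (intro directional_has_real_derivative[of "\<lambda>q. dderiv f q v"] d') (simp_all add: algebra_simps)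
  from MVT2[OF assms(3) this] obtain r where r: "0 < r" "r < t"
    "?\<psi> t - ?\<psi> 0 = t * dderiv (\<lambda>q. dderiv f q v) ((u + s *\<^sub>R v) + r *\<^sub>R w) w"
    by auto
  have "f (u + t *\<^sub>R v + t *\<^sub>R w) - f (u + t *\<^sub>R v) - f (u + t *\<^sub>R w) + f u = ?\<phi> t - ?\<phi> 0"
    by (simp add: algebra_simps)
  also have "\<dots> = t * (?\<psi> t - ?\<psi> 0)" using s by (simp add: algebra_simps)
  also have "\<dots> = t * t * dderiv (\<lambda>q. dderiv f q v) (u + s *\<^sub>R v + r *\<^sub>R w) w"
    using r by simp
  finally show ?thesis using s r by (intro exI[of _ s] exI[of _ r]) simp
qed

text \<open>The same second difference equals t^2 times either mixed derivative at some point of the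
  parallelogram. Two different values at \<open>u\<close> would, by continuity, stay apart on a
  small parallelogram.\<close>

lemma dderiv_symmetric_real:
  fixes f :: "'a::real_normed_vector \<Rightarrow> real"
  assumes "open S" "smooth_on S f" "u \<in> S"
  shows "dderiv (\<lambda>q. dderiv f q v) u w = dderiv (\<lambda>q. dderiv f q w) u v"
proof (rule ccontr)
  let ?F = "\<lambda>q. dderiv (\<lambda>q. dderiv f q v) q w" and ?H = "\<lambda>q. dderiv (\<lambda>q. dderiv f q w) q v"
  assume "?F u \<noteq> ?H u"
  then have "\<bar>?F u - ?H u\<bar> / 2 > 0" (is "?e > 0") by simp
  have "continuous_on S ?F" "continuous_on S ?H"
    by (intro smooth_on_continuous_on smooth_on_dderiv assms)+
  then have "isCont ?F u" "isCont ?H u"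
    using assms by (auto simp: continuous_on_eq_continuous_at)
  then obtain d1 d2 where d: "d1 > 0" "\<And>q. dist q u < d1 \<Longrightarrow> dist (?F q) (?F u) < ?e"
    "d2 > 0" "\<And>q. dist q u < d2 \<Longrightarrow> dist (?H q) (?H u) < ?e"
    using \<open>?e > 0\<close> unfolding continuous_at_eps_delta by metis
  obtain d3 where d3: "d3 > 0" "ball u d3 \<subseteq> S" using assms(1,3) openE by blast
  \<comment> \<open>The summand 1 keeps \<open>K\<close> positive when both directions vanish;
    \<open>t = D / (2 * K)\<close> then places the whole parallelogram inside the ball of radius
    \<open>D\<close>.\<close>
  define K where "K = norm v + norm w + 1"
  have "K > 0" unfolding K_def by (simp add: add_nonneg_pos)
  define D where "D = min d1 (min d2 d3)"
  define t where "t = D / (2 * K)"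
  have "D > 0" using d d3 D_def by auto
  then have "t > 0" using \<open>K > 0\<close> by (simp add: t_def)
  have near: "dist (u + s *\<^sub>R v + r *\<^sub>R w) u < D" if "0 \<le> s" "s \<le> t" "0 \<le> r" "r \<le> t" for s r
  proof -
    have "dist (u + s *\<^sub>R v + r *\<^sub>R w) u = norm (s *\<^sub>R v + r *\<^sub>R w)" by (simp add: dist_norm algebra_simps)
    also have "\<dots> \<le> s * norm v + r * norm w" using that by (metis abs_of_nonneg norm_scaleR norm_triangle_ineq)
    also have "\<dots> \<le> t * norm v + t * norm w" using that by (intro add_mono mult_right_mono) auto
    also have "\<dots> \<le> t * K" using \<open>t > 0\<close> by (simp add: K_def algebra_simps)
    also have "\<dots> < D" using \<open>D > 0\<close> \<open>K > 0\<close> by (simp add: t_def)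
    finally show ?thesis .
  qed
  have inS: "u + s *\<^sub>R v + r *\<^sub>R w \<in> S" if "0 \<le> s" "s \<le> t" "0 \<le> r" "r \<le> t" for s r
    using near[OF that] d3 by (auto simp: D_def dist_commute)
  have inS': "u + s *\<^sub>R w + r *\<^sub>R v \<in> S" if "0 \<le> s" "s \<le> t" "0 \<le> r" "r \<le> t" for s r
    using inS[OF that(3,4,1,2)] by (simp add: algebra_simps)
  obtain s r where 1: "0 \<le> s" "s \<le> t" "0 \<le> r" "r \<le> t"
    "f (u + t *\<^sub>R v + t *\<^sub>R w) - f (u + t *\<^sub>R v) - f (u + t *\<^sub>R w) + f u = t * t * ?F (u + s *\<^sub>R v + r *\<^sub>R w)"
    using mixed_difference[OF assms(1,2) \<open>t > 0\<close> inS] by blast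
  obtain s' r' where 2: "0 \<le> s'" "s' \<le> t" "0 \<le> r'" "r' \<le> t"
    "f (u + t *\<^sub>R w + t *\<^sub>R v) - f (u + t *\<^sub>R w) - f (u + t *\<^sub>R v) + f u = t * t * ?H (u + s' *\<^sub>R w + r' *\<^sub>R v)"
    using mixed_difference[OF assms(1,2) \<open>t > 0\<close> inS'] by blast
  have "t * t * ?F (u + s *\<^sub>R v + r *\<^sub>R w) = t * t * ?H (u + s' *\<^sub>R w + r' *\<^sub>R v)"
    using 1(5) 2(5) by (simp add: algebra_simps)
  then have eq: "?F (u + s *\<^sub>R v + r *\<^sub>R w) = ?H (u + s' *\<^sub>R w + r' *\<^sub>R v)" using \<open>t > 0\<close> by simp
  define x where "x = ?F (u + s *\<^sub>R v + r *\<^sub>R w)"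
  have "dist x (?F u) < ?e"
    unfolding x_def using near[OF 1(1-4)] by (intro d) (simp add: D_def)
  moreover have "dist x (?H u) < ?e"
    unfolding x_def eq using near[OF 2(3,4,1,2)] by (intro d) (simp add: D_def algebra_simps)
  moreover have "dist (?F u) (?H u) \<le> dist x (?F u) + dist x (?H u)" by (rule dist_triangle3)
  moreover have "dist (?F u) (?H u) = 2 * ?e" by (simp add: dist_real_def)
  ultimately show False by linarith
qed

lemma dderiv_inner:
  assumes "f differentiable at u"
  shows "dderiv (\<lambda>q. f q \<bullet> b) u v = dderiv f u v \<bullet> b"
  using dderiv_linear(1)[OF bounded_linear_inner_left assms] .

lemma dderiv_symmetric:
  fixes f :: "'a::real_normed_vector \<Rightarrow> 'b::euclidean_space"
  assumes "open S" "smooth_on S f" "u \<in> S"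
  shows "dderiv (\<lambda>q. dderiv f q v) u w = dderiv (\<lambda>q. dderiv f q w) u v"
proof (rule euclidean_eqI)
  fix b :: 'b assume "b \<in> Basis"
  have *: "dderiv (\<lambda>q. dderiv f q v) u w \<bullet> b = dderiv (\<lambda>q. dderiv (\<lambda>q. f q \<bullet> b) q v) u w" for v w
  proof -
    have "dderiv (\<lambda>q. dderiv f q v) u w \<bullet> b = dderiv (\<lambda>q. dderiv f q v \<bullet> b) u w"
      by (intro dderiv_inner[symmetric] smooth_on_differentiable[OF smooth_on_dderiv[OF assms(2,1)]] assms)
    also have "\<dots> = dderiv (\<lambda>q. dderiv (\<lambda>q. f q \<bullet> b) q v) u w"
      using assms smooth_on_differentiable[OF assms(2,1)]
      by (intro fun_cong[OF dderiv_cong[of S]] smooth_on_differentiable[of S] smooth_intros)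
        (simp_all add: dderiv_inner)
    finally show ?thesis .
  qed
  have "smooth_on S (\<lambda>q. f q \<bullet> b)" by (intro smooth_intros assms)
  then show "dderiv (\<lambda>q. dderiv f q v) u w \<bullet> b = dderiv (\<lambda>q. dderiv f q w) u v \<bullet> b"
    unfolding * by (rule dderiv_symmetric_real[OF assms(1) _ assms(3)])
qed

text \<open>\<open>smooth_on_family\<close>, applied to one slot at a time.\<close>

lemma smooth_form_fields:
  fixes P :: "'c::real_normed_vector \<Rightarrow> 'a::euclidean_space \<Rightarrow> 'b::euclidean_space \<Rightarrow> 'd::real_normed_vector"
  assumes "open U" "\<And>u. u \<in> U \<Longrightarrow> bilinear (P u)" "\<And>x y. smooth_on U (\<lambda>u. P u x y)"
    and "smooth_on U V" "smooth_on U W"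
  shows "smooth_on U (\<lambda>q. P q (V q) (W q))"
proof -
  have lin: "linear (P q y)" "linear (\<lambda>y. P q y z)" if "q \<in> U" for q y z
    using assms(2)[OF that] by (auto simp: bilinear_def)
  have sm: "smooth_on U (\<lambda>q. P q (V q) z)" for z
    by (rule smooth_on_family[of U "\<lambda>q x. P q x z", OF assms(1) lin(2) assms(3,4)])
  show ?thesis
    by (rule smooth_on_family[of U "\<lambda>q. P q (V q)", OF assms(1) lin(1) sm assms(5)])
qed

lemma dderiv_form_fields:
  fixes P :: "'c::real_normed_vector \<Rightarrow> 'a::euclidean_space \<Rightarrow> 'b::euclidean_space \<Rightarrow> 'd::real_normed_vector"
  assumes "open U" "\<And>u. u \<in> U \<Longrightarrow> bilinear (P u)" "\<And>x y. smooth_on U (\<lambda>u. P u x y)"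
    and "smooth_on U V" "smooth_on U W" "u \<in> U"
  shows "dderiv (\<lambda>q. P q (V q) (W q)) u x =
    dderiv (\<lambda>q. P q (V u) (W u)) u x + P u (dderiv V u x) (W u) + P u (V u) (dderiv W u x)"
proof -
  have lin: "linear (P q y)" "linear (\<lambda>y. P q y z)" if "q \<in> U" for q y z
    using assms(2)[OF that] by (auto simp: bilinear_def)
  have sm: "smooth_on U (\<lambda>q. P q (V q) z)" for z
    by (rule smooth_on_family[of U "\<lambda>q x. P q x z", OF assms(1) lin(2) assms(3,4)])
  show ?thesis
    using dderiv_family[of U "\<lambda>q. P q (V q)", OF assms(1) lin(1) sm assms(5,6), of x]
      dderiv_family[of U "\<lambda>q y. P q y (W u)", OF assms(1) lin(2) assms(3,4,6), of x] by simp
qed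

section \<open>Inner products on a Euclidean space\<close>

locale inner_form =
  fixes G :: "'a::euclidean_space \<Rightarrow> 'a \<Rightarrow> real"
  assumes bil: "bilinear G" and sym: "G x y = G y x" and pos: "x \<noteq> 0 \<Longrightarrow> G x x > 0"
begin

lemmas add [simp] = bilinear_ladd[OF bil] bilinear_radd[OF bil]
lemmas scale [simp] = bilinear_lmul[OF bil] bilinear_rmul[OF bil]
lemmas diff [simp] = bilinear_lsub[OF bil] bilinear_rsub[OF bil]
lemmas minus [simp] = bilinear_lneg[OF bil] bilinear_rneg[OF bil]
lemmas zero [simp] = bilinear_lzero[OF bil] bilinear_rzero[OF bil]

lemma linear_right: "linear (G x)" and linear_left: "linear (\<lambda>x. G x y)"
  using bil by (auto simp: bilinear_def)

lemma sum_left: "G (\<Sum>i\<in>I. f i) y = (\<Sum>i\<in>I. G (f i) y)"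
  using linear_sum[OF linear_left] by (simp add: o_def)

lemma sum_right: "G y (\<Sum>i\<in>I. f i) = (\<Sum>i\<in>I. G y (f i))"
  using linear_sum[OF linear_right] by (simp add: o_def)

lemma nonneg: "G x x \<ge> 0"
  using pos[of x] by (cases "x = 0") auto

lemma eq_zero_iff: "G x x = 0 \<longleftrightarrow> x = 0"
  using pos[of x] by (cases "x = 0") auto

lemma nondegenerate: "(\<And>z. G w z = G w' z) \<Longrightarrow> w = w'"
  using eq_zero_iff[of "w - w'"] by simp

text \<open>Nondegeneracy makes the map from \<open>w\<close> to the Euclidean representative of
  \<open>G w\<close> injective, and an injective linear endomorphism in finite dimension is
  onto.\<close>

lemma riesz:
  assumes "linear \<phi>"
  shows "\<exists>w. \<forall>z. G w z = \<phi> z"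
proof -
  let ?f = "\<lambda>w. \<Sum>b\<in>Basis. G w b *\<^sub>R b"
  have f: "?f w \<bullet> z = G w z" for w z
    using linear_Basis_expand[OF linear_right, of w z]
    by (simp add: inner_sum_left inner_sum_right inner_commute[of z] mult.commute)
  have "linear ?f"
    by (rule linearI) (simp_all add: scaleR_add_left sum.distrib scaleR_sum_right)
  moreover have "inj ?f"
    by (rule injI) (metis f nondegenerate)
  ultimately have "surj ?f" by (rule linear_inj_imp_surj)
  from surjD[OF this, of "\<Sum>b\<in>Basis. \<phi> b *\<^sub>R b"]
  obtain w where w: "?f w = (\<Sum>b\<in>Basis. \<phi> b *\<^sub>R b)" by auto
  have "G w z = \<phi> z" for z
    using f[of w z] linear_Basis_expand[OF assms, of z] unfolding w
    by (simp add: inner_sum_left inner_sum_right inner_commute[of z] mult.commute)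
  then show ?thesis by blast
qed

lemma the_riesz:
  assumes "linear \<phi>"
  shows "G (THE w. \<forall>z. G w z = \<phi> z) z = \<phi> z"
proof -
  obtain w where w: "\<forall>z. G w z = \<phi> z" using riesz[OF assms] by blast
  have "(THE w. \<forall>z. G w z = \<phi> z) = w"
    by (rule the_equality) (auto intro: nondegenerate simp: w)
  then show ?thesis using w by simp
qed

lemma bounded: "bounded_bilinear G"
  using bil by (simp add: bilinear_conv_bounded_bilinear)

text \<open>The minimum over the compact unit sphere is positive, and homogeneity extends the bound.
  It serves to estimate dual vectors and to bound orthonormal pairs.\<close>

lemma coercive: "\<exists>l>0. \<forall>z. G z z \<ge> l * (norm z)\<^sup>2"
proof -
  have c: "continuous_on (sphere 0 1) (\<lambda>z. G z z)"
    using bounded_bilinear.continuous_on[OF bounded continuous_on_id continuous_on_id] by simp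
  have "sphere (0::'a) 1 \<noteq> {}" by simp
  then obtain z0 where z0: "z0 \<in> sphere 0 1" "\<And>z. z \<in> sphere 0 1 \<Longrightarrow> G z0 z0 \<le> G z z"
    using continuous_attains_inf[OF compact_sphere _ c] by blast
  have "z0 \<noteq> 0" using z0(1) by auto
  have "G z z \<ge> G z0 z0 * (norm z)\<^sup>2" for z
  proof (cases "z = 0")
    case False
    then have "G z0 z0 \<le> G (z /\<^sub>R norm z) (z /\<^sub>R norm z)" by (intro z0) simp
    also have "\<dots> = G z z / (norm z)\<^sup>2" by (simp add: power2_eq_square field_simps)
    finally show ?thesis using False by (simp add: field_simps)
  qed simp
  then show ?thesis using pos[OF \<open>z0 \<noteq> 0\<close>] by blast
qed

end

section \<open>Metrics in a chart\<close>

locale metric_chart =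
  fixes S :: "'a::euclidean_space set" and g :: "'a coord_metric"
  assumes open_S: "open S"
    and inner_form: "u \<in> S \<Longrightarrow> inner_form (g u)"
    and smooth_g: "smooth_on S (\<lambda>u. g u x y)"
begin

lemma linear_g_left: "u \<in> S \<Longrightarrow> linear (\<lambda>x. g u x y)"
  and linear_g_right: "u \<in> S \<Longrightarrow> linear (g u x)"
  by (simp_all add: inner_form.linear_left[OF inner_form] inner_form.linear_right[OF inner_form])

lemma g_sym: "u \<in> S \<Longrightarrow> g u x y = g u y x"
  by (rule inner_form.sym[OF inner_form])

text \<open>The vectors \<open>sharp u b\<close> for \<open>b\<close> in \<open>Basis\<close> are
  the columns of the inverse metric matrix. Their smoothness replaces the smoothness of matrix
  inversion.\<close>

definition sharp :: "'a \<Rightarrow> 'a \<Rightarrow> 'a" where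
  "sharp u x = (THE w. \<forall>z. g u w z = x \<bullet> z)"

lemma g_sharp: "u \<in> S \<Longrightarrow> g u (sharp u x) z = x \<bullet> z"
  unfolding sharp_def
  by (intro inner_form.the_riesz inner_form bounded_linear.linear bounded_linear_inner_right)

lemma dderiv_g_zero:
  assumes "u \<in> S" "smooth_on S V"
  shows "((\<lambda>q. g q (V q) z) has_derivative (\<lambda>v. dderiv (\<lambda>q. g q (V u) z) u v + g u (dderiv V u v) z)) (at u)"
proof -
  have "smooth_on S (\<lambda>q. g q (V q) z)"
    using smooth_on_family[of S "\<lambda>q x. g q x z"] open_S linear_g_left smooth_g assms by blast
  from smooth_on_has_derivative[OF this open_S assms(1)]
  show ?thesis
    using dderiv_family[of S "\<lambda>q x. g q x z", OF open_S linear_g_left smooth_g assms(2,1)] by simp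
qed

text \<open>
  Differentiating \<open>g(b\<^sup>\<sharp>, z) = b \<bullet> z\<close> shows that the derivative of \<open>b\<^sup>\<sharp>\<close> is a polynomial in the
  \<open>b\<^sup>\<sharp>\<close> and the first derivatives of \<open>g\<close>, so smoothness follows by bootstrapping.
\<close>

lemma sharp_has_derivative:
  assumes u: "u \<in> S"
  shows "((\<lambda>q. sharp q b) has_derivative
    (\<lambda>v. - (\<Sum>b'\<in>Basis. dderiv (\<lambda>q. g q (sharp u b) b') u v *\<^sub>R sharp u b'))) (at u)"
    (is "(_ has_derivative ?L) _")
proof -
  interpret u: inner_form "g u" using inner_form u .
  have lin_dg: "linear (dderiv (\<lambda>q. g q x z) u)" for x z
    by (rule linear_dderiv[OF smooth_g open_S u])
  have lin_L: "linear ?L"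
    by (rule linearI)
      (simp_all add: linear_add[OF lin_dg] linear_scale[OF lin_dg] scaleR_add_left sum.distrib scaleR_sum_right)
  then have bl_L: "bounded_linear ?L" by (rule linear_conv_bounded_linear[THEN iffD1])
  have g_L: "g u (?L v) z = - dderiv (\<lambda>q. g q (sharp u b) z) u v" for v z
  proof -
    have "linear (\<lambda>z. dderiv (\<lambda>q. g q (sharp u b) z) u v)"
      by (intro linear_dderiv_family[of S] open_S linear_g_right smooth_g u)
    from linear_Basis_expand[OF this, of z]
    show ?thesis by (simp add: u.sum_left g_sharp[OF u] inner_commute[of _ z] mult.commute)
  qed
  \<comment> \<open>First-order candidate for \<open>sharp q b\<close>. The formula
    \<open>?L\<close> is forced by differentiating the identity that defines \<open>sharp\<close>;
    \<open>T\<close> below says that \<open>W\<close> satisfies this identity up to an error of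
    order o(norm (q - u)).\<close>
  define W where "W q = sharp u b + ?L (q - u)" for q
  have "(W has_derivative ?L) (at q)" for q
  proof -
    have "((\<lambda>q. sharp u b + ?L (q - u)) has_derivative (\<lambda>v. 0 + ?L (v - 0))) (at q)"
      by (intro has_derivative_add has_derivative_const bounded_linear.has_derivative[OF bl_L]
          has_derivative_diff has_derivative_ident)
    then show ?thesis by (simp add: W_def[abs_def])
  qed
  note dW = dderiv_eq(1)[OF this] and diffW = dderiv_eq(2)[OF this]
  have smW: "smooth_on S W"
    unfolding smooth_on_def
  proof
    fix k show "Ck_on k S W"
    proof (cases k)
      case 0
      show ?thesis unfolding 0 Ck_on.simps
        by (intro differentiable_imp_continuous_on differentiable_at_imp_differentiable_on diffW)
    next
      case (Suc k')
      show ?thesis unfolding Suc Ck_on_Suc_open[OF open_S] dW using diffW Ck_on_const[OF open_S] by blast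
    qed
  qed
  have Wu: "W u = sharp u b" using linear_0[OF lin_L] by (simp add: W_def)
  have T: "((\<lambda>q. g q (W q) z) has_derivative (\<lambda>v. 0)) (at u)" for z
    using dderiv_g_zero[OF u smW, of z] unfolding Wu dW g_L by simp
  obtain l where l: "l > 0" "\<And>z. g u z z \<ge> l * (norm z)\<^sup>2" using u.coercive by blast
  define N where "N = real DIM('a)"
  have "N > 0" unfolding N_def by simp
  have near: "\<exists>d>0. \<forall>q. norm (q - u) < d \<longrightarrow> \<bar>g q b' b'' - g u b' b''\<bar> \<le> l / (2 * N * N)"
    for b' b''
  proof -
    have "isCont (\<lambda>q. g q b' b'') u"
      using smooth_on_continuous_on[OF smooth_g] open_S u continuous_on_eq_continuous_at by blast
    moreover have "l / (2 * N * N) > 0" using l \<open>N > 0\<close> by simp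
    ultimately show ?thesis unfolding continuous_at_eps_delta dist_norm real_norm_def
      by (meson less_imp_le)
  qed
  show ?thesis
    unfolding has_derivative_at_alt
  proof (intro conjI allI impI bl_L)
    fix e :: real assume "e > 0"
    \<comment> \<open>Summing over \<open>N\<close> basis vectors and dividing by the coercivity
      constant \<open>l / 2\<close> turns this bound back into \<open>e\<close>.\<close>
    define \<epsilon> where "\<epsilon> = e * l / (2 * N)"
    have "\<epsilon> > 0" using \<open>e > 0\<close> l \<open>N > 0\<close> by (simp add: \<epsilon>_def)
    then have "\<exists>d>0. \<forall>q. norm (q - u) < d \<longrightarrow> \<bar>g q (W q) b' - b \<bullet> b'\<bar> \<le> \<epsilon> * norm (q - u)" for b'
      using T[of b'] unfolding has_derivative_at_alt Wu g_sharp[OF u] by simp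
    then obtain d1 where d1: "\<And>b'. d1 b' > 0"
      "\<And>b' q. norm (q - u) < d1 b' \<Longrightarrow> \<bar>g q (W q) b' - b \<bullet> b'\<bar> \<le> \<epsilon> * norm (q - u)"
      by metis
    obtain d2 where d2: "\<And>b' b''. d2 b' b'' > 0"
      "\<And>b' b'' q. norm (q - u) < d2 b' b'' \<Longrightarrow> \<bar>g q b' b'' - g u b' b''\<bar> \<le> l / (2 * N * N)"
      using near by metis
    obtain d3 where d3: "d3 > 0" "ball u d3 \<subseteq> S" using open_S u openE by blast
    define d where "d = Min ({d3} \<union> d1 ` Basis \<union> (\<lambda>(b', b''). d2 b' b'') ` (Basis \<times> Basis))"
    have "d > 0" using d3 d1 d2 by (auto simp: d_def)
    moreover have "norm (sharp q b - sharp u b - ?L (q - u)) \<le> e * norm (q - u)"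
      if q: "norm (q - u) < d" for q
    proof -
      have le: "d \<le> d3" "b' \<in> Basis \<Longrightarrow> d \<le> d1 b'" "b' \<in> Basis \<Longrightarrow> b'' \<in> Basis \<Longrightarrow> d \<le> d2 b' b''" for b' b''
        unfolding d_def by (intro Min_le; force)+
      have "q \<in> S" using q d3 le(1) by (auto simp: dist_norm norm_minus_commute)
      interpret q: inner_form "g q" using inner_form[OF \<open>q \<in> S\<close>] .
      define \<Delta> where "\<Delta> = sharp q b - W q"
      have comp: "\<bar>\<Delta> \<bullet> b'\<bar> \<le> norm \<Delta>" if "b' \<in> Basis" for b' using Basis_le_norm[OF that] .
      \<comment> \<open>Half of the coercivity at \<open>u\<close> survives at \<open>q\<close>:
        each of the N^2 entries of the metric has moved by at most l / (2 N^2).\<close>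
      have "l * (norm \<Delta>)\<^sup>2 - l / 2 * (norm \<Delta>)\<^sup>2 \<le> g q \<Delta> \<Delta>"
      proof -
        have expand: "g p \<Delta> \<Delta> = (\<Sum>b'\<in>Basis. \<Sum>b''\<in>Basis. (\<Delta> \<bullet> b') * (\<Delta> \<bullet> b'') * g p b' b'')" if "p \<in> S" for p
        proof -
          interpret p: inner_form "g p" using inner_form[OF that] .
          have "g p \<Delta> \<Delta> = (\<Sum>b'\<in>Basis. (\<Delta> \<bullet> b') * g p b' \<Delta>)"
            using linear_Basis_expand[OF p.linear_left, of \<Delta> \<Delta>] by simp
          also have "\<dots> = (\<Sum>b'\<in>Basis. \<Sum>b''\<in>Basis. (\<Delta> \<bullet> b') * (\<Delta> \<bullet> b'') * g p b' b'')"
            using linear_Basis_expand[OF p.linear_right, of _ \<Delta>] by (simp add: sum_distrib_left mult_ac)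
          finally show ?thesis .
        qed
        have "\<bar>g q \<Delta> \<Delta> - g u \<Delta> \<Delta>\<bar> = \<bar>\<Sum>b'\<in>Basis. \<Sum>b''\<in>Basis. (\<Delta> \<bullet> b') * (\<Delta> \<bullet> b'') * (g q b' b'' - g u b' b'')\<bar>"
          unfolding expand[OF \<open>q \<in> S\<close>] expand[OF u] by (simp add: sum_subtractf right_diff_distrib)
        also have "\<dots> \<le> (\<Sum>b'\<in>Basis. \<Sum>b''\<in>Basis. \<bar>(\<Delta> \<bullet> b') * (\<Delta> \<bullet> b'') * (g q b' b'' - g u b' b'')\<bar>)"
          by (intro order_trans[OF sum_abs] sum_mono order_refl)
        also have "\<dots> \<le> (\<Sum>b'\<in>(Basis::'a set). \<Sum>b''\<in>(Basis::'a set). norm \<Delta> * norm \<Delta> * (l / (2 * N * N)))"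
          unfolding abs_mult
          by (intro sum_mono mult_mono comp d2(2) less_le_trans[OF q le(3)]) auto
        also have "\<dots> = l / 2 * (norm \<Delta>)\<^sup>2"
          using \<open>N > 0\<close> by (simp add: N_def[symmetric] power2_eq_square)
        finally have "g u \<Delta> \<Delta> - g q \<Delta> \<Delta> \<le> l / 2 * (norm \<Delta>)\<^sup>2" by linarith
        then show ?thesis using l(2)[of \<Delta>] by linarith
      qed
      also have "g q \<Delta> \<Delta> = (\<Sum>b'\<in>Basis. (\<Delta> \<bullet> b') * (b \<bullet> b' - g q (W q) b'))"
      proof -
        have "g q \<Delta> b' = b \<bullet> b' - g q (W q) b'" for b'
          by (simp add: \<Delta>_def g_sharp[OF \<open>q \<in> S\<close>])
        then show ?thesis
          using linear_Basis_expand[OF q.linear_right, of \<Delta> \<Delta>] by simp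
      qed
      also have "\<dots> \<le> (\<Sum>b'\<in>(Basis::'a set). norm \<Delta> * (\<epsilon> * norm (q - u)))"
      proof (rule sum_mono)
        fix b' :: 'a assume b': "b' \<in> Basis"
        have "\<bar>(\<Delta> \<bullet> b') * (b \<bullet> b' - g q (W q) b')\<bar> \<le> norm \<Delta> * (\<epsilon> * norm (q - u))"
          unfolding abs_mult using d1(2)[OF less_le_trans[OF q le(2)[OF b']]]
          by (intro mult_mono comp b') (auto simp: abs_minus_commute)
        then show "(\<Delta> \<bullet> b') * (b \<bullet> b' - g q (W q) b') \<le> norm \<Delta> * (\<epsilon> * norm (q - u))" by linarith
      qed
      also have "\<dots> = norm \<Delta> * (N * \<epsilon> * norm (q - u))" by (simp add: N_def)
      finally have "norm \<Delta> * (l / 2 * norm \<Delta>) \<le> norm \<Delta> * (N * \<epsilon> * norm (q - u))"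
        by (simp add: power2_eq_square algebra_simps)
      then have "l / 2 * norm \<Delta> \<le> N * \<epsilon> * norm (q - u)"
        using \<open>\<epsilon> > 0\<close> \<open>N > 0\<close> by (cases "norm \<Delta> = 0") (simp_all add: mult_le_cancel_left_pos)
      then have "norm \<Delta> \<le> e * norm (q - u)"
        using l \<open>N > 0\<close> by (simp add: \<epsilon>_def field_simps)
      then show ?thesis by (simp add: \<Delta>_def W_def algebra_simps)
    qed
    ultimately show "\<exists>d>0. \<forall>q. norm (q - u) < d \<longrightarrow> norm (sharp q b - sharp u b - ?L (q - u)) \<le> e * norm (q - u)"
      by blast
  qed
qed

lemma smooth_sharp: "smooth_on S (\<lambda>q. sharp q b)"
proof -
  note d = dderiv_eq[OF sharp_has_derivative]
  have "Ck_on k S (\<lambda>q. sharp q b)" for k b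
  proof (induction k arbitrary: b)
    case 0
    show ?case unfolding Ck_on.simps
      by (intro differentiable_imp_continuous_on differentiable_at_imp_differentiable_on d(2))
  next
    case (Suc k)
    \<comment> \<open>The derivative of the metric has \<open>sharp u b\<close> as frozen argument.
      Expanding it leaves derivatives for constant arguments only, which are smooth, times
      components of \<open>sharp\<close>, which the induction hypothesis covers.\<close>
    have *: "dderiv (\<lambda>q. sharp q b) u v = - (\<Sum>b'\<in>Basis.
        (\<Sum>b''\<in>Basis. (sharp u b \<bullet> b'') *\<^sub>R dderiv (\<lambda>q. g q b'' b') u v) *\<^sub>R sharp u b')"
      if u: "u \<in> S" for u v
    proof -
      have "linear (\<lambda>z. dderiv (\<lambda>q. g q z b') u v)" for b'
        by (intro linear_dderiv_family[of S] open_S linear_g_left smooth_g u)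
      from linear_Basis_expand[OF this, where w = "sharp u b"] show ?thesis unfolding d(1)[OF u] by simp
    qed
    have "Ck_on k S (\<lambda>u. dderiv (\<lambda>q. g q x y) u v)" for x y v
      using smooth_on_dderiv[OF smooth_g open_S] by (simp add: smooth_on_def)
    then have b: "Ck_on k S (\<lambda>u. - (\<Sum>b'\<in>Basis.
        (\<Sum>b''\<in>Basis. (sharp u b \<bullet> b'') *\<^sub>R dderiv (\<lambda>q. g q b'' b') u v) *\<^sub>R sharp u b'))" for v
      by (intro Ck_on_sum Ck_on_bilinear[OF _ bounded_bilinear_scaleR] Suc open_S
        Ck_on_linear[OF _ bounded_linear_inner_left] Ck_on_linear[OF _ bounded_linear_minus[OF bounded_linear_ident]])
    have "Ck_on k S (\<lambda>u. dderiv (\<lambda>q. sharp q b) u v)" for v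
      by (rule Ck_on_congI[OF open_S b]) (rule *)
    then show ?case unfolding Ck_on_Suc_open[OF open_S] using d(2) by blast
  qed
  then show ?thesis by (simp add: smooth_on_def)
qed

end

section \<open>Levi-Civita connection, curvature and the Bianchi identities in a chart\<close>

context metric_chart
begin

definition koszul :: "'a \<Rightarrow> 'a \<Rightarrow> 'a \<Rightarrow> 'a \<Rightarrow> real" where
  "koszul u x y z =
    (dderiv (\<lambda>q. g q y z) u x + dderiv (\<lambda>q. g q x z) u y - dderiv (\<lambda>q. g q x y) u z) / 2"

lemma linear_dg:
  assumes "u \<in> S"
  shows "linear (dderiv (\<lambda>q. g q x y) u)" "linear (\<lambda>x. dderiv (\<lambda>q. g q x y) u v)"
    "linear (\<lambda>y. dderiv (\<lambda>q. g q x y) u v)"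
  by (rule linear_dderiv[OF smooth_g open_S assms])
    (rule linear_dderiv_family[of S "\<lambda>q x. g q x y", OF open_S linear_g_left smooth_g assms],
      assumption, rule linear_dderiv_family[of S "\<lambda>q. g q x", OF open_S linear_g_right smooth_g assms])

lemma dg_sym: "u \<in> S \<Longrightarrow> dderiv (\<lambda>q. g q x y) u = dderiv (\<lambda>q. g q y x) u"
  by (rule dderiv_cong[OF open_S _ g_sym smooth_on_differentiable[OF smooth_g open_S]])

lemma linear_koszul:
  assumes "u \<in> S"
  shows "linear (\<lambda>x. koszul u x y z)" "linear (\<lambda>y. koszul u x y z)" "linear (\<lambda>z. koszul u x y z)"
  unfolding koszul_def
  by (rule linearI; simp add: linear_dg[OF assms, THEN linear_add] linear_dg[OF assms, THEN linear_scale]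
      field_simps)+

lemma g_christoffel: "u \<in> S \<Longrightarrow> g u (christoffel g u x y) z = koszul u x y z"
  using inner_form.the_riesz[OF inner_form linear_koszul(3), of u u x y z]
  unfolding christoffel_def koszul_def by simp

lemma christoffel_eqI:
  "u \<in> S \<Longrightarrow> (\<And>z. g u w z = koszul u x y z) \<Longrightarrow> christoffel g u x y = w"
  by (rule inner_form.nondegenerate[OF inner_form, of u]) (simp_all add: g_christoffel[of u])

lemma smooth_koszul: "smooth_on S (\<lambda>u. koszul u x y z)"
  unfolding koszul_def divide_inverse by (intro smooth_intros open_S smooth_g)

text \<open>Raising the index of the Koszul form with \<open>sharp\<close>. The description by
  \<open>THE\<close> gives no smoothness; this one does.\<close>

lemma christoffel_expand:
  assumes u: "u \<in> S"
  shows "christoffel g u x y = (\<Sum>b\<in>Basis. koszul u x y b *\<^sub>R sharp u b)"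
proof (rule christoffel_eqI[OF u])
  fix z
  interpret u: inner_form "g u" using inner_form[OF u] .
  show "g u (\<Sum>b\<in>Basis. koszul u x y b *\<^sub>R sharp u b) z = koszul u x y z"
    using linear_Basis_expand[OF linear_koszul(3)[OF u], where w = z]
    by (simp add: u.sum_left g_sharp[OF u] inner_commute[of _ z] mult.commute)
qed

lemma smooth_christoffel: "smooth_on S (\<lambda>u. christoffel g u x y)"
proof -
  have "smooth_on S (\<lambda>u. \<Sum>b\<in>Basis. koszul u x y b *\<^sub>R sharp u b)"
    by (intro smooth_intros open_S smooth_koszul smooth_sharp)
  then show ?thesis
    by (rule smooth_on_congI[OF open_S]) (rule christoffel_expand)
qed

lemma christoffel_sym: "u \<in> S \<Longrightarrow> christoffel g u x y = christoffel g u y x"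
  by (rule christoffel_eqI) (simp_all add: g_christoffel koszul_def dg_sym[of u x y] add.commute)

lemma linear_christoffel:
  assumes u: "u \<in> S"
  shows "linear (christoffel g u x)" "linear (\<lambda>x. christoffel g u x y)"
proof -
  interpret u: inner_form "g u" using inner_form[OF u] .
  note k = linear_koszul[OF u, THEN linear_add] linear_koszul[OF u, THEN linear_scale]
  show "linear (christoffel g u x)" for x
    by (rule linearI) (rule christoffel_eqI[OF u], simp add: g_christoffel[OF u] k)+
  then show "linear (\<lambda>x. christoffel g u x y)"
    by (subst christoffel_sym[OF u])
qed

lemmas christoffel_simps =
  linear_christoffel[THEN linear_add] linear_christoffel[THEN linear_scale]
  linear_christoffel[THEN linear_0] linear_christoffel[THEN linear_neg] linear_christoffel[THEN linear_diff]

text \<open>In the sum of the Koszul expressions for (x, y, z) and (x, z, y) the derivatives along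
  \<open>y\<close> and \<open>z\<close> cancel and the two halves of the derivative along
  \<open>x\<close> add up.\<close>

lemma metric_compat:
  assumes "u \<in> S"
  shows "dderiv (\<lambda>q. g q y z) u x = g u (christoffel g u x y) z + g u y (christoffel g u x z)"
  using assms g_sym[of u y "christoffel g u x z"] dg_sym[of u y z] dg_sym[of u x y] dg_sym[of u x z]
  by (simp add: g_christoffel koszul_def field_simps)

abbreviation dchr :: "'a \<Rightarrow> 'a \<Rightarrow> 'a \<Rightarrow> 'a \<Rightarrow> 'a" where
  "dchr u v x y \<equiv> dderiv (\<lambda>q. christoffel g q x y) u v"

lemma dchr_sym: "u \<in> S \<Longrightarrow> dchr u v x y = dchr u v y x"
  by (intro fun_cong[OF dderiv_cong[OF open_S _ christoffel_sym
        smooth_on_differentiable[OF smooth_christoffel open_S]]])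

lemma linear_dchr:
  assumes "u \<in> S"
  shows "linear (\<lambda>v. dchr u v x y)" "linear (\<lambda>x. dchr u v x y)" "linear (\<lambda>y. dchr u v x y)"
  by (rule linear_dderiv[OF smooth_christoffel open_S assms])
    (rule linear_dderiv_family[of S "\<lambda>q x. christoffel g q x y",
        OF open_S linear_christoffel(2) smooth_christoffel assms], assumption,
      rule linear_dderiv_family[of S "\<lambda>q. christoffel g q x",
        OF open_S linear_christoffel(1) smooth_christoffel assms])

lemma levi_civita_const: "levi_civita g (\<lambda>_. x) (\<lambda>_. y) = (\<lambda>u. christoffel g u x y)"
  by (simp add: levi_civita_def fun_eq_iff)

text \<open>Constant coordinate fields commute, so the bracket term drops out.\<close>

lemma riem_eq:
  assumes "u \<in> S"
  shows "riem g u x y z = dchr u x y z - dchr u y x z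
    + christoffel g u x (christoffel g u y z) - christoffel g u y (christoffel g u x z)"
  unfolding riem_def curv_op_def levi_civita_const lie_bracket_def
  by (simp add: levi_civita_def christoffel_simps[OF assms])

lemma smooth_christoffel_field:
  "smooth_on S W \<Longrightarrow> smooth_on S (\<lambda>q. christoffel g q x (W q))"
  by (rule smooth_on_family[OF open_S linear_christoffel(1) smooth_christoffel])

lemma dderiv_christoffel_field:
  "u \<in> S \<Longrightarrow> smooth_on S W \<Longrightarrow>
    dderiv (\<lambda>q. christoffel g q x (W q)) u v = dchr u v x (W u) + christoffel g u x (dderiv W u v)"
  by (rule dderiv_family[OF open_S linear_christoffel(1) smooth_christoffel])

lemma smooth_riem: "smooth_on S (\<lambda>u. riem g u x y z)"
proof -
  have "smooth_on S (\<lambda>u. dchr u x y z - dchr u y x z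
    + christoffel g u x (christoffel g u y z) - christoffel g u y (christoffel g u x z))"
    by (intro smooth_intros open_S smooth_christoffel smooth_christoffel_field)
  then show ?thesis
    by (rule smooth_on_congI[OF open_S]) (rule riem_eq)
qed

lemma linear_riem:
  assumes "u \<in> S"
  shows "linear (\<lambda>x. riem g u x y z)" "linear (\<lambda>y. riem g u x y z)" "linear (riem g u x y)"
  by (rule linearI; simp add: riem_eq[OF assms] christoffel_simps[OF assms]
      linear_dchr[OF assms, THEN linear_add] linear_dchr[OF assms, THEN linear_scale] algebra_simps)+

text \<open>The integrability condition of \<open>\<nabla>P = 0\<close>.\<close>

lemma parallel_form:
  fixes P :: "'a \<Rightarrow> 'a \<Rightarrow> 'a \<Rightarrow> real"
  assumes U: "open U" "U \<subseteq> S"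
    and P: "\<And>u. u \<in> U \<Longrightarrow> bilinear (P u)" "\<And>x y. smooth_on U (\<lambda>u. P u x y)"
    and par: "\<And>u x y z. u \<in> U \<Longrightarrow> dderiv (\<lambda>q. P q y z) u x =
      P u (christoffel g u x y) z + P u y (christoffel g u x z)"
    and u: "u \<in> U"
  shows "P u (riem g u x y z) w + P u z (riem g u x y w) = 0"
proof -
  have uS: "u \<in> S" using u U by auto
  note sc = smooth_on_subset[OF open_S U smooth_christoffel] and sK = smooth_on_const[OF U(1)]
  note add = bilinear_ladd[OF P(1)[OF u]] bilinear_radd[OF P(1)[OF u]]
    and sub = bilinear_lsub[OF P(1)[OF u]] bilinear_rsub[OF P(1)[OF u]]
  \<comment> \<open>The two terms with a Christoffel symbol in both slots are exchanged by swapping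
    \<open>x\<close> and \<open>y\<close>. Symmetry of second derivatives therefore leaves only what
    \<open>riem_eq\<close> collects into the curvature.\<close>
  have second: "dderiv (\<lambda>q. dderiv (\<lambda>q. P q z w) q x) u y =
     P u (christoffel g u y (christoffel g u x z)) w + P u (christoffel g u x z) (christoffel g u y w)
     + P u (dchr u y x z) w
     + P u (christoffel g u y z) (christoffel g u x w) + P u z (christoffel g u y (christoffel g u x w))
     + P u z (dchr u y x w)" for x y
  proof -
    have "dderiv (\<lambda>q. dderiv (\<lambda>q. P q z w) q x) u y =
      dderiv (\<lambda>q. P q (christoffel g q x z) w + P q z (christoffel g q x w)) u y"
      by (intro fun_cong[OF dderiv_cong[OF U(1) u par]]
          smooth_on_differentiable[OF smooth_on_dderiv[OF P(2) U(1)] U(1) u])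
    also have "\<dots> = dderiv (\<lambda>q. P q (christoffel g q x z) w) u y + dderiv (\<lambda>q. P q z (christoffel g q x w)) u y"
      by (intro dderiv_add smooth_on_differentiable[OF _ U(1) u]
          smooth_form_fields[OF U(1) P sc sK] smooth_form_fields[OF U(1) P sK sc])
    also have "dderiv (\<lambda>q. P q (christoffel g q x z) w) u y =
      P u (christoffel g u y (christoffel g u x z)) w + P u (christoffel g u x z) (christoffel g u y w)
      + P u (dchr u y x z) w"
      using dderiv_form_fields[OF U(1) P sc smooth_on_const[OF U(1), of w] u, of x z y]
      by (simp add: par[OF u] bilinear_rzero[OF P(1)[OF u]])
    also have "dderiv (\<lambda>q. P q z (christoffel g q x w)) u y =
      P u (christoffel g u y z) (christoffel g u x w) + P u z (christoffel g u y (christoffel g u x w))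
      + P u z (dchr u y x w)"
      using dderiv_form_fields[OF U(1) P smooth_on_const[OF U(1), of z] sc u, of x w y]
      by (simp add: par[OF u] bilinear_lzero[OF P(1)[OF u]])
    finally show ?thesis by simp
  qed
  have "dderiv (\<lambda>q. dderiv (\<lambda>q. P q z w) q x) u y = dderiv (\<lambda>q. dderiv (\<lambda>q. P q z w) q y) u x"
    by (rule dderiv_symmetric[OF U(1) P(2) u])
  then show ?thesis
    unfolding second riem_eq[OF uS] add sub by linarith
qed

lemma bilinear_g: "u \<in> S \<Longrightarrow> bilinear (g u)"
  by (rule inner_form.bil[OF inner_form])

lemma riem_swap: "u \<in> S \<Longrightarrow> riem g u x y z = - riem g u y x z"
  by (simp add: riem_eq)

lemma riem4_swap12: "u \<in> S \<Longrightarrow> riem4 g u x y z w = - riem4 g u y x z w"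
  unfolding riem4_def by (subst riem_swap) (simp_all add: bilinear_lneg[OF bilinear_g])

text \<open>The metric itself is a parallel form, so this is \<open>parallel_form\<close> with
  \<open>P = g\<close>.\<close>

lemma riem4_swap34:
  assumes u: "u \<in> S"
  shows "riem4 g u x y z w = - riem4 g u x y w z"
proof -
  have "g u (riem g u x y z) w + g u z (riem g u x y w) = 0"
    by (rule parallel_form[of S g]) (simp_all add: open_S bilinear_g smooth_g metric_compat u)
  then show ?thesis
    by (simp add: riem4_def g_sym[OF u, of "riem g u x y w" z])
qed

lemma riem_bianchi1:
  assumes u: "u \<in> S"
  shows "riem g u x y z + riem g u y z x + riem g u z x y = 0"
  unfolding riem_eq[OF u] christoffel_sym[OF u, of y z] christoffel_sym[OF u, of x z]
    christoffel_sym[OF u, of x y] dchr_sym[OF u, where v = x and x = y and y = z]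
    dchr_sym[OF u, where v = y and x = x and y = z] dchr_sym[OF u, where v = z and x = x and y = y]
  by simp

lemma riem4_bianchi1:
  assumes "u \<in> S"
  shows "riem4 g u x y z w + riem4 g u y z x w + riem4 g u z x y w = 0"
  using arg_cong[OF riem_bianchi1[OF assms, of x y z], of "\<lambda>v. g u v w"]
  by (simp add: riem4_def bilinear_ladd[OF bilinear_g[OF assms]] bilinear_lzero[OF bilinear_g[OF assms]])

text \<open>The octahedron argument: four instances of the first Bianchi identity, combined with the
  skew symmetries in both pairs.\<close>

lemma riem4_pair_sym:
  assumes "u \<in> S"
  shows "riem4 g u x y z w = riem4 g u z w x y"
  using riem4_bianchi1[OF assms, of x y z w] riem4_bianchi1[OF assms, of y z w x]
    riem4_bianchi1[OF assms, of z w x y] riem4_bianchi1[OF assms, of w x y z]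
    riem4_swap12[OF assms, of z x y w] riem4_swap12[OF assms, of w y z x]
    riem4_swap34[OF assms, of y z x w] riem4_swap34[OF assms, of z w y x]
    riem4_swap34[OF assms, of w x z y] riem4_swap34[OF assms, of x y w z]
    riem4_swap34[OF assms, of x z w y] riem4_swap34[OF assms, of y w x z]
    riem4_swap12[OF assms, of y w x z]
  by linarith

lemma linear_riem4:
  assumes "u \<in> S"
  shows "linear (\<lambda>x. riem4 g u x y z w)" "linear (\<lambda>y. riem4 g u x y z w)"
    "linear (\<lambda>z. riem4 g u x y z w)" "linear (\<lambda>w. riem4 g u x y z w)"
  unfolding riem4_def
  by (rule linearI; simp add: linear_riem[OF assms, THEN linear_add] linear_riem[OF assms, THEN linear_scale]
      bilinear_ladd[OF bilinear_g[OF assms]] bilinear_lmul[OF bilinear_g[OF assms]]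
      bilinear_radd[OF bilinear_g[OF assms]] bilinear_rmul[OF bilinear_g[OF assms]])+

lemma smooth_riem4: "smooth_on S (\<lambda>u. riem4 g u x y z w)"
  unfolding riem4_def
  using smooth_form_fields[where P = g and V = "\<lambda>q. riem g q x y z" and W = "\<lambda>_. w",
      OF open_S bilinear_g smooth_g smooth_riem smooth_on_const[OF open_S]] .

definition nabla_riem4 :: "'a \<Rightarrow> 'a \<Rightarrow> 'a \<Rightarrow> 'a \<Rightarrow> 'a \<Rightarrow> 'a \<Rightarrow> real" where
  "nabla_riem4 u v x y z w = dderiv (\<lambda>q. riem4 g q x y z w) u v
    - riem4 g u (christoffel g u v x) y z w - riem4 g u x (christoffel g u v y) z w
    - riem4 g u x y (christoffel g u v z) w - riem4 g u x y z (christoffel g u v w)"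

lemma nabla_riem4_eq:
  assumes u: "u \<in> S"
  shows "nabla_riem4 u v x y z w = g u (dderiv (\<lambda>q. riem g q x y z) u v
    + christoffel g u v (riem g u x y z) - riem g u x y (christoffel g u v z)) w
    - riem4 g u (christoffel g u v x) y z w - riem4 g u x (christoffel g u v y) z w"
proof -
  have "dderiv (\<lambda>q. riem4 g q x y z w) u v =
      dderiv (\<lambda>q. g q (riem g u x y z) w) u v + g u (dderiv (\<lambda>q. riem g q x y z) u v) w"
    unfolding riem4_def
    using dderiv_form_fields[where P = g and V = "\<lambda>q. riem g q x y z" and W = "\<lambda>_. w" and x = v,
        OF open_S bilinear_g smooth_g smooth_riem smooth_on_const[OF open_S] u]
    by (simp add: bilinear_rzero[OF bilinear_g[OF u]])
  then show ?thesis
    unfolding nabla_riem4_def metric_compat[OF u]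
    by (simp add: riem4_def bilinear_ladd[OF bilinear_g[OF u]] bilinear_lsub[OF bilinear_g[OF u]])
qed

lemma dderiv_riem:
  assumes u: "u \<in> S"
  shows "dderiv (\<lambda>q. riem g q x y z) u v =
    dderiv (\<lambda>q. dchr q x y z) u v - dderiv (\<lambda>q. dchr q y x z) u v
    + (dchr u v x (christoffel g u y z) + christoffel g u x (dchr u v y z))
    - (dchr u v y (christoffel g u x z) + christoffel g u y (dchr u v x z))"
proof -
  note hd = smooth_on_has_derivative[OF _ open_S u]
  have "((\<lambda>u. dchr u x y z - dchr u y x z
    + christoffel g u x (christoffel g u y z) - christoffel g u y (christoffel g u x z)) has_derivative
    (\<lambda>v. dderiv (\<lambda>q. dchr q x y z) u v - dderiv (\<lambda>q. dchr q y x z) u v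
    + dderiv (\<lambda>q. christoffel g q x (christoffel g q y z)) u v
    - dderiv (\<lambda>q. christoffel g q y (christoffel g q x z)) u v)) (at u)"
    by (intro has_derivative_add has_derivative_diff hd smooth_on_dderiv smooth_christoffel
        smooth_christoffel_field open_S)
  from has_derivative_transform_within_open[OF this open_S u riem_eq[symmetric]]
  show ?thesis
    by (simp add: dderiv_eq(1) dderiv_christoffel_field[OF u smooth_christoffel])
qed

text \<open>In the cyclic sum the second derivatives of the Christoffel symbols cancel by their
  symmetry and the products of lower order cancel algebraically. The corrections in the first two
  slots of the tensor cancel because the connection is torsion-free and the curvature is skew
  there.\<close>

lemma second_bianchi:
  assumes u: "u \<in> S"
  shows "nabla_riem4 u v x y z w + nabla_riem4 u x y v z w + nabla_riem4 u y v x z w = 0"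
proof -
  have "dderiv (\<lambda>q. dchr q x y z) u v = dderiv (\<lambda>q. dchr q v y z) u x" for v x y
    by (rule dderiv_symmetric[OF open_S smooth_christoffel u])
  note sym = this[of v x y] this[of x y v] this[of y v x]
  let ?B = "\<lambda>v x y. dderiv (\<lambda>q. riem g q x y z) u v
    + christoffel g u v (riem g u x y z) - riem g u x y (christoffel g u v z)"
  have B: "?B v x y + ?B x y v + ?B y v x = 0"
    unfolding dderiv_riem[OF u]
    by (simp add: riem_eq[OF u] sym christoffel_simps[OF u])
  have "g u (?B v x y) w + g u (?B x y v) w + g u (?B y v x) w = 0"
    using arg_cong[OF B, of "\<lambda>v. g u v w"]
    by (simp only: bilinear_ladd[OF bilinear_g[OF u]] bilinear_lzero[OF bilinear_g[OF u]])
  then show ?thesis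
    unfolding nabla_riem4_eq[OF u]
    using christoffel_sym[OF u, of v x] christoffel_sym[OF u, of v y] christoffel_sym[OF u, of x y]
      riem4_swap12[OF u, of "christoffel g u v x" y z w] riem4_swap12[OF u, of "christoffel g u v y" x z w]
      riem4_swap12[OF u, of "christoffel g u x y" v z w]
    by simp
qed

end

section \<open>Isometric immersions in charts\<close>

locale immersion_chart = M: metric_chart S g + N: metric_chart T gb
  for S :: "'a::euclidean_space set" and g :: "'a coord_metric"
    and T :: "'b::euclidean_space set" and gb :: "'b coord_metric" +
  fixes F :: "'a \<Rightarrow> 'b"
  assumes smooth_F: "smooth_on S F" and F_in: "u \<in> S \<Longrightarrow> F u \<in> T"
    and induced: "u \<in> S \<Longrightarrow> g u x y = gb (F u) (dderiv F u x) (dderiv F u y)"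
begin

abbreviation nab :: "'a \<Rightarrow> ('a \<Rightarrow> 'b) \<Rightarrow> 'a \<Rightarrow> 'b" where
  "nab x V \<equiv> ambient_nabla gb F (\<lambda>_. x) V"

lemma nab_eq: "nab x V u = dderiv V u x + christoffel gb (F u) (dderiv F u x) (V u)"
  by (simp add: ambient_nabla_def)

lemma compose_F:
  assumes "smooth_on T f"
  shows "smooth_on S (\<lambda>u. f (F u))"
    and "u \<in> S \<Longrightarrow> dderiv (\<lambda>q. f (F q)) u x = dderiv f (F u) (dderiv F u x)"
  using smooth_on_compose[OF M.open_S N.open_S _ smooth_F assms] F_in
  by (blast, intro dderiv_compose(1) smooth_on_differentiable[OF smooth_F M.open_S]
      smooth_on_differentiable[OF assms N.open_S])

lemma linear_dF: "u \<in> S \<Longrightarrow> linear (dderiv F u)"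
  by (rule linear_dderiv[OF smooth_F M.open_S])

lemmas dF_simps = linear_dF[THEN linear_add] linear_dF[THEN linear_scale] linear_dF[THEN linear_0]
  linear_dF[THEN linear_neg] linear_dF[THEN linear_diff]

lemma smooth_dF: "smooth_on S (\<lambda>u. dderiv F u x)"
  by (rule smooth_on_dderiv[OF smooth_F M.open_S])

lemma bilinear_christoffel: "u \<in> S \<Longrightarrow> bilinear (christoffel gb (F u))"
  using N.linear_christoffel[OF F_in] by (simp add: bilinear_def)

lemma bilinear_gb: "u \<in> S \<Longrightarrow> bilinear (gb (F u))"
  by (rule N.bilinear_g[OF F_in])

lemma smooth_christoffel_F:
  "smooth_on S V \<Longrightarrow> smooth_on S (\<lambda>q. christoffel gb (F q) (dderiv F q x) (V q))"
  by (rule smooth_form_fields[of S "\<lambda>q. christoffel gb (F q)", OF M.open_S bilinear_christoffel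
        compose_F(1)[OF N.smooth_christoffel] smooth_dF])

lemma smooth_nab:
  assumes V: "smooth_on S V"
  shows "smooth_on S (nab x V)"
  unfolding nab_eq[abs_def]
  by (rule smooth_on_add[OF M.open_S smooth_on_dderiv[OF V M.open_S] smooth_christoffel_F[OF V]])

lemma nab_compat:
  assumes u: "u \<in> S" and V: "smooth_on S V" and W: "smooth_on S W"
  shows "dderiv (\<lambda>q. gb (F q) (V q) (W q)) u x =
    gb (F u) (nab x V u) (W u) + gb (F u) (V u) (nab x W u)"
  using dderiv_form_fields[of S "\<lambda>q. gb (F q)", OF M.open_S bilinear_gb compose_F(1)[OF N.smooth_g] V W u, of x]
  unfolding nab_eq compose_F(2)[OF N.smooth_g u] N.metric_compat[OF F_in[OF u]]
  by (simp add: bilinear_ladd[OF bilinear_gb[OF u]] bilinear_radd[OF bilinear_gb[OF u]])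

text \<open>Curvature of the pulled-back connection. Second derivatives of \<open>V\<close> and of
  \<open>F\<close> are symmetric in \<open>x\<close> and \<open>y\<close>, as are the products of a
  first derivative of \<open>V\<close> with a Christoffel symbol, so only the ambient curvature
  survives. Constant fields commute, hence no bracket term.\<close>

lemma nab_curvature:
  assumes u: "u \<in> S" and V: "smooth_on S V"
  shows "nab x (nab y V) u - nab y (nab x V) u = riem gb (F u) (dderiv F u x) (dderiv F u y) (V u)"
proof -
  let ?G = "\<lambda>q. christoffel gb (F q)"
  have sm: "smooth_on S (\<lambda>q. ?G q (dderiv F q y) (V q))" for y
    by (rule smooth_christoffel_F[OF V])
  have d: "dderiv (nab y V) u x = dderiv (\<lambda>q. dderiv V q y) u x
      + dderiv (\<lambda>q. ?G q (dderiv F q y) (V q)) u x" for x y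
    unfolding nab_eq[abs_def]
    by (intro dderiv_add(1) smooth_on_differentiable[OF _ M.open_S u] sm smooth_on_dderiv[OF V M.open_S])
  have "dderiv (\<lambda>q. ?G q (dderiv F q y) (V q)) u x = N.dchr (F u) (dderiv F u x) (dderiv F u y) (V u)
      + ?G u (dderiv (\<lambda>q. dderiv F q y) u x) (V u) + ?G u (dderiv F u y) (dderiv V u x)" for x y
    using dderiv_form_fields[of S ?G, OF M.open_S bilinear_christoffel compose_F(1)[OF N.smooth_christoffel]
        smooth_dF V u, of y x]
    unfolding compose_F(2)[OF N.smooth_christoffel u] .
  note d = d[unfolded this]
  have "nab x (nab y V) u = dderiv (\<lambda>q. dderiv V q y) u x
      + N.dchr (F u) (dderiv F u x) (dderiv F u y) (V u)
      + ?G u (dderiv (\<lambda>q. dderiv F q y) u x) (V u) + ?G u (dderiv F u y) (dderiv V u x)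
      + ?G u (dderiv F u x) (dderiv V u y) + ?G u (dderiv F u x) (?G u (dderiv F u y) (V u))" for x y
    unfolding nab_eq[of x "nab y V"] d nab_eq[of y V]
    by (simp add: bilinear_radd[OF bilinear_christoffel[OF u]])
  then show ?thesis
    unfolding N.riem_eq[OF F_in[OF u]]
    using dderiv_symmetric[OF M.open_S V u, of x y] dderiv_symmetric[OF M.open_S smooth_F u, of x y]
    by simp
qed

abbreviation h :: "'a \<Rightarrow> 'a \<Rightarrow> 'a \<Rightarrow> 'b" where "h \<equiv> second_ff g gb F"

lemma second_ff_eq: "h u x y = nab x (\<lambda>q. dderiv F q y) u - dderiv F u (christoffel g u x y)"
  by (simp add: second_ff_def M.levi_civita_const)

lemma gauss_formula: "nab x (\<lambda>q. dderiv F q y) u = dderiv F u (christoffel g u x y) + h u x y"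
  by (simp add: second_ff_eq)

lemma nab_dF_sym: "u \<in> S \<Longrightarrow> nab x (\<lambda>q. dderiv F q y) u = nab y (\<lambda>q. dderiv F q x) u"
  unfolding nab_eq using dderiv_symmetric[OF M.open_S smooth_F, of u x y]
    N.christoffel_sym[OF F_in, of u "dderiv F u x" "dderiv F u y"] by simp

lemma h_sym: "u \<in> S \<Longrightarrow> h u x y = h u y x"
  unfolding second_ff_eq using nab_dF_sym[of u x y] M.christoffel_sym[of u x y] by simp

lemma dg_eq:
  assumes u: "u \<in> S"
  shows "dderiv (\<lambda>q. g q y z) u x = gb (F u) (nab x (\<lambda>q. dderiv F q y) u) (dderiv F u z)
    + gb (F u) (nab x (\<lambda>q. dderiv F q z) u) (dderiv F u y)"
  using nab_compat[OF u smooth_dF smooth_dF, of y z x]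
    dderiv_cong[OF M.open_S u induced smooth_on_differentiable[OF M.smooth_g M.open_S u], of y z]
    N.g_sym[OF F_in[OF u]] by simp

text \<open>The tangential part of the ambient derivative is torsion-free and compatible with the
  induced metric, so the Koszul formula identifies it with the Levi-Civita connection of
  \<open>g\<close>.\<close>

lemma h_normal:
  assumes u: "u \<in> S"
  shows "gb (F u) (h u x y) (dderiv F u z) = 0"
proof -
  have "gb (F u) (dderiv F u (christoffel g u x y)) (dderiv F u z) = M.koszul u x y z"
    using M.g_christoffel[OF u, of x y z] induced[OF u] by simp
  also have "\<dots> = gb (F u) (nab x (\<lambda>q. dderiv F q y) u) (dderiv F u z)"
    unfolding M.koszul_def dg_eq[OF u]
    using nab_dF_sym[OF u, of x y] nab_dF_sym[OF u, of x z] nab_dF_sym[OF u, of y z] by simp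
  finally show ?thesis
    unfolding second_ff_eq by (simp add: bilinear_lsub[OF bilinear_gb[OF u]])
qed

lemma h_normal': "u \<in> S \<Longrightarrow> gb (F u) (dderiv F u z) (h u x y) = 0"
  using h_normal[of u x y z] N.g_sym[OF F_in, of u "dderiv F u z" "h u x y"] by simp

lemma bilinear_h:
  assumes u: "u \<in> S"
  shows "bilinear (h u)"
proof -
  have l: "linear (h u x)" for x
  proof -
    have 1: "linear (\<lambda>y. dderiv (\<lambda>q. dderiv F q y) u x)"
      by (rule linear_dderiv_family[of S "dderiv F", OF M.open_S linear_dF smooth_dF u])
    show ?thesis
      unfolding second_ff_eq[abs_def] nab_eq
      by (rule linearI) (simp_all add: linear_add[OF 1] linear_scale[OF 1] dF_simps[OF u]
          M.christoffel_simps[OF u] N.christoffel_simps[OF F_in[OF u]] algebra_simps)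
  qed
  moreover have "linear (\<lambda>x. h u x y)" for y
    using l[of y] h_sym[OF u, of _ y] by simp
  ultimately show ?thesis by (simp add: bilinear_def)
qed

lemma smooth_h: "smooth_on S (\<lambda>u. h u x y)"
  unfolding second_ff_eq
  by (rule smooth_on_diff[OF M.open_S smooth_nab[OF smooth_dF]
      smooth_on_family[of S "dderiv F", OF M.open_S linear_dF smooth_dF M.smooth_christoffel]])

text \<open>Differentiating the tangential component of the ambient derivative once more moves a
  derivative onto the second factor; there the normal parts contribute
  \<open>gb (F u) (h u y z) (h u x w)\<close>. Skew-symmetrising in \<open>x\<close> and
  \<open>y\<close> and using \<open>nab_curvature\<close> gives the equation.\<close>

theorem gauss_equation:
  assumes u: "u \<in> S"
  shows "riem4 g u x y z w =
    riem4 gb (F u) (dderiv F u x) (dderiv F u y) (dderiv F u z) (dderiv F u w)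
    + gb (F u) (h u y z) (h u x w) - gb (F u) (h u x z) (h u y w)"
proof -
  let ?Z = "\<lambda>z q. dderiv F q z"
  note add = bilinear_ladd[OF bilinear_gb[OF u]] bilinear_radd[OF bilinear_gb[OF u]]
    bilinear_lsub[OF bilinear_gb[OF u]] 
  have *: "gb (F u) (nab x (nab y (?Z z)) u) (dderiv F u w) =
      g u (M.dchr u x y z + christoffel g u x (christoffel g u y z)) w - gb (F u) (h u y z) (h u x w)" for x y
  proof -
    have 1: "gb (F q) (nab y (?Z z) q) (?Z w q) = g q (christoffel g q y z) w" if "q \<in> S" for q
      unfolding gauss_formula induced[OF that]
      by (simp add: bilinear_ladd[OF bilinear_gb[OF that]] h_normal[OF that])
    have "gb (F u) (nab x (nab y (?Z z)) u) (?Z w u) + gb (F u) (nab y (?Z z) u) (nab x (?Z w) u)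
        = dderiv (\<lambda>q. gb (F q) (nab y (?Z z) q) (?Z w q)) u x"
      by (rule nab_compat[OF u smooth_nab[OF smooth_dF] smooth_dF, symmetric])
    also have "\<dots> = dderiv (\<lambda>q. g q (christoffel g q y z) w) u x"
      by (rule fun_cong[OF dderiv_cong[OF M.open_S u 1]])
        (assumption, rule smooth_on_differentiable[OF smooth_form_fields[of S "\<lambda>q. gb (F q)", OF M.open_S
          bilinear_gb compose_F(1)[OF N.smooth_g] smooth_nab[OF smooth_dF] smooth_dF] M.open_S u])
    also have "\<dots> = g u (M.dchr u x y z + christoffel g u x (christoffel g u y z)) w
        + g u (christoffel g u y z) (christoffel g u x w)"
      using dderiv_form_fields[where P = g and V = "\<lambda>q. christoffel g q y z" and W = "\<lambda>_. w" and x = x,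
          OF M.open_S M.bilinear_g M.smooth_g M.smooth_christoffel smooth_on_const[OF M.open_S] u]
      by (simp add: M.metric_compat[OF u] bilinear_rzero[OF M.bilinear_g[OF u]]
          bilinear_ladd[OF M.bilinear_g[OF u]])
    also have "gb (F u) (nab y (?Z z) u) (nab x (?Z w) u) =
        g u (christoffel g u y z) (christoffel g u x w) + gb (F u) (h u y z) (h u x w)"
      unfolding gauss_formula add induced[OF u]
      by (simp add: h_normal[OF u] h_normal'[OF u])
    finally show ?thesis by simp
  qed
  have "riem4 gb (F u) (dderiv F u x) (dderiv F u y) (dderiv F u z) (dderiv F u w) =
      gb (F u) (nab x (nab y (?Z z)) u) (dderiv F u w) - gb (F u) (nab y (nab x (?Z z)) u) (dderiv F u w)"
    unfolding riem4_def nab_curvature[OF u smooth_dF, symmetric] add by simp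
  then show ?thesis
    unfolding * riem4_def M.riem_eq[OF u]
    by (simp add: bilinear_ladd[OF M.bilinear_g[OF u]] bilinear_lsub[OF M.bilinear_g[OF u]])
qed

end

section \<open>Orthonormal frames\<close>

context inner_form
begin

definition orthonormal :: "nat \<Rightarrow> (nat \<Rightarrow> 'a) \<Rightarrow> bool" where
  "orthonormal k e \<longleftrightarrow> (\<forall>i\<in>{1..k}. \<forall>j\<in>{1..k}. G (e i) (e j) = (if i = j then 1 else 0))"

abbreviation frame :: "(nat \<Rightarrow> 'a) \<Rightarrow> bool" where "frame e \<equiv> orthonormal DIM('a) e"

lemma orthonormalD:
  "orthonormal k e \<Longrightarrow> i \<in> {1..k} \<Longrightarrow> j \<in> {1..k} \<Longrightarrow> G (e i) (e j) = (if i = j then 1 else 0)"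
  by (simp add: orthonormal_def)

lemma orthonormal_coeff:
  assumes "orthonormal k e" "i \<in> {1..k}"
  shows "G (\<Sum>j\<in>{1..k}. f j *\<^sub>R e j) (e i) = f i"
proof -
  have "G (\<Sum>j\<in>{1..k}. f j *\<^sub>R e j) (e i) = (\<Sum>j\<in>{1..k}. if j = i then f j else 0)"
    unfolding sum_left using assms by (intro sum.cong refl) (simp add: orthonormal_def)
  then show ?thesis using assms(2) by simp
qed

lemma orthonormal_card:
  assumes "orthonormal k e"
  shows "inj_on e {1..k}" "independent (e ` {1..k})"
proof -
  show inj: "inj_on e {1..k}"
  proof (rule inj_onI)
    fix i j assume "i \<in> {1..k}" "j \<in> {1..k}" "e i = e j"
    then show "i = j"
      using orthonormalD[OF assms, of i i] orthonormalD[OF assms, of i j] by (metis zero_neq_one)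
  qed
  show "independent (e ` {1..k})"
  proof (rule independent_if_scalars_zero)
    fix f x assume z: "(\<Sum>x\<in>e ` {1..k}. f x *\<^sub>R x) = 0" and "x \<in> e ` {1..k}"
    then obtain i where i: "i \<in> {1..k}" "x = e i" by auto
    have "(\<Sum>j\<in>{1..k}. f (e j) *\<^sub>R e j) = 0" using z unfolding sum.reindex[OF inj] by (simp add: o_def)
    then show "f x = 0" using orthonormal_coeff[OF assms i(1), of "\<lambda>j. f (e j)"] i by simp
  qed simp
qed

lemma orthonormal_le: "orthonormal k e \<Longrightarrow> k \<le> DIM('a)"
  using independent_bound[OF orthonormal_card(2)] card_image[OF orthonormal_card(1)] by fastforce

lemma orthonormal_snoc:
  assumes "orthonormal k e" "G v v = 1" "\<And>i. i \<in> {1..k} \<Longrightarrow> G v (e i) = 0"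
  shows "orthonormal (Suc k) (e(Suc k := v))"
  unfolding orthonormal_def
proof (intro ballI)
  have v: "G (e i) v = 0" if "i \<in> {1..k}" for i using assms(3)[OF that] sym[of "e i" v] by simp
  fix i j assume "i \<in> {1..Suc k}" "j \<in> {1..Suc k}"
  then consider "i \<in> {1..k}" "j \<in> {1..k}" | "i = Suc k" "j \<in> {1..k}" | "i \<in> {1..k}" "j = Suc k"
    | "i = Suc k" "j = Suc k" by (auto simp: le_Suc_eq)
  then show "G ((e(Suc k := v)) i) ((e(Suc k := v)) j) = (if i = j then 1 else 0)"
    by cases (use orthonormalD[OF assms(1), of i j] assms(2,3) v in auto)
qed

lemma normalise: "r \<noteq> 0 \<Longrightarrow> G (r /\<^sub>R sqrt (G r r)) (r /\<^sub>R sqrt (G r r)) = 1"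
  using pos[of r] by (simp add: field_simps)

lemma residual_orthogonal:
  assumes "orthonormal k e" "i \<in> {1..k}"
  shows "G (x - (\<Sum>j\<in>{1..k}. G x (e j) *\<^sub>R e j)) (e i) = 0"
  using orthonormal_coeff[OF assms, of "\<lambda>j. G x (e j)"] by simp

lemma orthonormal_extend_step:
  assumes "orthonormal k e" "x \<noteq> (\<Sum>j\<in>{1..k}. G x (e j) *\<^sub>R e j)"
  shows "\<exists>v. orthonormal (Suc k) (e(Suc k := v))"
proof -
  define r where "r = x - (\<Sum>j\<in>{1..k}. G x (e j) *\<^sub>R e j)"
  have "r \<noteq> 0" using assms(2) by (simp add: r_def)
  have "orthonormal (Suc k) (e(Suc k := r /\<^sub>R sqrt (G r r)))"
  proof (rule orthonormal_snoc[OF assms(1) normalise[OF \<open>r \<noteq> 0\<close>]])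
    fix i assume "i \<in> {1..k}"
    then have "G r (e i) = 0" unfolding r_def by (rule residual_orthogonal[OF assms(1)])
    then show "G (r /\<^sub>R sqrt (G r r)) (e i) = 0" by simp
  qed
  then show ?thesis by blast
qed

text \<open>A nonzero residual would extend the frame to \<open>DIM('a) + 1\<close> orthonormal
  vectors.\<close>

lemma frame_expand:
  assumes "frame e"
  shows "x = (\<Sum>i\<in>{1..DIM('a)}. G x (e i) *\<^sub>R e i)"
  using orthonormal_extend_step[OF assms, of x] orthonormal_le by (meson Suc_n_not_le_n)

lemma orthonormal_extend:
  assumes "orthonormal k e"
  shows "\<exists>e'. frame e' \<and> (\<forall>i\<in>{1..k}. e' i = e i)"
  using assms
proof (induction "DIM('a) - k" arbitrary: k e)
  case 0
  then show ?case using orthonormal_le[OF 0(2)] by (intro exI[of _ e]) simp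
next
  case (Suc m)
  then have k: "k < DIM('a)" by simp
  have "\<exists>x. x \<noteq> (\<Sum>j\<in>{1..k}. G x (e j) *\<^sub>R e j)"
  proof (rule ccontr)
    assume "\<not> ?thesis"
    then have *: "x = (\<Sum>j\<in>{1..k}. G x (e j) *\<^sub>R e j)" for x by blast
    have "x \<in> span (e ` {1..k})" for x
    proof -
      have "(\<Sum>j\<in>{1..k}. G x (e j) *\<^sub>R e j) \<in> span (e ` {1..k})"
        by (intro span_sum span_scale span_base imageI)
      then show ?thesis by (subst *[of x])
    qed
    then have "span (e ` {1..k}) = UNIV" by blast
    then have "DIM('a) \<le> card (e ` {1..k})"
      using dim_le_card'[of "e ` {1..k}"] dim_span[of "e ` {1..k}"] by simp
    also have "\<dots> \<le> k" using card_image_le[of "{1..k}" e] by simp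
    finally show False using k by simp
  qed
  then obtain v where v: "orthonormal (Suc k) (e(Suc k := v))"
    using orthonormal_extend_step[OF Suc.prems] by blast
  have "m = DIM('a) - Suc k" using Suc.hyps(2) by simp
  from Suc.hyps(1)[OF this v] obtain e' where
    e': "frame e'" "\<forall>i\<in>{1..Suc k}. e' i = (e(Suc k := v)) i" by blast
  then show ?case by (intro exI[of _ e']) auto
qed

lemma ex_frame: "\<exists>e. frame e"
  using orthonormal_extend[of 0] by (auto simp: orthonormal_def)

lemma frame_eqI:
  assumes "frame e" "\<And>i. i \<in> {1..DIM('a)} \<Longrightarrow> G x (e i) = G y (e i)"
  shows "x = y"
proof -
  have "(\<Sum>i\<in>{1..DIM('a)}. G x (e i) *\<^sub>R e i) = (\<Sum>i\<in>{1..DIM('a)}. G y (e i) *\<^sub>R e i)"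
    using assms(2) by (intro sum.cong) auto
  then show ?thesis
    by (rule trans[OF frame_expand[OF assms(1), of x] trans[OF _ frame_expand[OF assms(1), of y, symmetric]]])
qed

lemma frame_linear_expand:
  fixes L :: "'a \<Rightarrow> 'v::real_vector"
  assumes "frame e" "linear L"
  shows "L x = (\<Sum>i\<in>{1..DIM('a)}. G x (e i) *\<^sub>R L (e i))"
proof -
  interpret L: linear L by fact
  have "L x = L (\<Sum>i\<in>{1..DIM('a)}. G x (e i) *\<^sub>R e i)"
    by (rule arg_cong[OF frame_expand[OF assms(1), of x]])
  then show ?thesis by (simp add: L.sum L.scale)
qed

lemma trace_frame:
  fixes B :: "'a \<Rightarrow> 'a \<Rightarrow> 'v::real_vector"
  assumes "frame e" "frame e'" "\<And>y. linear (\<lambda>x. B x y)" "\<And>x. linear (B x)"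
  shows "(\<Sum>i\<in>{1..DIM('a)}. B (e i) (e i)) = (\<Sum>i\<in>{1..DIM('a)}. B (e' i) (e' i))"
proof -
  have "(\<Sum>i\<in>{1..DIM('a)}. B (e i) (e i)) =
      (\<Sum>i\<in>{1..DIM('a)}. \<Sum>j\<in>{1..DIM('a)}. G (e i) (e' j) *\<^sub>R B (e' j) (e i))"
    by (intro sum.cong refl frame_linear_expand[OF assms(2,3)])
  also have "\<dots> = (\<Sum>j\<in>{1..DIM('a)}. \<Sum>i\<in>{1..DIM('a)}. G (e' j) (e i) *\<^sub>R B (e' j) (e i))"
    by (subst sum.swap) (simp add: sym)
  also have "\<dots> = (\<Sum>j\<in>{1..DIM('a)}. B (e' j) (e' j))"
    by (intro sum.cong refl frame_linear_expand[OF assms(1,4), symmetric])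
  finally show ?thesis .
qed

lemma lin_trace_frame:
  assumes "frame e" "linear L"
  shows "lin_trace L = (\<Sum>i\<in>{1..DIM('a)}. G (L (e i)) (e i))"
proof -
  interpret L: linear L by fact
  have "lin_trace L = (\<Sum>b\<in>Basis. \<Sum>i\<in>{1..DIM('a)}. G (L b) (e i) * (e i \<bullet> b))"
    unfolding lin_trace_def
  proof (intro sum.cong refl)
    fix b :: 'a
    show "L b \<bullet> b = (\<Sum>i\<in>{1..DIM('a)}. G (L b) (e i) * (e i \<bullet> b))"
      using arg_cong[OF frame_expand[OF assms(1), of "L b"], of "\<lambda>x. x \<bullet> b"]
      by (simp add: inner_sum_left)
  qed
  also have "\<dots> = (\<Sum>i\<in>{1..DIM('a)}. G (\<Sum>b\<in>Basis. (e i \<bullet> b) *\<^sub>R L b) (e i))"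
    by (subst sum.swap) (simp add: sum_left mult.commute)
  also have "\<dots> = (\<Sum>i\<in>{1..DIM('a)}. G (L (e i)) (e i))"
    by (simp add: linear_Basis_expand[OF assms(2), symmetric])
  finally show ?thesis .
qed

text \<open>Frames are chosen separately at each point. This form of the trace uses the fixed
  \<open>Basis\<close> and dual vectors instead, which makes traces of smooth tensors
  smooth.\<close>

lemma trace_dual_basis:
  fixes B :: "'a \<Rightarrow> 'a \<Rightarrow> 'v::real_vector"
  assumes "frame e" "\<And>y. linear (\<lambda>x. B x y)" "\<And>x. linear (B x)"
    and s: "\<And>b z. G (s b) z = b \<bullet> z"
  shows "(\<Sum>i\<in>{1..DIM('a)}. B (e i) (e i)) = (\<Sum>b\<in>Basis. B b (s b))"
proof -
  have "(\<Sum>b\<in>Basis. B b (s b)) = (\<Sum>b\<in>Basis. \<Sum>i\<in>{1..DIM('a)}. (b \<bullet> e i) *\<^sub>R B b (e i))"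
  proof (intro sum.cong refl)
    fix b :: 'a
    show "B b (s b) = (\<Sum>i\<in>{1..DIM('a)}. (b \<bullet> e i) *\<^sub>R B b (e i))"
      using frame_linear_expand[OF assms(1,3), of b "s b"] by (simp add: s)
  qed
  also have "\<dots> = (\<Sum>i\<in>{1..DIM('a)}. \<Sum>b\<in>Basis. (e i \<bullet> b) *\<^sub>R B b (e i))"
    by (subst sum.swap) (simp add: inner_commute)
  also have "\<dots> = (\<Sum>i\<in>{1..DIM('a)}. B (e i) (e i))"
    by (intro sum.cong refl linear_Basis_expand[OF assms(2), symmetric])
  finally show ?thesis by simp
qed

end

lemma orthonormal_frame_iff:
  fixes g :: "'a::euclidean_space coord_metric"
  shows "inner_form (g u) \<Longrightarrow> orthonormal_frame g u e \<longleftrightarrow> inner_form.orthonormal (g u) DIM('a) e"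
  by (simp add: orthonormal_frame_def inner_form.orthonormal_def)

lemma frame_some_frame:
  fixes g :: "'a::euclidean_space coord_metric"
  assumes "inner_form (g u)"
  shows "inner_form.orthonormal (g u) DIM('a) (some_frame g u)"
  using inner_form.ex_frame[OF assms] someI_ex[of "orthonormal_frame g u"]
  unfolding some_frame_def orthonormal_frame_iff[where g = g and u = u, OF assms] by blast

lemma metric_trace_frame:
  fixes g :: "'a::euclidean_space coord_metric"
  assumes "inner_form (g u)" "inner_form.orthonormal (g u) DIM('a) e" "bilinear B"
  shows "metric_trace g u B = (\<Sum>i\<in>{1..DIM('a)}. B (e i) (e i))"
  unfolding metric_trace_def
  using inner_form.trace_frame[OF assms(1) frame_some_frame[where g = g and u = u] assms(2), of B] assms
  by (auto simp: bilinear_def)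

section \<open>The Gauss equation at a point\<close>

text \<open>All data are frozen at one point: \<open>h\<close> is the second fundamental form,
  \<open>L\<close> the differential of the immersion, \<open>R\<close> the curvature tensor. What
  follows is linear algebra, free of derivatives.\<close>

locale gauss_point = inner_form G + B: inner_form Gb
  for G :: "'a::euclidean_space \<Rightarrow> 'a \<Rightarrow> real" and Gb :: "'b::euclidean_space \<Rightarrow> 'b \<Rightarrow> real" +
  fixes h :: "'a \<Rightarrow> 'a \<Rightarrow> 'b" and L :: "'a \<Rightarrow> 'b" and c :: real
    and R :: "'a \<Rightarrow> 'a \<Rightarrow> 'a \<Rightarrow> 'a \<Rightarrow> real"
  assumes h_bil: "bilinear h" and h_sym: "h x y = h y x"
    and L_lin: "linear L" and L_iso: "Gb (L x) (L y) = G x y" and h_normal: "Gb (h x y) (L z) = 0"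
    and gauss: "R x y z w = c * (G y z * G x w - G x z * G y w)
      + Gb (h y z) (h x w) - Gb (h x z) (h y w)"
    and dim: "DIM('a) \<ge> 3"
begin

lemmas h_simps = bilinear_ladd[OF h_bil] bilinear_radd[OF h_bil] bilinear_lmul[OF h_bil]
  bilinear_rmul[OF h_bil] bilinear_lsub[OF h_bil] bilinear_rsub[OF h_bil]
  bilinear_lneg[OF h_bil] bilinear_rneg[OF h_bil] bilinear_lzero[OF h_bil] bilinear_rzero[OF h_bil]

definition sec :: "'a \<Rightarrow> 'a \<Rightarrow> real" where
  "sec x y = R x y y x / (G x x * G y y - (G x y)\<^sup>2)"

definition orthonormal_pair :: "'a \<Rightarrow> 'a \<Rightarrow> bool" where
  "orthonormal_pair x y \<longleftrightarrow> G x x = 1 \<and> G y y = 1 \<and> G x y = 0"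

lemma orthonormal_pair_frame:
  assumes "orthonormal_pair x y"
  shows "\<exists>e. frame e \<and> e 1 = x \<and> e 2 = y"
proof -
  have "{1..2::nat} = {1, 2}" by auto
  then have "orthonormal 2 (\<lambda>i. if i = 1 then x else y)"
    using assms sym[of y x] by (auto simp: orthonormal_def orthonormal_pair_def)
  from orthonormal_extend[OF this] show ?thesis by auto
qed

lemma orthonormal_pair_spans:
  assumes "orthonormal_pair x y"
  shows "spans_plane x y"
proof -
  obtain e where e: "frame e" "e 1 = x" "e 2 = y" using orthonormal_pair_frame[OF assms] by blast
  have sub: "{1::nat, 2} \<subseteq> {1..DIM('a)}" using dim by auto
  have "e ` {1, 2} = {x, y}" using e by auto
  then have "independent {x, y}"
    using independent_mono[OF orthonormal_card(2)[OF e(1)] image_mono[OF sub]] by simp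
  moreover have "x \<noteq> y" using assms by (auto simp: orthonormal_pair_def)
  ultimately show ?thesis by (simp add: spans_plane_def)
qed

lemma sec_orthonormal: "orthonormal_pair x y \<Longrightarrow> sec x y = R x y y x"
  by (simp add: sec_def orthonormal_pair_def)

text \<open>Gram-Schmidt: the component of \<open>y\<close> along \<open>x\<close> contributes
  neither to the numerator nor to the Gram determinant, and both scale by the same factor.\<close>

lemma spans_plane_orthonormalise:
  assumes "spans_plane x y"
  shows "\<exists>x' y'. orthonormal_pair x' y' \<and> sec x y = R x' y' y' x'"
    and "G x x * G y y - (G x y)\<^sup>2 > 0"
proof -
  have "y \<notin> span {x}" "x \<noteq> 0"
    using assms independent_insert[of y "{x}"] unfolding spans_plane_def
    by (auto simp: insert_commute)
  define s where "s = sqrt (G x x)"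
  have s: "s > 0" "s * s = G x x" using pos[OF \<open>x \<noteq> 0\<close>] by (simp_all add: s_def)
  define x' where "x' = x /\<^sub>R s"
  have x: "x = s *\<^sub>R x'" using s by (simp add: x'_def)
  have x'1: "G x' x' = 1" using s pos[OF \<open>x \<noteq> 0\<close>] by (simp add: x'_def field_simps)
  define t where "t = G x' y"
  define r where "r = y - t *\<^sub>R x'"
  have y: "y = r + t *\<^sub>R x'" by (simp add: r_def)
  have "r \<noteq> 0"
  proof
    assume "r = 0"
    then have "y = (t / s) *\<^sub>R x" by (simp add: r_def x'_def divide_inverse)
    then show False using \<open>y \<notin> span {x}\<close> by (auto simp: span_singleton)
  qed
  have x'r: "G x' r = 0" using x'1 by (simp add: r_def t_def)
  define k where "k = sqrt (G r r)"
  have k: "k > 0" "k * k = G r r" using pos[OF \<open>r \<noteq> 0\<close>] by (simp_all add: k_def)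
  define y' where "y' = r /\<^sub>R k"
  have r: "r = k *\<^sub>R y'" using k by (simp add: y'_def)
  have op: "orthonormal_pair x' y'"
    using x'1 x'r k pos[OF \<open>r \<noteq> 0\<close>] by (simp add: orthonormal_pair_def y'_def field_simps)
  then have o: "G x' x' = 1" "G y' y' = 1" "G x' y' = 0" "G y' x' = 0"
    using sym[of y' x'] by (auto simp: orthonormal_pair_def)
  have d: "G x x * G y y - (G x y)\<^sup>2 = s * s * (k * k)"
    unfolding y unfolding x r by (simp add: o power2_eq_square algebra_simps)
  show "G x x * G y y - (G x y)\<^sup>2 > 0" unfolding d using s(1) k(1) by (intro mult_pos_pos)
  have "R x y y x = s * s * (k * k) * R x' y' y' x'"
  proof -
    define p q w where "p = h x' x'" and "q = h x' y'" and "w = h y' y'"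
    have h: "h x x = (s * s) *\<^sub>R p" "h x y = (s * k) *\<^sub>R q + (s * t) *\<^sub>R p"
      "h y y = (k * k) *\<^sub>R w + (2 * k * t) *\<^sub>R q + (t * t) *\<^sub>R p"
      unfolding y unfolding x r p_def q_def w_def
      by (simp_all add: h_simps h_sym[of y' x'] algebra_simps scaleR_left_distrib[symmetric])
    have 1: "Gb (h y y) (h x x) - Gb (h x y) (h x y) = s * s * (k * k) * (Gb w p - Gb q q)"
      unfolding h by (simp add: B.sym[of q p] B.sym[of w p] algebra_simps)
    have 2: "R x y y x = c * (G x x * G y y - (G x y)\<^sup>2) + (Gb (h y y) (h x x) - Gb (h x y) (h x y))"
      by (simp add: gauss h_sym[of y x] power2_eq_square sym[of y x] mult.commute)
    have 3: "R x' y' y' x' = c + (Gb w p - Gb q q)"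
      by (simp add: gauss h_sym[of y' x'] o p_def q_def w_def)
    show ?thesis unfolding 2 1 3 d by (simp add: algebra_simps)
  qed
  moreover have "s * s * (k * k) \<noteq> 0" using s(1) k(1) by (intro mult_pos_pos less_imp_neq[symmetric]) auto
  ultimately have "sec x y = R x' y' y' x'"
    unfolding sec_def d by (metis nonzero_mult_div_cancel_left)
  with op show "\<exists>x' y'. orthonormal_pair x' y' \<and> sec x y = R x' y' y' x'" by blast
qed

lemma continuous_form:
  fixes P :: "'c::euclidean_space \<Rightarrow> 'd::euclidean_space \<Rightarrow> 'e::real_normed_vector"
  assumes "bilinear P" "continuous_on S f" "continuous_on S k"
  shows "continuous_on S (\<lambda>z. P (f z) (k z))"
  using bounded_bilinear.continuous_on[OF _ assms(2,3)] assms(1)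
  by (simp add: bilinear_conv_bounded_bilinear)

text \<open>Orthonormal pairs form a compact set and every plane has such a basis. Chen's equality
  thus becomes a statement about one plane, which can be spanned by the first two frame
  vectors.\<close>

lemma inf_sec_attained:
  "\<exists>x y. orthonormal_pair x y \<and> Inf {sec x y | x y. spans_plane x y} = R x y y x"
proof -
  let ?O = "{z. orthonormal_pair (fst z) (snd z)}"
  let ?\<phi> = "\<lambda>z. R (fst z) (snd z) (snd z) (fst z)"
  have cf: "continuous_on UNIV fst" "continuous_on UNIV snd" by (auto intro: continuous_intros)
  note cG = continuous_form[OF bil]
  have "?O = {z. G (fst z) (fst z) = 1} \<inter> {z. G (snd z) (snd z) = 1} \<inter> {z. G (fst z) (snd z) = 0}"
    by (auto simp: orthonormal_pair_def)
  moreover have "closed \<dots>"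
    by (intro closed_Int closed_Collect_eq cG cf continuous_on_const)
  ultimately have "closed ?O" by simp
  obtain l where l: "l > 0" "\<And>z. G z z \<ge> l * (norm z)\<^sup>2" using coercive by blast
  have bd: "norm z \<le> sqrt (1 / l)" if "G z z = 1" for z
    using l(2)[of z] l(1) that by (intro real_le_rsqrt) (simp add: field_simps)
  have "bounded ?O"
  proof (rule boundedI)
    fix z assume "z \<in> ?O"
    then have "norm (fst z) \<le> sqrt (1 / l)" "norm (snd z) \<le> sqrt (1 / l)"
      by (auto simp: orthonormal_pair_def intro: bd)
    then show "norm z \<le> sqrt (1 / l) + sqrt (1 / l)"
      using norm_Pair_le[of "fst z" "snd z"] by simp
  qed
  with \<open>closed ?O\<close> have "compact ?O" by (simp add: compact_eq_bounded_closed)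
  moreover have "?O \<noteq> {}"
  proof -
    obtain e where "frame e" using ex_frame by blast
    then have "orthonormal_pair (e 1) (e 2)" using dim by (simp add: orthonormal_pair_def orthonormal_def)
    then show ?thesis by (intro notI, auto)
  qed
  moreover have "continuous_on UNIV ?\<phi>"
    unfolding gauss
    by (intro continuous_on_add continuous_on_diff continuous_on_mult continuous_on_const cG cf
      continuous_form[OF B.bil] continuous_form[OF h_bil])
  then have "continuous_on ?O ?\<phi>" by (rule continuous_on_subset) simp
  ultimately obtain z where z: "z \<in> ?O" "\<And>w. w \<in> ?O \<Longrightarrow> ?\<phi> z \<le> ?\<phi> w"
    using continuous_attains_inf[of ?O ?\<phi>] by blast
  have "Inf {sec x y | x y. spans_plane x y} = ?\<phi> z"
  proof (rule cInf_eq_minimum)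
    show "?\<phi> z \<in> {sec x y | x y. spans_plane x y}"
      using z(1) sec_orthonormal[of "fst z" "snd z"] orthonormal_pair_spans[of "fst z" "snd z"]
      by (intro CollectI exI[of _ "fst z"] exI[of _ "snd z"]) auto
  next
    fix s assume "s \<in> {sec x y | x y. spans_plane x y}"
    then obtain x y where "s = sec x y" "spans_plane x y" by blast
    then obtain x' y' where "orthonormal_pair x' y'" "s = R x' y' y' x'"
      using spans_plane_orthonormalise(1)[of x y] by auto
    then show "?\<phi> z \<le> s" using z(2)[of "(x', y')"] by simp
  qed
  then show ?thesis using z(1) by blast
qed

definition tau :: "(nat \<Rightarrow> 'a) \<Rightarrow> real" where
  "tau e = (\<Sum>i\<in>{1..DIM('a)}. \<Sum>j\<in>{1..DIM('a)}. R (e j) (e i) (e i) (e j))"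

definition trace_h :: "(nat \<Rightarrow> 'a) \<Rightarrow> 'b" where
  "trace_h e = (\<Sum>i\<in>{1..DIM('a)}. h (e i) (e i))"

lemma tau_eq:
  assumes "frame e"
  shows "tau e = real DIM('a) * (real DIM('a) - 1) * c + Gb (trace_h e) (trace_h e)
    - (\<Sum>i\<in>{1..DIM('a)}. \<Sum>j\<in>{1..DIM('a)}. Gb (h (e i) (e j)) (h (e i) (e j)))"
proof -
  let ?I = "{1..DIM('a)}"
  have "R (e j) (e i) (e i) (e j) = c * (1 - (if i = j then 1 else 0))
      + Gb (h (e i) (e i)) (h (e j) (e j)) - Gb (h (e i) (e j)) (h (e i) (e j))"
    if "i \<in> ?I" "j \<in> ?I" for i j
    using orthonormalD[OF assms that] orthonormalD[OF assms that(2,1)] orthonormalD[OF assms that(1,1)]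
      orthonormalD[OF assms that(2,2)] h_sym[of "e j" "e i"]
    by (simp add: gauss)
  then have "tau e = (\<Sum>i\<in>?I. \<Sum>j\<in>?I. c * (1 - (if i = j then 1 else 0))
      + Gb (h (e i) (e i)) (h (e j) (e j)) - Gb (h (e i) (e j)) (h (e i) (e j)))"
    unfolding tau_def by (intro sum.cong refl) blast
  also have "\<dots> = (\<Sum>i\<in>?I. \<Sum>j\<in>?I. c * (1 - (if i = j then 1 else 0)))
      + (\<Sum>i\<in>?I. \<Sum>j\<in>?I. Gb (h (e i) (e i)) (h (e j) (e j)))
      - (\<Sum>i\<in>?I. \<Sum>j\<in>?I. Gb (h (e i) (e j)) (h (e i) (e j)))"
    by (simp add: sum.distrib sum_subtractf)
  also have "(\<Sum>i\<in>?I. \<Sum>j\<in>?I. Gb (h (e i) (e i)) (h (e j) (e j))) = Gb (trace_h e) (trace_h e)"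
    by (simp add: trace_h_def B.sum_left B.sum_right) (rule sum.swap)
  also have "(\<Sum>i\<in>?I. \<Sum>j\<in>?I. c * (1 - (if i = j then 1 else 0))) = real DIM('a) * (real DIM('a) - 1) * c"
  proof -
    have "(\<Sum>j\<in>?I. c * (1 - (if i = j then 1 else 0))) = c * (real DIM('a) - 1)" if "i \<in> ?I" for i
      using that by (simp add: sum_distrib_left[symmetric] sum_subtractf)
    then have "(\<Sum>i\<in>?I. \<Sum>j\<in>?I. c * (1 - (if i = j then 1 else 0))) = (\<Sum>i\<in>?I. c * (real DIM('a) - 1))"
      by (intro sum.cong refl)
    then show ?thesis by simp
  qed
  finally show ?thesis .
qed

text \<open>
  \<open>ideal e \<eta>\<close>: equality holds in Chen's inequality for the plane of \<open>e 1\<close> and \<open>e 2\<close>.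
\<close>

definition ideal :: "(nat \<Rightarrow> 'a) \<Rightarrow> 'b \<Rightarrow> bool" where
  "ideal e \<eta> \<longleftrightarrow> frame e \<and> h (e 1) (e 1) + h (e 2) (e 2) = \<eta> \<and>
    (\<forall>i\<in>{3..DIM('a)}. \<forall>j\<in>{1..DIM('a)}. h (e i) (e j) = (if i = j then \<eta> else 0))"

lemma sum_split12:
  fixes f :: "nat \<Rightarrow> 'v::comm_monoid_add"
  shows "(\<Sum>i\<in>{1..DIM('a)}. f i) = f 1 + (f 2 + (\<Sum>i\<in>{3..DIM('a)}. f i))"
proof -
  have "{1..DIM('a)} = insert 1 (insert 2 {3..DIM('a)})" using dim by auto
  then show ?thesis by simp
qed

text \<open>By the traced Gauss equation twice the defect in Chen's inequality is a sum of squares: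
  the off-diagonal entries of \<open>h\<close> except the one for \<open>e 1\<close> and
  \<open>e 2\<close>, plus the deviations of n - 1 vectors with sum \<open>T\<close> from their
  mean. Equality makes every square vanish.\<close>

lemma chen_equality_ideal:
  assumes e: "frame e"
    and eq: "tau e / 2 - R (e 1) (e 2) (e 2) (e 1) =
      (real DIM('a) - 2) / (2 * (real DIM('a) - 1)) * Gb (trace_h e) (trace_h e)
      + (real DIM('a) + 1) * (real DIM('a) - 2) * c / 2"
  shows "\<exists>\<eta>. ideal e \<eta>"
proof -
  let ?n = "real DIM('a)" and ?I = "{1..DIM('a)}" and ?J = "{3..DIM('a)}"
  define N where "N v = Gb v v" for v
  define H where "H i j = h (e i) (e j)" for i j
  define T where "T = trace_h e"
  \<comment> \<open>The mean of the n - 1 vectors \<open>y2\<close>, \<open>H 3 3\<close>, ...,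
    \<open>H n n\<close>.\<close>
  define \<eta> where "\<eta> = T /\<^sub>R (?n - 1)"
  define y2 where "y2 = H 1 1 + H 2 2"
  have n: "?n \<ge> 3" using dim by simp
  have T: "T = y2 + (\<Sum>i\<in>?J. H i i)"
    unfolding T_def trace_h_def H_def[symmetric] sum_split12 y2_def by (simp add: add.assoc)
  have N0: "N v \<ge> 0" and N_zero: "N v = 0 \<longleftrightarrow> v = 0" for v by (simp_all add: N_def B.nonneg B.eq_zero_iff)
  have Hs: "H i j = H j i" for i j unfolding H_def by (rule h_sym)
  \<comment> \<open>The index pairs whose entries have to vanish. \<open>H 1 2\<close> stays free,
    which is why the normal form keeps the entries d_t.\<close>
  define A where "A = (?I \<times> ?I) - ({(1, 2), (2, 1)} \<union> (\<lambda>i. (i, i)) ` ?I)"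
  have fA: "finite A" by (simp add: A_def)
  have all: "(\<Sum>i\<in>?I. \<Sum>j\<in>?I. N (H i j)) = (\<Sum>p\<in>A. N (H (fst p) (snd p))) + (\<Sum>i\<in>?I. N (H i i)) + 2 * N (H 1 2)"
  proof -
    let ?f = "\<lambda>p. N (H (fst p) (snd p))"
    have "(\<Sum>i\<in>?I. \<Sum>j\<in>?I. N (H i j)) = sum ?f (?I \<times> ?I)" by (simp add: sum.cartesian_product split_def)
    also have "\<dots> = sum ?f A + sum ?f ({(1, 2), (2, 1)} \<union> (\<lambda>i. (i, i)) ` ?I)"
      unfolding A_def using dim by (intro sum.subset_diff) auto
    also have "sum ?f ({(1, 2), (2, 1)} \<union> (\<lambda>i. (i, i)) ` ?I) =
        sum ?f {(1, 2), (2, 1)} + sum ?f ((\<lambda>i. (i, i)) ` ?I)"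
      by (intro sum.union_disjoint) auto
    also have "sum ?f ((\<lambda>i. (i, i)) ` ?I) = (\<Sum>i\<in>?I. N (H i i))"
      by (subst sum.reindex) (auto simp: inj_on_def)
    also have "sum ?f {(1, 2), (2, 1)} = 2 * N (H 1 2)" using Hs[of 2 1] by simp
    finally show ?thesis by simp
  qed
  have R12: "R (e 1) (e 2) (e 2) (e 1) = c + Gb (H 1 1) (H 2 2) - N (H 1 2)"
    using orthonormalD[OF e, of 1 1] orthonormalD[OF e, of 2 2] orthonormalD[OF e, of 1 2] dim
    by (simp add: gauss H_def N_def h_sym[of "e 2" "e (Suc 0)"] B.sym[of "h (e 2) (e 2)" "h (e (Suc 0)) (e (Suc 0))"])
  have "(\<Sum>p\<in>A. N (H (fst p) (snd p))) + (\<Sum>i\<in>?I. N (H i i)) + 2 * Gb (H 1 1) (H 2 2) = N T / (?n - 1)"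
  proof -
    have 1: "(?n - 2) / (2 * (?n - 1)) * N T = (N T - N T / (?n - 1)) / 2"
      using n by (simp add: field_simps)
    have 2: "?n * (?n - 1) * c - 2 * c = (?n + 1) * (?n - 2) * c" by (simp add: algebra_simps)
    \<comment> \<open>Here \<open>M\<close> is the squared norm of \<open>H 1 2\<close>: half the
      scalar curvature and the sectional curvature contain it with the same sign, so it drops out of
      their difference.\<close>
    have 3: "P - 2 * c = Q \<Longrightarrow> (P + X - (A1 + A2 + 2 * M)) / 2 - (c + g - M) = (X - Y) / 2 + Q / 2
      \<Longrightarrow> A1 + A2 + 2 * g = Y" for P Q X Y A1 A2 M g :: real
      by (simp add: field_simps)
    show ?thesis
      by (rule 3[OF 2 eq[unfolded tau_eq[OF e] R12 T_def[symmetric] N_def[symmetric] H_def[symmetric] all 1]])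
  qed
  moreover have "(\<Sum>i\<in>?I. N (H i i)) + 2 * Gb (H 1 1) (H 2 2) = N y2 + (\<Sum>i\<in>?J. N (H i i))"
    unfolding sum_split12 by (simp add: N_def y2_def B.sym[of "H 2 2" "H (Suc 0) (Suc 0)"])
  moreover have "N (y2 - \<eta>) + (\<Sum>i\<in>?J. N (H i i - \<eta>)) = N y2 + (\<Sum>i\<in>?J. N (H i i)) - N T / (?n - 1)"
  proof -
    have N: "N (v - \<eta>) = N v - 2 * Gb v \<eta> + N \<eta>" for v
      by (simp add: N_def B.sym[of \<eta> v])
    have "N (y2 - \<eta>) + (\<Sum>i\<in>?J. N (H i i - \<eta>)) =
        N y2 + (\<Sum>i\<in>?J. N (H i i)) - 2 * Gb T \<eta> + (1 + real (card ?J)) * N \<eta>"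
    proof -
      have "(\<Sum>i\<in>?J. N (H i i - \<eta>)) =
          (\<Sum>i\<in>?J. N (H i i)) - 2 * (\<Sum>i\<in>?J. Gb (H i i) \<eta>) + real (card ?J) * N \<eta>"
        unfolding N by (simp only: sum.distrib sum_subtractf sum_distrib_left[symmetric] sum_constant)
      moreover have "Gb T \<eta> = Gb y2 \<eta> + (\<Sum>i\<in>?J. Gb (H i i) \<eta>)"
        unfolding T by (simp only: B.add B.sum_left)
      ultimately show ?thesis unfolding N[of y2] by (simp add: algebra_simps)
    qed
    moreover have "1 + real (card ?J) = ?n - 1" using dim by (simp add: of_nat_diff)
    moreover have "Gb T \<eta> = N T / (?n - 1)" by (simp add: \<eta>_def N_def divide_inverse mult.commute)
    moreover have "(?n - 1) * N \<eta> = N T / (?n - 1)"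
    proof -
      have "k * (inverse k * (inverse k * X)) = X / k" if "k > 0" for k X :: real
        using that by (simp add: field_simps)
      from this[of "?n - 1" "N T"] show ?thesis using n by (simp add: \<eta>_def N_def)
    qed
    ultimately show ?thesis by simp
  qed
  ultimately have "(\<Sum>p\<in>A. N (H (fst p) (snd p))) + (N (y2 - \<eta>) + (\<Sum>i\<in>?J. N (H i i - \<eta>))) = 0"
    by linarith
  moreover have "(\<Sum>p\<in>A. N (H (fst p) (snd p))) \<ge> 0" "(\<Sum>i\<in>?J. N (H i i - \<eta>)) \<ge> 0"
    by (intro sum_nonneg N0)+
  ultimately have z: "(\<Sum>p\<in>A. N (H (fst p) (snd p))) = 0" "N (y2 - \<eta>) = 0" "(\<Sum>i\<in>?J. N (H i i - \<eta>)) = 0"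
    using N0[of "y2 - \<eta>"] by linarith+
  have "y2 = \<eta>" using z(2) by (simp add: N_zero)
  moreover have "H i i = \<eta>" if "i \<in> ?J" for i
    using z(3) that N0 by (simp add: sum_nonneg_eq_0_iff N_zero)
  moreover have "H i j = 0" if "i \<in> ?J" "j \<in> ?I" "i \<noteq> j" for i j
  proof -
    have "(i, j) \<in> A" using that by (auto simp: A_def)
    then have "N (H (fst (i, j)) (snd (i, j))) = 0"
      using z(1) sum_nonneg_eq_0_iff[OF fA, of "\<lambda>p. N (H (fst p) (snd p))"] N0 by blast
    then show ?thesis by (simp add: N_zero)
  qed
  ultimately have "ideal e \<eta>" using e by (auto simp: ideal_def H_def y2_def)
  then show ?thesis by blast
qed

end

section \<open>From the equality case to the normal form of the shape operators\<close>

context gauss_point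
begin

definition shape :: "'b \<Rightarrow> 'a \<Rightarrow> 'a" where
  "shape \<xi> x = (THE w. \<forall>y. G w y = Gb (h x y) \<xi>)"

lemma G_shape: "G (shape \<xi> x) y = Gb (h x y) \<xi>"
proof -
  have "linear (\<lambda>y. Gb (h x y) \<xi>)" by (rule linearI) (simp_all add: h_simps)
  from the_riesz[OF this] show ?thesis unfolding shape_def .
qed

lemma shape_eqI:
  assumes "frame e" "\<And>j. j \<in> {1..DIM('a)} \<Longrightarrow> G w (e j) = Gb (h x (e j)) \<xi>"
  shows "shape \<xi> x = w"
  by (rule frame_eqI[OF assms(1)]) (simp only: G_shape assms(2))

definition normal_form_with ::
    "real \<Rightarrow> real \<Rightarrow> (nat \<Rightarrow> 'a) \<Rightarrow> (nat \<Rightarrow> 'b) \<Rightarrow> (nat \<Rightarrow> real) \<Rightarrow> (nat \<Rightarrow> real) \<Rightarrow> bool" where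
  "normal_form_with a b e xi cc d \<longleftrightarrow> frame e \<and>
        (\<forall>t\<in>{1..DIM('b) - DIM('a)}. \<forall>x. Gb (xi t) (L x) = 0) \<and>
        (\<forall>s\<in>{1..DIM('b) - DIM('a)}. \<forall>t\<in>{1..DIM('b) - DIM('a)}. Gb (xi s) (xi t) = (if s = t then 1 else 0)) \<and>
        shape (xi 1) (e 1) = a *\<^sub>R e 1 \<and> shape (xi 1) (e 2) = b *\<^sub>R e 2 \<and>
        (\<forall>i\<in>{3..DIM('a)}. shape (xi 1) (e i) = (a + b) *\<^sub>R e i) \<and>
        (\<forall>t\<in>{2..DIM('b) - DIM('a)}.
           shape (xi t) (e 1) = cc t *\<^sub>R e 1 + d t *\<^sub>R e 2 \<and>
           shape (xi t) (e 2) = d t *\<^sub>R e 1 - cc t *\<^sub>R e 2 \<and>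
           (\<forall>i\<in>{3..DIM('a)}. shape (xi t) (e i) = 0))"

definition normal_form_at :: "real \<Rightarrow> real \<Rightarrow> bool" where
  "normal_form_at a b \<longleftrightarrow> (\<exists>e xi cc d. normal_form_with a b e xi cc d)"

lemma L_orthonormal: "orthonormal k e \<Longrightarrow> B.orthonormal k (\<lambda>i. L (e i))"
  by (simp add: orthonormal_def B.orthonormal_def L_iso)

lemma ideal_frame: "ideal e \<eta> \<Longrightarrow> frame e" by (simp add: ideal_def)

lemma ideal_h3: "ideal e \<eta> \<Longrightarrow> i \<in> {3..DIM('a)} \<Longrightarrow> j \<in> {1..DIM('a)} \<Longrightarrow>
    h (e i) (e j) = (if i = j then \<eta> else 0)"
  by (simp add: ideal_def)

text \<open>The first normal vector must point along \<eta>, so that all other shape operators are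
  trace-free on the plane and vanish on its complement. If \<eta> = 0, any normal frame
  serves.\<close>

lemma ideal_normal_frame:
  assumes id: "ideal e \<eta>" and codim: "DIM('b) > DIM('a)"
  shows "\<exists>f s. B.frame f \<and> (\<forall>i\<in>{1..DIM('a)}. f i = L (e i)) \<and> \<eta> = s *\<^sub>R f (Suc DIM('a))"
proof (cases "\<eta> = 0")
  case True
  then show ?thesis
    using B.orthonormal_extend[OF L_orthonormal[OF ideal_frame[OF id]]] by (metis scale_zero_left)
next
  case False
  let ?v = "\<eta> /\<^sub>R sqrt (Gb \<eta> \<eta>)"
  have "\<eta> = h (e 3) (e 3)" using ideal_h3[OF id, of 3 3] dim by simp
  then have "Gb ?v (L (e i)) = 0" for i by (simp add: h_normal)
  then have "B.orthonormal (Suc DIM('a)) ((\<lambda>i. L (e i))(Suc DIM('a) := ?v))"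
    by (intro B.orthonormal_snoc L_orthonormal ideal_frame[OF id] B.normalise False)
  from B.orthonormal_extend[OF this] obtain f where f: "B.frame f"
    "\<forall>i\<in>{1..Suc DIM('a)}. f i = ((\<lambda>i. L (e i))(Suc DIM('a) := ?v)) i" by blast
  have "\<forall>i\<in>{1..DIM('a)}. f i = L (e i)" using f(2) by auto
  moreover have "f (Suc DIM('a)) = ?v" using f(2) by auto
  then have "\<eta> = sqrt (Gb \<eta> \<eta>) *\<^sub>R f (Suc DIM('a))" using B.pos[OF False] by simp
  ultimately show ?thesis using f(1) by blast
qed

text \<open>The off-diagonal entry changes sign under a rotation by a right angle.\<close>

lemma ideal_rotate:
  assumes id: "ideal e \<eta>"
  shows "\<exists>e'. ideal e' \<eta> \<and> Gb (h (e' 1) (e' 2)) \<xi> = 0"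
proof -
  define E1 where "E1 t = cos t *\<^sub>R e 1 + sin t *\<^sub>R e 2" for t
  define E2 where "E2 t = - sin t *\<^sub>R e 1 + cos t *\<^sub>R e 2" for t
  define \<phi> where "\<phi> t = Gb (h (E1 t) (E2 t)) \<xi>" for t
  have \<phi>: "\<phi> t = sin t * cos t * (Gb (h (e 2) (e 2)) \<xi> - Gb (h (e 1) (e 1)) \<xi>)
      + (cos t * cos t - sin t * sin t) * Gb (h (e 1) (e 2)) \<xi>" for t
    unfolding \<phi>_def E1_def E2_def
    by (simp add: h_simps h_sym[of "e 2" "e (Suc 0)"] algebra_simps)
  have "\<exists>t\<ge>0. t \<le> pi / 2 \<and> \<phi> t = 0"
  proof (cases "\<phi> 0 \<le> 0")
    case True
    have "\<phi> (pi / 2) = - \<phi> 0" unfolding \<phi> by simp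
    then show ?thesis using True
      by (intro IVT) (auto simp: \<phi> intro!: continuous_intros)
  next
    case False
    have "\<phi> (pi / 2) = - \<phi> 0" unfolding \<phi> by simp
    then show ?thesis using False
      by (intro IVT2) (auto simp: \<phi> intro!: continuous_intros)
  qed
  then obtain t where t: "\<phi> t = 0" by blast
  define e' where "e' = e(1 := E1 t, 2 := E2 t)"
  note f = ideal_frame[OF id]
  have o: "G (e 1) (e 1) = 1" "G (e 2) (e 2) = 1" "G (e 1) (e 2) = 0" "G (e 2) (e 1) = 0"
    using orthonormalD[OF f, of 1 1] orthonormalD[OF f, of 2 2] orthonormalD[OF f, of 1 2]
      orthonormalD[OF f, of 2 1] dim by auto
  have sc: "cos t * cos t + sin t * sin t = 1"
    using sin_cos_squared_add[of t] by (simp add: power2_eq_square add.commute)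
  have O: "G (E1 t) (E1 t) = 1" "G (E2 t) (E2 t) = 1" "G (E1 t) (E2 t) = 0"
    using sc unfolding E1_def E2_def by (simp_all add: o[simplified] add.commute)
  have O3: "G (E1 t) (e i) = 0" "G (E2 t) (e i) = 0" "h (e i) (E1 t) = 0" "h (e i) (E2 t) = 0"
    if i: "i \<in> {3..DIM('a)}" for i
  proof -
    have "G (e 1) (e i) = 0" "G (e 2) (e i) = 0"
      using orthonormalD[OF f, of 1 i] orthonormalD[OF f, of 2 i] i by auto
    then show "G (E1 t) (e i) = 0" "G (E2 t) (e i) = 0" by (simp_all add: E1_def E2_def)
    have "h (e i) (e 1) = 0" "h (e i) (e 2) = 0"
      using ideal_h3[OF id i, of 1] ideal_h3[OF id i, of 2] i by auto
    then show "h (e i) (E1 t) = 0" "h (e i) (E2 t) = 0" by (simp_all add: E1_def E2_def h_simps)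
  qed
  have e': "e' 1 = E1 t" "e' 2 = E2 t" "i \<in> {3..DIM('a)} \<Longrightarrow> e' i = e i" for i
    by (auto simp: e'_def)
  have cases3: "i \<in> {1..DIM('a)} \<Longrightarrow> i = 1 \<or> i = 2 \<or> i \<in> {3..DIM('a)}" for i by auto
  have "frame e'"
    unfolding orthonormal_def
  proof (intro ballI)
    fix i j assume i: "i \<in> {1..DIM('a)}" and j: "j \<in> {1..DIM('a)}"
    have J: "G (e' 1) (e' k) = 0" "G (e' 2) (e' k) = 0" "G (e' k) (e' 1) = 0" "G (e' k) (e' 2) = 0"
      if "k \<in> {3..DIM('a)}" for k
      unfolding e'(1,2) e'(3)[OF that] using O3[OF that] sym[of "e k" "E1 t"] sym[of "e k" "E2 t"] by simp_all
    have JJ: "G (e' i) (e' j) = (if i = j then 1 else 0)" if "i \<in> {3..DIM('a)}" "j \<in> {3..DIM('a)}"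
      unfolding e'(3)[OF that(1)] e'(3)[OF that(2)] using orthonormalD[OF f i j] .
    have "G (e' 1) (e' 1) = 1" "G (e' 2) (e' 2) = 1" "G (e' 1) (e' 2) = 0" "G (e' 2) (e' 1) = 0"
      unfolding e' using O sym[of "E2 t" "E1 t"] by simp_all
    then show "G (e' i) (e' j) = (if i = j then 1 else 0)"
      using cases3[OF i] cases3[OF j] J[of i] J[of j] JJ by auto
  qed
  moreover have "h (e' 1) (e' 1) + h (e' 2) (e' 2) = \<eta>"
  proof -
    have "h (C *\<^sub>R e 1 + s *\<^sub>R e 2) (C *\<^sub>R e 1 + s *\<^sub>R e 2)
        + h (- s *\<^sub>R e 1 + C *\<^sub>R e 2) (- s *\<^sub>R e 1 + C *\<^sub>R e 2) =
        (C * C + s * s) *\<^sub>R (h (e 1) (e 1) + h (e 2) (e 2))" for C s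
      by (simp add: h_simps algebra_simps)
    from this[of "cos t" "sin t"] show ?thesis
      using id unfolding e' sc E1_def[symmetric] E2_def[symmetric] by (simp add: ideal_def)
  qed
  moreover have "h (e' i) (e' j) = (if i = j then \<eta> else 0)"
    if "i \<in> {3..DIM('a)}" "j \<in> {1..DIM('a)}" for i j
  proof -
    have "h (e' i) (e' 1) = 0" "h (e' i) (e' 2) = 0"
      unfolding e'(1,2) e'(3)[OF that(1)] using O3[OF that(1)] by simp_all
    moreover have "h (e' i) (e' j) = (if i = j then \<eta> else 0)" if "j \<in> {3..DIM('a)}"
      unfolding e'(3)[OF that] e'(3)[OF \<open>i \<in> {3..DIM('a)}\<close>]
      using ideal_h3[OF id \<open>i \<in> {3..DIM('a)}\<close> \<open>j \<in> {1..DIM('a)}\<close>] .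
    ultimately show ?thesis using cases3[OF that(2)] that(1) by auto
  qed
  ultimately have "ideal e' \<eta>" by (simp add: ideal_def)
  moreover have "Gb (h (e' 1) (e' 2)) \<xi> = 0" using t unfolding \<phi>_def e' .
  ultimately show ?thesis by blast
qed

text \<open>The normal frame is fixed first; the rotation of \<open>e 1\<close> and
  \<open>e 2\<close> then diagonalises the block of the first shape operator without disturbing
  \<open>ideal\<close>. The remaining blocks are trace-free because \<eta> is orthogonal to their
  normal vectors.\<close>

lemma ideal_normal_form:
  assumes "ideal e \<eta>" and codim: "DIM('b) > DIM('a)"
  shows "\<exists>a b. normal_form_at a b"
proof -
  obtain f0 s0 where f0: "B.frame f0" "\<forall>i\<in>{1..DIM('a)}. f0 i = L (e i)" "\<eta> = s0 *\<^sub>R f0 (Suc DIM('a))"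
    using ideal_normal_frame[OF assms] by blast
  define xi where "xi t = f0 (DIM('a) + t)" for t
  obtain e' where id: "ideal e' \<eta>" and off: "Gb (h (e' 1) (e' 2)) (xi 1) = 0"
    using ideal_rotate[OF assms(1)] by blast
  note f = ideal_frame[OF id]
  let ?p = "DIM('b) - DIM('a)"
  have xi_normal: "Gb (xi t) (L x) = 0" if "t \<in> {1..?p}" for t x
  proof -
    have "Gb (xi t) (L (e i)) = 0" if "i \<in> {1..DIM('a)}" for i
      using B.orthonormalD[OF f0(1), of "DIM('a) + t" i] f0(2) that \<open>t \<in> {1..?p}\<close> by (auto simp: xi_def)
    moreover have "linear (\<lambda>x. Gb (xi t) (L x))"
      using L_lin by (intro linearI) (simp_all add: linear_add linear_scale)
    then have "Gb (xi t) (L x) = (\<Sum>i\<in>{1..DIM('a)}. G x (e i) *\<^sub>R Gb (xi t) (L (e i)))"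
      by (rule frame_linear_expand[OF ideal_frame[OF assms(1)]])
    ultimately show ?thesis by simp
  qed
  have xi_on: "Gb (xi s) (xi t) = (if s = t then 1 else 0)" if "s \<in> {1..?p}" "t \<in> {1..?p}" for s t
    using B.orthonormalD[OF f0(1), of "DIM('a) + s" "DIM('a) + t"] that by (auto simp: xi_def)
  define H where "H t i j = Gb (h (e' i) (e' j)) (xi t)" for t i j
  have \<eta>: "\<eta> = s0 *\<^sub>R xi 1" by (simp add: f0(3) xi_def)
  have Hs: "H t i j = H t j i" for t i j by (simp add: H_def h_sym[of "e' i"])
  have H3: "H t i j = (if i = j then Gb \<eta> (xi t) else 0)" if "i \<in> {3..DIM('a)}" "j \<in> {1..DIM('a)}" for t i j
    using ideal_h3[OF id that] by (simp add: H_def)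
  have Hsum: "H t 1 1 + H t 2 2 = Gb \<eta> (xi t)" for t
    using id by (simp add: H_def ideal_def flip: B.add(1))
  have cases3: "i \<in> {1..DIM('a)} \<Longrightarrow> i = 1 \<or> i = 2 \<or> i \<in> {3..DIM('a)}" for i by auto
  have o: "i \<in> {1..DIM('a)} \<Longrightarrow> j \<in> {1..DIM('a)} \<Longrightarrow> G (e' i) (e' j) = (if i = j then 1 else 0)" for i j
    by (rule orthonormalD[OF f])
  have in12: "1 \<in> {1..DIM('a)}" "2 \<in> {1..DIM('a)}" using dim by auto
  have s1: "shape (xi t) (e' 1) = H t 1 1 *\<^sub>R e' 1 + H t 1 2 *\<^sub>R e' 2" for t
  proof (rule shape_eqI[OF f])
    fix j assume j: "j \<in> {1..DIM('a)}"
    show "G (H t 1 1 *\<^sub>R e' 1 + H t 1 2 *\<^sub>R e' 2) (e' j) = Gb (h (e' 1) (e' j)) (xi t)"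
      unfolding H_def[of t 1 j, symmetric]
      using cases3[OF j] o[OF in12(1) j] o[OF in12(2) j] H3[of j 1 t] in12 Hs[of t 1 j]
      by (-, elim disjE, simp_all)
  qed
  have s2: "shape (xi t) (e' 2) = H t 1 2 *\<^sub>R e' 1 + H t 2 2 *\<^sub>R e' 2" for t
  proof (rule shape_eqI[OF f])
    fix j assume j: "j \<in> {1..DIM('a)}"
    show "G (H t 1 2 *\<^sub>R e' 1 + H t 2 2 *\<^sub>R e' 2) (e' j) = Gb (h (e' 2) (e' j)) (xi t)"
      unfolding H_def[of t 2 j, symmetric]
      using cases3[OF j] o[OF in12(1) j] o[OF in12(2) j] H3[of j 2 t] in12 Hs[of t 2 j]
      by (-, elim disjE, simp_all)
  qed
  have s3: "shape (xi t) (e' i) = Gb \<eta> (xi t) *\<^sub>R e' i" if i: "i \<in> {3..DIM('a)}" for t i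
  proof (rule shape_eqI[OF f])
    fix j assume j: "j \<in> {1..DIM('a)}"
    show "G (Gb \<eta> (xi t) *\<^sub>R e' i) (e' j) = Gb (h (e' i) (e' j)) (xi t)"
      unfolding H_def[of t i j, symmetric] H3[OF i j] using o[of i j] i j by simp
  qed
  have p1: "1 \<in> {1..?p}" using codim by auto
  have \<eta>t: "Gb \<eta> (xi t) = 0" if "t \<in> {2..?p}" for t
    using xi_on[OF p1, of t] that by (simp add: \<eta>)
  have "H t 2 2 = - H t 1 1" if "t \<in> {2..?p}" for t
    using Hsum[of t] \<eta>t[OF that] by simp
  moreover have "H 1 1 2 = 0" using off by (simp add: H_def)
  ultimately have "normal_form_with (H 1 1 1) (H 1 2 2) e' xi (\<lambda>t. H t 1 1) (\<lambda>t. H t 1 2)"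
    unfolding normal_form_with_def
    using f xi_normal xi_on s1 s2 s3 \<eta>t Hsum by simp
  then show ?thesis unfolding normal_form_at_def by blast
qed

text \<open>
  \<open>adapted e \<xi> \<gamma> \<delta> a b\<close> records the second fundamental form in a normal form: \<open>\<xi>\<close> is the first
  normal vector, \<open>\<gamma>\<close> and \<open>\<delta>\<close> collect the entries of the other shape operators.
\<close>

definition adapted :: "(nat \<Rightarrow> 'a) \<Rightarrow> 'b \<Rightarrow> 'b \<Rightarrow> 'b \<Rightarrow> real \<Rightarrow> real \<Rightarrow> bool" where
  "adapted e \<xi> \<gamma> \<delta> a b \<longleftrightarrow> frame e \<and> Gb \<xi> \<xi> = 1 \<and> Gb \<gamma> \<xi> = 0 \<and> Gb \<delta> \<xi> = 0 \<and>
    h (e 1) (e 1) = a *\<^sub>R \<xi> + \<gamma> \<and> h (e 2) (e 2) = b *\<^sub>R \<xi> - \<gamma> \<and> h (e 1) (e 2) = \<delta> \<and>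
    (\<forall>i\<in>{3..DIM('a)}. \<forall>j\<in>{1..DIM('a)}. h (e i) (e j) = (if i = j then (a + b) *\<^sub>R \<xi> else 0))"

text \<open>Reassembles the vector-valued \<open>h\<close> from the shape operators. The images of
  the tangent frame together with the \<open>xi t\<close> form a frame of the ambient tangent space,
  so a normal vector is determined by its products with the \<open>xi t\<close>. For p = 1 there is
  no \<open>t \<ge> 2\<close>, hence both remainders vanish.\<close>

lemma normal_form_adapted:
  assumes "normal_form_at a b" and codim: "DIM('b) > DIM('a)"
  shows "\<exists>e \<xi> \<gamma> \<delta>. adapted e \<xi> \<gamma> \<delta> a b \<and> (DIM('b) = DIM('a) + 1 \<longrightarrow> \<gamma> = 0 \<and> \<delta> = 0)"
proof -
  let ?p = "DIM('b) - DIM('a)"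
  obtain e xi cc d where nf: "normal_form_with a b e xi cc d"
    using assms(1) unfolding normal_form_at_def by blast
  have f: "frame e"
    and xi_normal: "\<And>t x. t \<in> {1..?p} \<Longrightarrow> Gb (xi t) (L x) = 0"
    and xi_on: "\<And>s t. s \<in> {1..?p} \<Longrightarrow> t \<in> {1..?p} \<Longrightarrow> Gb (xi s) (xi t) = (if s = t then 1 else 0)"
    and s1: "shape (xi 1) (e 1) = a *\<^sub>R e 1" "shape (xi 1) (e 2) = b *\<^sub>R e 2"
      "\<And>i. i \<in> {3..DIM('a)} \<Longrightarrow> shape (xi 1) (e i) = (a + b) *\<^sub>R e i"
    and st: "\<And>t. t \<in> {2..?p} \<Longrightarrow> shape (xi t) (e 1) = cc t *\<^sub>R e 1 + d t *\<^sub>R e 2"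
      "\<And>t. t \<in> {2..?p} \<Longrightarrow> shape (xi t) (e 2) = d t *\<^sub>R e 1 - cc t *\<^sub>R e 2"
      "\<And>t i. t \<in> {2..?p} \<Longrightarrow> i \<in> {3..DIM('a)} \<Longrightarrow> shape (xi t) (e i) = 0"
    using nf unfolding normal_form_with_def by simp_all
  have o: "i \<in> {1..DIM('a)} \<Longrightarrow> j \<in> {1..DIM('a)} \<Longrightarrow> G (e i) (e j) = (if i = j then 1 else 0)" for i j
    by (rule orthonormalD[OF f])
  have in12: "1 \<in> {1..DIM('a)}" "2 \<in> {1..DIM('a)}" using dim by auto
  have p1: "1 \<in> {1..?p}" using codim by auto
  have casesp: "t \<in> {1..?p} \<Longrightarrow> t = 1 \<or> t \<in> {2..?p}" for t by auto
  have f': "B.frame (\<lambda>i. if i \<le> DIM('a) then L (e i) else xi (i - DIM('a)))" (is "B.frame ?f")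
    unfolding B.orthonormal_def
  proof (intro ballI)
    fix i j assume ij: "i \<in> {1..DIM('b)}" "j \<in> {1..DIM('b)}"
    show "Gb (?f i) (?f j) = (if i = j then 1 else 0)"
    proof (cases "i \<le> DIM('a)"; cases "j \<le> DIM('a)")
      assume "i \<le> DIM('a)" "j \<le> DIM('a)"
      then show ?thesis using o[of i j] ij by (simp add: L_iso)
    next
      assume "i \<le> DIM('a)" "\<not> j \<le> DIM('a)"
      moreover from this have "j - DIM('a) \<in> {1..?p}" using ij by auto
      ultimately show ?thesis
        using xi_normal[of "j - DIM('a)" "e i"] B.sym[of "xi (j - DIM('a))" "L (e i)"] by simp
    next
      assume "\<not> i \<le> DIM('a)" "j \<le> DIM('a)"
      moreover from this have "i - DIM('a) \<in> {1..?p}" using ij by auto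
      ultimately show ?thesis using xi_normal[of "i - DIM('a)" "e j"] by simp
    next
      assume "\<not> i \<le> DIM('a)" "\<not> j \<le> DIM('a)"
      moreover from this have "i - DIM('a) \<in> {1..?p}" "j - DIM('a) \<in> {1..?p}" using ij by auto
      ultimately show ?thesis using xi_on[of "i - DIM('a)" "j - DIM('a)"] by auto
    qed
  qed
  have normal_eqI: "v = w"
    if "\<And>x. Gb v (L x) = 0" "\<And>x. Gb w (L x) = 0" "Gb v (xi 1) = Gb w (xi 1)"
      "\<And>t. t \<in> {2..?p} \<Longrightarrow> Gb v (xi t) = Gb w (xi t)" for v w
  proof (rule B.frame_eqI[OF f'])
    fix i assume "i \<in> {1..DIM('b)}"
    then consider "i \<le> DIM('a)" | "\<not> i \<le> DIM('a)" "i - DIM('a) = 1" | "\<not> i \<le> DIM('a)" "i - DIM('a) \<in> {2..?p}"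
      using casesp[of "i - DIM('a)"] by force
    then show "Gb v (?f i) = Gb w (?f i)"
      by cases (simp_all only: that if_True if_False)
  qed
  define \<xi> where "\<xi> = xi 1"
  \<comment> \<open>This is the sum over t \<ge> 2 of \<open>cc t *\<^sub>R xi t\<close>, and
    \<delta> is the same sum with \<open>d t\<close>; their squared norms add up to the s of the
    overview.\<close>
  define \<gamma> where "\<gamma> = h (e 1) (e 1) - a *\<^sub>R \<xi>"
  define \<delta> where "\<delta> = h (e 1) (e 2)"
  have Nxi: "Gb \<xi> (L x) = 0" for x using xi_normal[OF p1] by (simp add: \<xi>_def)
  have \<xi>1: "Gb \<xi> \<xi> = 1" using xi_on[OF p1 p1] by (simp add: \<xi>_def)
  have \<xi>t: "Gb \<xi> (xi t) = 0" if "t \<in> {2..?p}" for t using xi_on[OF p1, of t] that by (simp add: \<xi>_def)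
  have H: "Gb (h (e i) (e j)) (xi t) = G (shape (xi t) (e i)) (e j)" for i j t by (simp add: G_shape)
  have H1: "Gb (h (e 1) (e 1)) \<xi> = a" "Gb (h (e 2) (e 2)) \<xi> = b" "Gb (h (e 1) (e 2)) \<xi> = 0"
    unfolding \<xi>_def H s1 using o[OF in12(1,1)] o[OF in12(2,2)] o[OF in12] by simp_all
  have Ht: "Gb (h (e 1) (e 1)) (xi t) = cc t" "Gb (h (e 2) (e 2)) (xi t) = - cc t" if "t \<in> {2..?p}" for t
    unfolding H st[OF that] using o[OF in12(1,1)] o[OF in12(2,2)] o[OF in12] o[OF in12(2,1)] by simp_all
  have "Gb \<gamma> \<xi> = 0" "Gb \<delta> \<xi> = 0" using H1 \<xi>1 by (simp_all add: \<gamma>_def \<delta>_def)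
  moreover have "h (e 1) (e 1) = a *\<^sub>R \<xi> + \<gamma>" by (simp add: \<gamma>_def)
  moreover have "h (e 2) (e 2) = b *\<^sub>R \<xi> - \<gamma>"
  proof (rule normal_eqI)
    show "Gb (h (e 2) (e 2)) (xi t) = Gb (b *\<^sub>R \<xi> - \<gamma>) (xi t)" if "t \<in> {2..?p}" for t
      using Ht[OF that] \<xi>t[OF that] by (simp add: \<gamma>_def)
  next
    show "Gb (h (e 2) (e 2)) (xi 1) = Gb (b *\<^sub>R \<xi> - \<gamma>) (xi 1)"
      using H1 \<xi>1 unfolding \<xi>_def[symmetric] by (simp add: \<gamma>_def)
  qed (simp_all add: h_normal \<gamma>_def Nxi)
  moreover have "h (e i) (e j) = (if i = j then (a + b) *\<^sub>R \<xi> else 0)"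
    if i: "i \<in> {3..DIM('a)}" and j: "j \<in> {1..DIM('a)}" for i j
  proof (rule normal_eqI)
    have i': "i \<in> {1..DIM('a)}" using i by auto
    show "Gb (h (e i) (e j)) (xi t) = Gb (if i = j then (a + b) *\<^sub>R \<xi> else 0) (xi t)" if "t \<in> {2..?p}" for t
      unfolding H st(3)[OF that i] using \<xi>t[OF that] by simp
    show "Gb (h (e i) (e j)) (xi 1) = Gb (if i = j then (a + b) *\<^sub>R \<xi> else 0) (xi 1)"
      unfolding H s1(3)[OF i] using \<xi>1 o[OF i' j] unfolding \<xi>_def[symmetric] by simp
  qed (auto simp: h_normal Nxi)
  moreover have "\<gamma> = 0 \<and> \<delta> = 0" if "DIM('b) = DIM('a) + 1"
  proof -
    have "{2..?p} = {}" using that by simp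
    then have *: "v = 0" if "\<And>x. Gb v (L x) = 0" "Gb v \<xi> = 0" for v
      using that by (intro normal_eqI) (auto simp: \<xi>_def)
    have "Gb \<gamma> (L x) = 0" "Gb \<delta> (L x) = 0" for x by (simp_all add: \<gamma>_def \<delta>_def h_normal Nxi)
    then show ?thesis using * \<open>Gb \<gamma> \<xi> = 0\<close> \<open>Gb \<delta> \<xi> = 0\<close> by blast
  qed
  ultimately have "adapted e \<xi> \<gamma> \<delta> a b \<and> (DIM('b) = DIM('a) + 1 \<longrightarrow> \<gamma> = 0 \<and> \<delta> = 0)"
    using f \<xi>1 unfolding adapted_def \<delta>_def by blast
  then show ?thesis by blast
qed

end

section \<open>Curvature and the weakly Einstein condition in a normal form\<close>

context gauss_point
begin

lemma linear_R:
  "linear (\<lambda>x. R x y z w)" "linear (\<lambda>y. R x y z w)" "linear (\<lambda>z. R x y z w)" "linear (R x y z)"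
  by (rule linearI; simp add: gauss h_simps algebra_simps)+

definition check :: "(nat \<Rightarrow> 'a) \<Rightarrow> 'a \<Rightarrow> 'a \<Rightarrow> real" where
  "check e x y = (\<Sum>i\<in>{1..DIM('a)}. \<Sum>j\<in>{1..DIM('a)}. \<Sum>k\<in>{1..DIM('a)}.
     R x (e i) (e j) (e k) * R y (e i) (e j) (e k))"

text \<open>The contraction is defined with an arbitrary frame but evaluated in an adapted one; the
  three indices are exchanged one after the other by \<open>trace_frame\<close>.\<close>

lemma check_frame:
  assumes "frame e" "frame e'"
  shows "check e x y = check e' x y"
proof -
  let ?I = "{1..DIM('a)}"
  note R = linear_R[THEN linear_add] linear_R[THEN linear_scale]
  have "check e x y = (\<Sum>i\<in>?I. \<Sum>j\<in>?I. \<Sum>k\<in>?I. R x (e i) (e j) (e' k) * R y (e i) (e j) (e' k))"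
    unfolding check_def
  proof (rule sum.cong[OF refl], rule sum.cong[OF refl])
    fix i j
    show "(\<Sum>k\<in>?I. R x (e i) (e j) (e k) * R y (e i) (e j) (e k)) =
        (\<Sum>k\<in>?I. R x (e i) (e j) (e' k) * R y (e i) (e j) (e' k))"
      by (rule trace_frame[OF assms, of "\<lambda>u v. R x (e i) (e j) u * R y (e i) (e j) v"];
          rule linearI; simp add: R algebra_simps)
  qed
  also have "\<dots> = (\<Sum>i\<in>?I. \<Sum>j\<in>?I. \<Sum>k\<in>?I. R x (e i) (e' j) (e' k) * R y (e i) (e' j) (e' k))"
  proof (rule sum.cong[OF refl])
    fix i
    show "(\<Sum>j\<in>?I. \<Sum>k\<in>?I. R x (e i) (e j) (e' k) * R y (e i) (e j) (e' k)) =
        (\<Sum>j\<in>?I. \<Sum>k\<in>?I. R x (e i) (e' j) (e' k) * R y (e i) (e' j) (e' k))"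
      by (rule trace_frame[OF assms, of "\<lambda>u v. \<Sum>k\<in>?I. R x (e i) u (e' k) * R y (e i) v (e' k)"];
          rule linearI; simp add: R sum.distrib sum_distrib_left algebra_simps)
  qed
  also have "\<dots> = check e' x y"
    unfolding check_def
    by (rule trace_frame[OF assms, of "\<lambda>u v. \<Sum>j\<in>?I. \<Sum>k\<in>?I. R x u (e' j) (e' k) * R y v (e' j) (e' k)"];
        rule linearI; simp add: R sum.distrib sum_distrib_left algebra_simps)
  finally show ?thesis .
qed

lemma dim_in: "1 \<in> {1..DIM('a)}" "2 \<in> {1..DIM('a)}" "3 \<in> {1..DIM('a)}" "3 \<in> {3..DIM('a)}"
  using dim by auto

lemma adapted_frame: "adapted e \<xi> \<gamma> \<delta> a b \<Longrightarrow> frame e" by (simp add: adapted_def)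

lemma adapted_h:
  assumes ad: "adapted e \<xi> \<gamma> \<delta> a b"
  shows "h (e 1) w = G w (e 1) *\<^sub>R (a *\<^sub>R \<xi> + \<gamma>) + G w (e 2) *\<^sub>R \<delta>"
    and "h (e 2) w = G w (e 1) *\<^sub>R \<delta> + G w (e 2) *\<^sub>R (b *\<^sub>R \<xi> - \<gamma>)"
    and "i \<in> {3..DIM('a)} \<Longrightarrow> h (e i) w = (G w (e i) * (a + b)) *\<^sub>R \<xi>"
proof -
  have ex: "h x w = G w (e 1) *\<^sub>R h x (e 1) + (G w (e 2) *\<^sub>R h x (e 2) +
      (\<Sum>i\<in>{3..DIM('a)}. G w (e i) *\<^sub>R h x (e i)))" for x
    using frame_linear_expand[OF adapted_frame[OF ad], of "h x" w] h_bil
    unfolding sum_split12 by (simp add: bilinear_def)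
  have h3: "h (e i) (e j) = (if i = j then (a + b) *\<^sub>R \<xi> else 0)"
    if "i \<in> {3..DIM('a)}" "j \<in> {1..DIM('a)}" for i j
    using ad that by (simp add: adapted_def)
  have h12: "h (e 1) (e i) = 0" "h (e 2) (e i) = 0" if "i \<in> {3..DIM('a)}" for i
    using h3[OF that dim_in(1)] h3[OF that dim_in(2)] that h_sym[of "e 1" "e i"] h_sym[of "e 2" "e i"]
    by auto
  have z: "(\<Sum>i\<in>{3..DIM('a)}. G w (e i) *\<^sub>R h (e 1) (e i)) = 0"
    "(\<Sum>i\<in>{3..DIM('a)}. G w (e i) *\<^sub>R h (e 2) (e i)) = 0"
    by (intro sum.neutral ballI; simp add: h12[simplified])+
  have h: "h (e 1) (e 1) = a *\<^sub>R \<xi> + \<gamma>" "h (e 2) (e 2) = b *\<^sub>R \<xi> - \<gamma>" "h (e 1) (e 2) = \<delta>"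
    "h (e 2) (e 1) = \<delta>"
    using ad h_sym[of "e 2" "e 1"] by (simp_all add: adapted_def)
  show "h (e 1) w = G w (e 1) *\<^sub>R (a *\<^sub>R \<xi> + \<gamma>) + G w (e 2) *\<^sub>R \<delta>"
    unfolding ex[of "e 1"] z h by simp
  show "h (e 2) w = G w (e 1) *\<^sub>R \<delta> + G w (e 2) *\<^sub>R (b *\<^sub>R \<xi> - \<gamma>)"
    unfolding ex[of "e 2"] z h by simp
  show "h (e i) w = (G w (e i) * (a + b)) *\<^sub>R \<xi>" if i: "i \<in> {3..DIM('a)}"
  proof -
    have "h (e i) w = (\<Sum>j\<in>{1..DIM('a)}. G w (e j) *\<^sub>R h (e i) (e j))"
      using frame_linear_expand[OF adapted_frame[OF ad], of "h (e i)" w] h_bil by (simp add: bilinear_def)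
    also have "\<dots> = (\<Sum>j\<in>{1..DIM('a)}. if i = j then (G w (e j) * (a + b)) *\<^sub>R \<xi> else 0)"
      using h3[OF i] by (intro sum.cong refl) simp
    finally show ?thesis using i by simp
  qed
qed

text \<open>The sectional curvatures of the coordinate planes of an adapted frame.\<close>

definition curv_entry :: "real \<Rightarrow> real \<Rightarrow> real \<Rightarrow> nat \<Rightarrow> nat \<Rightarrow> real" where
  "curv_entry a b s i j = (if i = j then 0 else if i \<le> 2 \<and> j \<le> 2 then c + a * b - s
     else if i = 1 \<or> j = 1 then c + a * (a + b) else if i = 2 \<or> j = 2 then c + b * (a + b)
     else c + (a + b)\<^sup>2)"

text \<open>The curvature operator is diagonal on the bivectors of the frame. In the block of
  \<open>e 1\<close> and \<open>e 2\<close> the terms with \<open>Gb \<gamma> \<delta>\<close>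
  cancel, so the normal directions beyond the first enter through one number only.\<close>

lemma adapted_curvature:
  assumes ad: "adapted e \<xi> \<gamma> \<delta> a b" and i: "i \<in> {1..DIM('a)}" and j: "j \<in> {1..DIM('a)}"
  shows "R (e i) (e j) z w = curv_entry a b (Gb \<gamma> \<gamma> + Gb \<delta> \<delta>) i j *
    (G z (e j) * G w (e i) - G z (e i) * G w (e j))"
proof -
  note h1 = adapted_h(1)[OF ad] and h2 = adapted_h(2)[OF ad] and h3 = adapted_h(3)[OF ad]
  have o: "Gb \<xi> \<xi> = 1" "Gb \<gamma> \<xi> = 0" "Gb \<delta> \<xi> = 0" "Gb \<xi> \<gamma> = 0" "Gb \<xi> \<delta> = 0" "Gb \<delta> \<gamma> = Gb \<gamma> \<delta>"
    using ad B.sym[of \<xi> \<gamma>] B.sym[of \<xi> \<delta>] B.sym[of \<gamma> \<delta>] by (simp_all add: adapted_def)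
  have skew: "R x y z w = - R y x z w" for x y by (simp add: gauss B.sym[of "h x w" "h y z"] B.sym[of "h y w" "h x z"] algebra_simps)
  have eskew: "curv_entry a b s i j = curv_entry a b s j i" for s i j by (auto simp: curv_entry_def)
  have main: "R (e i) (e j) z w = curv_entry a b (Gb \<gamma> \<gamma> + Gb \<delta> \<delta>) i j *
      (G z (e j) * G w (e i) - G z (e i) * G w (e j))"
    if ij: "i < j" "i \<in> {1..DIM('a)}" "j \<in> {1..DIM('a)}" for i j
  proof -
    have g: "R (e i) (e j) z w = c * (G z (e j) * G w (e i) - G z (e i) * G w (e j))
        + Gb (h (e j) z) (h (e i) w) - Gb (h (e i) z) (h (e j) w)"
      by (simp add: gauss sym[of "e i" z] sym[of "e i" w] sym[of "e j" z] sym[of "e j" w])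
    consider "i = 1" "j = 2" | "i = 1" "j \<in> {3..DIM('a)}" | "i = 2" "j \<in> {3..DIM('a)}"
      | "i \<in> {3..DIM('a)}" "j \<in> {3..DIM('a)}" using ij by force
    then show ?thesis
    proof cases
      case 1
      show ?thesis unfolding g unfolding 1 h1 h2 curv_entry_def by (simp add: o algebra_simps)
    next
      case 2
      then have "curv_entry a b (Gb \<gamma> \<gamma> + Gb \<delta> \<delta>) i j = c + a * (a + b)" by (auto simp: curv_entry_def)
      then show ?thesis unfolding g h3[OF 2(2)] unfolding 2(1) h1 by (simp add: o algebra_simps)
    next
      case 3
      then have "curv_entry a b (Gb \<gamma> \<gamma> + Gb \<delta> \<delta>) i j = c + b * (a + b)" by (auto simp: curv_entry_def)
      then show ?thesis unfolding g h3[OF 3(2)] unfolding 3(1) h2 by (simp add: o algebra_simps)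
    next
      case 4
      then have "curv_entry a b (Gb \<gamma> \<gamma> + Gb \<delta> \<delta>) i j = c + (a + b)\<^sup>2" using ij by (auto simp: curv_entry_def)
      then show ?thesis unfolding g h3[OF 4(1)] h3[OF 4(2)] by (simp add: o power2_eq_square algebra_simps)
    qed
  qed
  consider "i < j" | "i = j" | "j < i" by linarith
  then show ?thesis
  proof cases
    case 1
    then show ?thesis using main i j by blast
  next
    case 2
    then show ?thesis using skew[of "e i" "e i"] by (simp add: curv_entry_def)
  next
    case 3
    then show ?thesis using main[OF 3 j i] skew[of "e i" "e j"] eskew[of _ i j] by (simp add: algebra_simps)
  qed
qed

text \<open>For fixed i \<noteq> j only (k, l) = (j, i) and (k, l) = (i, j) contribute, hence the
  factor 2.\<close>

lemma adapted_check:
  assumes ad: "adapted e \<xi> \<gamma> \<delta> a b" and i: "i \<in> {1..DIM('a)}"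
  shows "check e (e i) (e i) = 2 * (\<Sum>j\<in>{1..DIM('a)}. (curv_entry a b (Gb \<gamma> \<gamma> + Gb \<delta> \<delta>) i j)\<^sup>2)"
proof -
  let ?I = "{1..DIM('a)}" and ?K = "curv_entry a b (Gb \<gamma> \<gamma> + Gb \<delta> \<delta>)"
  define d where "d k l = (if k = l then 1 else 0 :: real)" for k l :: nat
  have o: "k \<in> ?I \<Longrightarrow> l \<in> ?I \<Longrightarrow> G (e k) (e l) = d k l" for k l
    using orthonormalD[OF adapted_frame[OF ad]] by (simp add: d_def)
  have "(\<Sum>k\<in>?I. \<Sum>l\<in>?I. R (e i) (e j) (e k) (e l) * R (e i) (e j) (e k) (e l)) = 2 * (?K i j)\<^sup>2"
    if j: "j \<in> ?I" for j
  proof (cases "i = j")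
    case True
    then show ?thesis by (simp add: adapted_curvature[OF ad j j] curv_entry_def)
  next
    case False
    have "(\<Sum>k\<in>?I. \<Sum>l\<in>?I. R (e i) (e j) (e k) (e l) * R (e i) (e j) (e k) (e l)) =
        (\<Sum>k\<in>?I. \<Sum>l\<in>?I. (?K i j)\<^sup>2 * (d k j * d l i + d k i * d l j))"
    proof (intro sum.cong refl)
      fix k l assume k: "k \<in> ?I" and l: "l \<in> ?I"
      show "R (e i) (e j) (e k) (e l) * R (e i) (e j) (e k) (e l) =
          (?K i j)\<^sup>2 * (d k j * d l i + d k i * d l j)"
        unfolding adapted_curvature[OF ad i j] o[OF k j] o[OF l i] o[OF k i] o[OF l j]
        using False by (auto simp: d_def power2_eq_square)
    qed
    also have "\<dots> = (?K i j)\<^sup>2 * ((\<Sum>k\<in>?I. d k j) * (\<Sum>l\<in>?I. d l i) + (\<Sum>k\<in>?I. d k i) * (\<Sum>l\<in>?I. d l j))"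
      unfolding sum_product by (simp add: sum_distrib_left sum.distrib distrib_left)
    also have "(\<Sum>k\<in>?I. d k i) = 1" using i by (simp add: d_def)
    also have "(\<Sum>k\<in>?I. d k j) = 1" using j by (simp add: d_def)
    finally show ?thesis by simp
  qed
  then show ?thesis unfolding check_def sum_distrib_left by (intro sum.cong refl) blast
qed

text \<open>\<open>A\<close>, \<open>B\<close>, \<open>C\<close>, \<open>D\<close> are the
  curvatures of the planes (1,2), (1,j), (2,j), (j,k) with j, k \<ge> 3. All directions from the
  third on look alike, so it suffices to compare the diagonal values at \<open>e 1\<close>,
  \<open>e 2\<close> and \<open>e 3\<close>: the first two give the first equation, the outer two
  the second.\<close>

lemma weakly_einstein_at:
  assumes ad: "adapted e \<xi> \<gamma> \<delta> a b"
    and W: "\<And>x y. check e x y = \<rho> * G x y"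
    and defs: "A = c + a * b - (Gb \<gamma> \<gamma> + Gb \<delta> \<delta>)" "B = c + a * (a + b)" "C = c + b * (a + b)" "D = c + (a + b)\<^sup>2"
  shows "B\<^sup>2 = C\<^sup>2" "A\<^sup>2 + (real DIM('a) - 2) * B\<^sup>2 = B\<^sup>2 + C\<^sup>2 + (real DIM('a) - 3) * D\<^sup>2"
proof -
  let ?I = "{1..DIM('a)}" and ?J = "{3..DIM('a)}" and ?K = "curv_entry a b (Gb \<gamma> \<gamma> + Gb \<delta> \<delta>)"
  have \<rho>: "2 * (\<Sum>j\<in>?I. (?K i j)\<^sup>2) = \<rho>" if "i \<in> ?I" for i
    using adapted_check[OF ad that] W[of "e i" "e i"] orthonormalD[OF adapted_frame[OF ad] that that] by simp
  have n: "real (card ?J) = real DIM('a) - 2" using dim by (simp add: of_nat_diff)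
  have "(\<Sum>j\<in>?J. (?K 1 j)\<^sup>2) = (\<Sum>j\<in>?J. B\<^sup>2)" "(\<Sum>j\<in>?J. (?K 2 j)\<^sup>2) = (\<Sum>j\<in>?J. C\<^sup>2)"
    by (intro sum.cong refl; simp add: curv_entry_def defs)+
  then have J: "(\<Sum>j\<in>?J. (?K 1 j)\<^sup>2) = (real DIM('a) - 2) * B\<^sup>2" "(\<Sum>j\<in>?J. (?K 2 j)\<^sup>2) = (real DIM('a) - 2) * C\<^sup>2"
    by (simp_all only: sum_constant n)
  have "(\<Sum>j\<in>?J. (?K 3 j)\<^sup>2) = (\<Sum>j\<in>?J - {3}. D\<^sup>2)"
  proof -
    have "(\<Sum>j\<in>?J. (?K 3 j)\<^sup>2) = (?K 3 3)\<^sup>2 + (\<Sum>j\<in>?J - {3}. (?K 3 j)\<^sup>2)"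
      using dim by (intro sum.remove) auto
    also have "(\<Sum>j\<in>?J - {3}. (?K 3 j)\<^sup>2) = (\<Sum>j\<in>?J - {3}. D\<^sup>2)"
      by (intro sum.cong refl) (auto simp: curv_entry_def defs)
    finally show ?thesis by (simp add: curv_entry_def)
  qed
  also have "\<dots> = (real DIM('a) - 3) * D\<^sup>2"
    using dim by (simp add: of_nat_diff)
  finally have J3: "(\<Sum>j\<in>?J. (?K 3 j)\<^sup>2) = (real DIM('a) - 3) * D\<^sup>2" .
  have K: "(?K 1 1)\<^sup>2 = 0" "(?K 1 2)\<^sup>2 = A\<^sup>2" "(?K 2 1)\<^sup>2 = A\<^sup>2" "(?K 2 2)\<^sup>2 = 0" "(?K 3 1)\<^sup>2 = B\<^sup>2" "(?K 3 2)\<^sup>2 = C\<^sup>2"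
    by (simp_all add: curv_entry_def defs)
  have e1: "2 * (A\<^sup>2 + (real DIM('a) - 2) * B\<^sup>2) = \<rho>"
    using \<rho>[OF dim_in(1)] unfolding sum_split12 J K by simp
  have e2: "2 * (A\<^sup>2 + (real DIM('a) - 2) * C\<^sup>2) = \<rho>"
    using \<rho>[OF dim_in(2)] unfolding sum_split12 J K by simp
  have e3: "2 * (B\<^sup>2 + (C\<^sup>2 + (real DIM('a) - 3) * D\<^sup>2)) = \<rho>"
    using \<rho>[OF dim_in(3)] unfolding sum_split12 J3 K by simp
  have half: "p = q" if "2 * p = \<rho>" "2 * q = \<rho>" for p q :: real using that by argo
  have "(real DIM('a) - 2) * B\<^sup>2 = (real DIM('a) - 2) * C\<^sup>2"
    by (rule add_left_imp_eq[OF half[OF e1 e2]])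
  then show "B\<^sup>2 = C\<^sup>2" using dim by (auto simp: mult_cancel_left)
  show "A\<^sup>2 + (real DIM('a) - 2) * B\<^sup>2 = B\<^sup>2 + C\<^sup>2 + (real DIM('a) - 3) * D\<^sup>2"
    using half[OF e1 e3] by (simp only: add.assoc)
qed

text \<open>The plane contributes a + b once and each of the n - 2 other directions once more. This
  is the origin of the factor n / (n - 1) between the mean curvature vector and (a + b) times the
  first normal vector.\<close>

lemma adapted_trace_h:
  assumes ad: "adapted e \<xi> \<gamma> \<delta> a b"
  shows "trace_h e = ((real DIM('a) - 1) * (a + b)) *\<^sub>R \<xi>"
proof -
  have "(\<Sum>i\<in>{3..DIM('a)}. h (e i) (e i)) = (\<Sum>i\<in>{3..DIM('a)}. (a + b) *\<^sub>R \<xi>)"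
    using ad by (intro sum.cong refl) (auto simp: adapted_def)
  then have J: "(\<Sum>i\<in>{3..DIM('a)}. h (e i) (e i)) = ((real DIM('a) - 2) * (a + b)) *\<^sub>R \<xi>"
    using dim by (simp add: sum_constant_scaleR of_nat_diff del: sum_constant)
  have h: "h (e 1) (e 1) = a *\<^sub>R \<xi> + \<gamma>" "h (e 2) (e 2) = b *\<^sub>R \<xi> - \<gamma>"
    using ad by (simp_all add: adapted_def)
  have "trace_h e = (a + b + (real DIM('a) - 2) * (a + b)) *\<^sub>R \<xi>"
    unfolding trace_h_def sum_split12 J h by (simp add: scaleR_left_distrib)
  also have "a + b + (real DIM('a) - 2) * (a + b) = (real DIM('a) - 1) * (a + b)"
    by (simp add: algebra_simps)
  finally show ?thesis .
qed

text \<open>With b = - a the last assumption says that a^2 and the two squared norms add up to zero,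
  so \<open>h\<close> vanishes.\<close>

lemma adapted_totally_geodesic:
  assumes ad: "adapted e \<xi> \<gamma> \<delta> a b" and "a + b = 0" "a * b = Gb \<gamma> \<gamma> + Gb \<delta> \<delta>"
  shows "R x y z w = c * (G y z * G x w - G x z * G y w)"
proof -
  have b: "b = - a" using assms(2) by simp
  have "a * a + Gb \<gamma> \<gamma> + Gb \<delta> \<delta> = 0" using assms(3) unfolding b by simp
  then have "a * a = 0" "Gb \<gamma> \<gamma> = 0" "Gb \<delta> \<delta> = 0"
    using zero_le_square[of a] B.nonneg[of \<gamma>] B.nonneg[of \<delta>] by linarith+
  then have z: "a = 0" "b = 0" "\<gamma> = 0" "\<delta> = 0" by (auto simp: b B.eq_zero_iff)
  have "h (e i) w = 0" if i: "i \<in> {1..DIM('a)}" for i w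
  proof -
    consider "i = 1" | "i = 2" | "i \<in> {3..DIM('a)}" using i by force
    then show ?thesis
      by cases (use adapted_h[OF ad] z in \<open>simp_all\<close>)
  qed
  note h0 = this
  have "h x w = 0" for x w
  proof -
    have "linear (\<lambda>x. h x w)" using h_bil by (simp add: bilinear_def)
    then have "h x w = (\<Sum>i\<in>{1..DIM('a)}. G x (e i) *\<^sub>R h (e i) w)"
      by (rule frame_linear_expand[OF adapted_frame[OF ad]])
    also have "\<dots> = 0" by (intro sum.neutral ballI) (simp only: h0 scale_zero_right)
    finally show ?thesis .
  qed
  then show ?thesis by (simp add: gauss)
qed

text \<open>If a + b = 0, every coordinate plane other than that of \<open>e 1\<close> and
  \<open>e 2\<close> has curvature \<open>c\<close>, and the exceptional one has at least
  \<open>- c\<close>. The n - 2 \<ge> 1 complementary directions compensate the single negative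
  term, and the Ricci form is diagonal in the frame.\<close>

lemma adapted_minimal_ricci_nonneg:
  assumes ad: "adapted e \<xi> \<gamma> \<delta> a b" and "a + b = 0" "c > 0"
    and "c + a * b - (Gb \<gamma> \<gamma> + Gb \<delta> \<delta>) \<ge> - c"
  shows "(\<Sum>i\<in>{1..DIM('a)}. R (e i) x x (e i)) \<ge> 0"
proof -
  let ?I = "{1..DIM('a)}" and ?J = "{3..DIM('a)}" and ?K = "curv_entry a b (Gb \<gamma> \<gamma> + Gb \<delta> \<delta>)"
  note f = adapted_frame[OF ad]
  have K: "?K i j \<ge> (if i = j then 0 else if i \<le> 2 \<and> j \<le> 2 then - c else c)" for i j
    using assms(2-4) by (simp add: curv_entry_def)
  have "R (e i) x x (e i) = (\<Sum>j\<in>?I. ?K i j * (G x (e j) * G x (e j)))" if i: "i \<in> ?I" for i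
  proof -
    have "R (e i) x x (e i) = (\<Sum>j\<in>?I. G x (e j) *\<^sub>R R (e i) (e j) x (e i))"
      by (rule frame_linear_expand[OF f linear_R(2)])
    also have "\<dots> = (\<Sum>j\<in>?I. ?K i j * (G x (e j) * G x (e j)))"
    proof (intro sum.cong refl)
      fix j assume j: "j \<in> ?I"
      show "G x (e j) *\<^sub>R R (e i) (e j) x (e i) = ?K i j * (G x (e j) * G x (e j))"
        unfolding adapted_curvature[OF ad i j]
        using orthonormalD[OF f i i] orthonormalD[OF f i j]
        by (cases "i = j") (simp_all add: curv_entry_def algebra_simps)
    qed
    finally show ?thesis .
  qed
  then have *: "(\<Sum>i\<in>?I. R (e i) x x (e i)) = (\<Sum>i\<in>?I. \<Sum>j\<in>?I. ?K i j * (G x (e j) * G x (e j)))"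
    by (intro sum.cong refl)
  have "(\<Sum>i\<in>?I. R (e i) x x (e i)) = (\<Sum>j\<in>?I. (\<Sum>i\<in>?I. ?K i j) * (G x (e j) * G x (e j)))"
  proof -
    have "(\<Sum>i\<in>?I. \<Sum>j\<in>?I. ?K i j * (G x (e j) * G x (e j))) =
        (\<Sum>j\<in>?I. \<Sum>i\<in>?I. ?K i j * (G x (e j) * G x (e j)))"
      by (rule sum.swap)
    with * show ?thesis by (simp add: sum_distrib_right)
  qed
  also have "\<dots> \<ge> 0"
  proof (rule sum_nonneg, rule mult_nonneg_nonneg)
    fix j assume j: "j \<in> ?I"
    have "(\<Sum>i\<in>?I. ?K i j) \<ge> (\<Sum>i\<in>?I. if i = j then 0 else if i \<le> 2 \<and> j \<le> 2 then - c else c)"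
      by (intro sum_mono K)
    moreover have "(\<Sum>i\<in>?I. if i = j then 0 else if i \<le> 2 \<and> j \<le> 2 then - c else c) \<ge> 0"
    proof -
      consider "j = 1" | "j = 2" | "j \<ge> 3" using j by force
      then show ?thesis
      proof cases
        case 3
        then show ?thesis using assms(3) by (intro sum_nonneg) auto
      qed (unfold sum_split12, use assms(3) dim in \<open>auto simp: of_nat_diff\<close>)
    qed
    ultimately show "(\<Sum>i\<in>?I. ?K i j) \<ge> 0" by linarith
  qed simp
  finally show ?thesis .
qed

text \<open>For a = b the second fundamental form is a multiple of \<xi> that depends on
  \<open>G\<close> and \<open>P\<close> alone, plus a remainder orthogonal to \<xi>. Pairing with
  the multiple of \<xi> given by the mean curvature vector isolates \<open>P\<close>, which makes
  the plane field accessible to differentiation.\<close>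

lemma adapted_umbilic_structure:
  assumes ad: "adapted e \<xi> \<gamma> \<delta> a a"
    and P: "\<And>x y. P x y = G x (e 1) * G y (e 1) + G x (e 2) * G y (e 2)"
  shows "Gb (h x y) ((2 * a) *\<^sub>R \<xi>) = 2 * a\<^sup>2 * (2 * G x y - P x y)"
    and "R x y z w = (c + 4 * a\<^sup>2) * (G y z * G x w - G x z * G y w)
      - 2 * a\<^sup>2 * (P y z * G x w + G y z * P x w - P x z * G y w - G x z * P y w)
      + (a\<^sup>2 - (Gb \<gamma> \<gamma> + Gb \<delta> \<delta>)) * (P y z * P x w - P x z * P y w)"
proof -
  \<comment> \<open>The trace-free part on the plane. The terms with
    \<open>Gb \<gamma> \<delta>\<close> cancel in its curvature contribution, leaving a multiple of
    the curvature form built from \<open>P\<close>.\<close>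
  define \<beta> where "\<beta> x y = (G x (e 1) * G y (e 1) - G x (e 2) * G y (e 2)) *\<^sub>R \<gamma>
    + (G x (e 1) * G y (e 2) + G x (e 2) * G y (e 1)) *\<^sub>R \<delta>" for x y
  have o: "Gb \<xi> \<xi> = 1" "Gb \<gamma> \<xi> = 0" "Gb \<delta> \<xi> = 0" "Gb \<xi> \<gamma> = 0" "Gb \<xi> \<delta> = 0" "Gb \<delta> \<gamma> = Gb \<gamma> \<delta>"
    using ad B.sym[of \<xi> \<gamma>] B.sym[of \<xi> \<delta>] B.sym[of \<gamma> \<delta>] by (simp_all add: adapted_def)
  note f = adapted_frame[OF ad]
  have h: "h x y = (a * (2 * G x y - P x y)) *\<^sub>R \<xi> + \<beta> x y" for x y
  proof -
    have "linear (\<lambda>x. h x y)" using h_bil by (simp add: bilinear_def)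
    from frame_linear_expand[OF f this, of x]
    have "h x y = G x (e 1) *\<^sub>R h (e 1) y + (G x (e 2) *\<^sub>R h (e 2) y
        + (\<Sum>i\<in>{3..DIM('a)}. G x (e i) *\<^sub>R h (e i) y))"
      unfolding sum_split12 .
    also have "(\<Sum>i\<in>{3..DIM('a)}. G x (e i) *\<^sub>R h (e i) y) =
        (2 * a * (\<Sum>i\<in>{3..DIM('a)}. G x (e i) * G y (e i))) *\<^sub>R \<xi>"
      unfolding sum_distrib_left scaleR_left.sum
      by (intro sum.cong refl) (simp add: adapted_h(3)[OF ad] mult_ac)
    also have "(\<Sum>i\<in>{3..DIM('a)}. G x (e i) * G y (e i)) = G x y - P x y"
    proof -
      have "G x y = (\<Sum>i\<in>{1..DIM('a)}. G y (e i) *\<^sub>R G x (e i))"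
        by (rule frame_linear_expand[OF f linear_right])
      then show ?thesis unfolding sum_split12 by (simp add: P mult.commute)
    qed
    finally have "h x y = G x (e 1) *\<^sub>R (G y (e 1) *\<^sub>R (a *\<^sub>R \<xi> + \<gamma>) + G y (e 2) *\<^sub>R \<delta>)
        + (G x (e 2) *\<^sub>R (G y (e 1) *\<^sub>R \<delta> + G y (e 2) *\<^sub>R (a *\<^sub>R \<xi> - \<gamma>))
        + (2 * a * (G x y - P x y)) *\<^sub>R \<xi>)"
      unfolding adapted_h(1,2)[OF ad] .
    also have "\<dots> = (a * (G x (e 1) * G y (e 1) + G x (e 2) * G y (e 2)) + 2 * a * (G x y - P x y)) *\<^sub>R \<xi> + \<beta> x y"
      by (simp add: \<beta>_def algebra_simps)
    also have "a * (G x (e 1) * G y (e 1) + G x (e 2) * G y (e 2)) + 2 * a * (G x y - P x y) = a * (2 * G x y - P x y)"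
      unfolding P[symmetric] by (simp add: algebra_simps)
    finally show ?thesis .
  qed
  have \<beta>\<xi>: "Gb (\<beta> x y) \<xi> = 0" "Gb \<xi> (\<beta> x y) = 0" for x y by (simp_all add: \<beta>_def o)
  show "Gb (h x y) ((2 * a) *\<^sub>R \<xi>) = 2 * a\<^sup>2 * (2 * G x y - P x y)"
    unfolding h by (simp add: \<beta>\<xi> o power2_eq_square)
  have hh: "Gb (h x y) (h z w) = a\<^sup>2 * ((2 * G x y - P x y) * (2 * G z w - P z w)) + Gb (\<beta> x y) (\<beta> z w)" for x y z w
    unfolding h by (simp add: \<beta>\<xi> o power2_eq_square)
  have \<beta>\<beta>: "Gb (\<beta> y z) (\<beta> x w) - Gb (\<beta> x z) (\<beta> y w) = - (Gb \<gamma> \<gamma> + Gb \<delta> \<delta>) * (P y z * P x w - P x z * P y w)"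
  proof -
    have 1: "Gb (k *\<^sub>R \<gamma> + l *\<^sub>R \<delta>) (k' *\<^sub>R \<gamma> + l' *\<^sub>R \<delta>) =
        k * k' * Gb \<gamma> \<gamma> + (k * l' + l * k') * Gb \<gamma> \<delta> + l * l' * Gb \<delta> \<delta>" for k l k' l'
      by (simp add: o algebra_simps)
    show ?thesis unfolding \<beta>_def 1 P by (simp add: algebra_simps)
  qed
  show "R x y z w = (c + 4 * a\<^sup>2) * (G y z * G x w - G x z * G y w)
      - 2 * a\<^sup>2 * (P y z * G x w + G y z * P x w - P x z * G y w - G x z * P y w)
      + (a\<^sup>2 - (Gb \<gamma> \<gamma> + Gb \<delta> \<delta>)) * (P y z * P x w - P x z * P y w)"
  proof -
    have "R x y z w = c * (G y z * G x w - G x z * G y w)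
        + a\<^sup>2 * ((2 * G y z - P y z) * (2 * G x w - P x w) - (2 * G x z - P x z) * (2 * G y w - P y w))
        + (Gb (\<beta> y z) (\<beta> x w) - Gb (\<beta> x z) (\<beta> y w))"
      unfolding gauss hh by (simp add: right_diff_distrib)
    also have "\<dots> = (c + 4 * a\<^sup>2) * (G y z * G x w - G x z * G y w)
      - 2 * a\<^sup>2 * (P y z * G x w + G y z * P x w - P x z * G y w - G x z * P y w)
      + (a\<^sup>2 - (Gb \<gamma> \<gamma> + Gb \<delta> \<delta>)) * (P y z * P x w - P x z * P y w)"
      unfolding \<beta>\<beta> by (simp add: algebra_simps)
    finally show ?thesis .
  qed
qed

end

section \<open>The umbilic structure in dimension at least five\<close>

text \<open>
  The Gauss equation gives this curvature tensor where \<open>a = b \<noteq> 0\<close> in the normal form: \<open>X = a\<^sup>2\<close>, \<open>P\<close> is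
  the orthogonal projection onto the plane of \<open>e 1\<close> and \<open>e 2\<close>, and \<open>c + q\<close> is the sectional curvature of
  that plane.
\<close>

locale plane_structure = metric_chart S g for S and g :: "'a::euclidean_space coord_metric" +
  fixes V :: "'a set" and P :: "'a \<Rightarrow> 'a \<Rightarrow> 'a \<Rightarrow> real" and X q :: "'a \<Rightarrow> real" and c :: real
  assumes dim5: "DIM('a) \<ge> 5" and V: "open V" "V \<subseteq> S"
    and bilinear_P: "u \<in> V \<Longrightarrow> bilinear (P u)"
    and smooth_P: "smooth_on V (\<lambda>u. P u x y)"
    and smooth_X: "smooth_on V X" and smooth_q: "smooth_on V q"
    and X_nz: "u \<in> V \<Longrightarrow> X u \<noteq> 0"
    and P_frame: "u \<in> V \<Longrightarrow> \<exists>e. inner_form.orthonormal (g u) DIM('a) e \<and>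
      (\<forall>x y. P u x y = g u x (e 1) * g u y (e 1) + g u x (e 2) * g u y (e 2))"
    and riem4_formula: "u \<in> V \<Longrightarrow> riem4 g u x y z w =
      (c + 4 * X u) * (g u y z * g u x w - g u x z * g u y w)
      - 2 * X u * (P u y z * g u x w + g u y z * P u x w - P u x z * g u y w - g u x z * P u y w)
      + q u * (P u y z * P u x w - P u x z * P u y w)"
begin

lemma in_S: "u \<in> V \<Longrightarrow> u \<in> S" using V by auto

definition nabP :: "'a \<Rightarrow> 'a \<Rightarrow> 'a \<Rightarrow> 'a \<Rightarrow> real" where
  "nabP u v x y = dderiv (\<lambda>q. P q x y) u v - P u (christoffel g u v x) y - P u x (christoffel g u v y)"

lemma P_sym: "u \<in> V \<Longrightarrow> P u x y = P u y x"
  using P_frame[of u] by (auto simp: mult.commute)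

lemma nabP_sym: "u \<in> V \<Longrightarrow> nabP u v x y = nabP u v y x"
  using dderiv_cong[OF V(1) _ P_sym smooth_on_differentiable[OF smooth_P V(1)], of u x y]
    P_sym[of u "christoffel g u v x" y] P_sym[of u x "christoffel g u v y"]
  by (simp add: nabP_def)

lemma linear_nabP:
  assumes u: "u \<in> V"
  shows "linear (\<lambda>v. nabP u v x y)" "linear (\<lambda>x. nabP u v x y)" "linear (nabP u v x)"
proof -
  have P: "linear (\<lambda>x. P q x y)" "linear (P q x)" if "q \<in> V" for q x y
    using bilinear_P[OF that] by (auto simp: bilinear_def)
  have 1: "linear (dderiv (\<lambda>q. P q x y) u)" by (rule linear_dderiv[OF smooth_P V(1) u])
  have 2: "linear (\<lambda>x. dderiv (\<lambda>q. P q x y) u v)" for y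
    by (rule linear_dderiv_family[of V "\<lambda>q x. P q x y", OF V(1) P(1) smooth_P u])
  note l = linear_add linear_scale
  note s = christoffel_simps[OF in_S[OF u]] P[OF u, THEN linear_add] P[OF u, THEN linear_scale]
  show "linear (\<lambda>v. nabP u v x y)"
    unfolding nabP_def by (rule linearI; simp add: l[OF 1] s algebra_simps)
  show 3: "linear (\<lambda>x. nabP u v x y)" for y
    unfolding nabP_def by (rule linearI; simp add: l[OF 2] s algebra_simps)
  show "linear (nabP u v x)"
  proof -
    have "nabP u v x = (\<lambda>y. nabP u v y x)" by (intro ext nabP_sym[OF u])
    then show ?thesis using 3[of x] by simp
  qed
qed

text \<open>The Leibniz rule applied to \<open>riem4_formula\<close>. The metric is parallel, so
  only derivatives of \<open>X\<close>, \<open>q\<close> and \<open>P\<close> remain once the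
  Christoffel terms cancel.\<close>

lemma nabla_riem4_formula:
  assumes u: "u \<in> V"
  shows "nabla_riem4 u v x y z w =
    4 * dderiv X u v * (g u y z * g u x w - g u x z * g u y w)
    - 2 * dderiv X u v * (P u y z * g u x w + g u y z * P u x w - P u x z * g u y w - g u x z * P u y w)
    - 2 * X u * (nabP u v y z * g u x w + g u y z * nabP u v x w - nabP u v x z * g u y w - g u x z * nabP u v y w)
    + dderiv q u v * (P u y z * P u x w - P u x z * P u y w)
    + q u * (nabP u v y z * P u x w + P u y z * nabP u v x w - nabP u v x z * P u y w - P u x z * nabP u v y w)"
proof -
  have dP: "((\<lambda>q. P q a b) has_derivative (\<lambda>v. nabP u v a b + P u (christoffel g u v a) b + P u a (christoffel g u v b))) (at u)"
    for a b
    using smooth_on_has_derivative[OF smooth_P V(1) u, of a b] by (simp add: nabP_def)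
  have dg: "((\<lambda>q. g q a b) has_derivative (\<lambda>v. g u (christoffel g u v a) b + g u a (christoffel g u v b))) (at u)"
    for a b
    using smooth_on_has_derivative[OF smooth_g open_S in_S[OF u], of a b] metric_compat[OF in_S[OF u]] by simp
  note dX = smooth_on_has_derivative[OF smooth_X V(1) u] and dq = smooth_on_has_derivative[OF smooth_q V(1) u]
  let ?g = "\<lambda>v a b. g u (christoffel g u v a) b + g u a (christoffel g u v b)"
  let ?P = "\<lambda>v a b. nabP u v a b + P u (christoffel g u v a) b + P u a (christoffel g u v b)"
  have "((\<lambda>u. (c + 4 * X u) * (g u y z * g u x w - g u x z * g u y w)
      - 2 * X u * (P u y z * g u x w + g u y z * P u x w - P u x z * g u y w - g u x z * P u y w)
      + q u * (P u y z * P u x w - P u x z * P u y w)) has_derivative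
    (\<lambda>v. (c + 4 * X u) * ((g u y z * ?g v x w + ?g v y z * g u x w) - (g u x z * ?g v y w + ?g v x z * g u y w))
      + (0 + 4 * dderiv X u v) * (g u y z * g u x w - g u x z * g u y w)
      - (2 * X u * ((P u y z * ?g v x w + ?P v y z * g u x w) + (g u y z * ?P v x w + ?g v y z * P u x w)
          - (P u x z * ?g v y w + ?P v x z * g u y w) - (g u x z * ?P v y w + ?g v x z * P u y w))
        + 2 * dderiv X u v * (P u y z * g u x w + g u y z * P u x w - P u x z * g u y w - g u x z * P u y w))
      + (q u * ((P u y z * ?P v x w + ?P v y z * P u x w) - (P u x z * ?P v y w + ?P v x z * P u y w))
        + dderiv q u v * (P u y z * P u x w - P u x z * P u y w)))) (at u)"
    by (intro has_derivative_add has_derivative_diff has_derivative_mult has_derivative_const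
        has_derivative_mult_right dX dq dP dg)
  from has_derivative_transform_within_open[OF this V(1) u]
  have "((\<lambda>q. riem4 g q x y z w) has_derivative
    (\<lambda>v. (c + 4 * X u) * ((g u y z * ?g v x w + ?g v y z * g u x w) - (g u x z * ?g v y w + ?g v x z * g u y w))
      + (0 + 4 * dderiv X u v) * (g u y z * g u x w - g u x z * g u y w)
      - (2 * X u * ((P u y z * ?g v x w + ?P v y z * g u x w) + (g u y z * ?P v x w + ?g v y z * P u x w)
          - (P u x z * ?g v y w + ?P v x z * g u y w) - (g u x z * ?P v y w + ?g v x z * P u y w))
        + 2 * dderiv X u v * (P u y z * g u x w + g u y z * P u x w - P u x z * g u y w - g u x z * P u y w))
      + (q u * ((P u y z * ?P v x w + ?P v y z * P u x w) - (P u x z * ?P v y w + ?P v x z * P u y w))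
        + dderiv q u v * (P u y z * P u x w - P u x z * P u y w)))) (at u)"
    using riem4_formula by simp
  note d = fun_cong[OF dderiv_eq(1)[OF this]]
  show ?thesis
    unfolding nabla_riem4_def d riem4_formula[OF u] by (simp add: algebra_simps)
qed

lemma bianchi:
  "u \<in> V \<Longrightarrow> nabla_riem4 u v x y z w + nabla_riem4 u x y v z w + nabla_riem4 u y v x z w = 0"
  by (rule second_bianchi[OF in_S])

definition adapted_frame :: "'a \<Rightarrow> (nat \<Rightarrow> 'a) \<Rightarrow> bool" where
  "adapted_frame u e \<longleftrightarrow> u \<in> V \<and> inner_form.orthonormal (g u) DIM('a) e \<and>
      (\<forall>x y. P u x y = g u x (e 1) * g u y (e 1) + g u x (e 2) * g u y (e 2))"

lemma ex_adapted_frame: "u \<in> V \<Longrightarrow> \<exists>e. adapted_frame u e"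
  using P_frame by (simp add: adapted_frame_def)

context
  fixes u e assumes ad: "adapted_frame u e"
begin

lemma u: "u \<in> V" using ad by (simp add: adapted_frame_def)

interpretation u: inner_form "g u" by (rule inner_form[OF in_S[OF u]])

lemma frame: "u.frame e" using ad by (simp add: adapted_frame_def)

lemma P_eq: "P u x y = g u x (e 1) * g u y (e 1) + g u x (e 2) * g u y (e 2)"
  using ad by (simp add: adapted_frame_def)

lemma g_e: "a \<in> {1..DIM('a)} \<Longrightarrow> b \<in> {1..DIM('a)} \<Longrightarrow> g u (e a) (e b) = (if a = b then 1 else 0)"
  by (rule u.orthonormalD[OF frame])

lemma P_e:
  assumes "a \<in> {1..DIM('a)}" "b \<in> {1..DIM('a)}"
  shows "P u (e a) (e b) = (if a = b \<and> a \<le> 2 then 1 else 0)"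
proof -
  have "1 \<in> {1..DIM('a)}" "2 \<in> {1..DIM('a)}" using dim5 by auto
  then show ?thesis unfolding P_eq using assms by (auto simp: g_e)
qed

text \<open>
  \<open>g - P\<close> and \<open>P\<close> are nonnegative and vanish at \<open>u\<close> on the plane and on its complement, respectively,
  so their derivatives vanish there.
\<close>

lemma nabP_diag:
  assumes x: "(\<forall>y. P u x y = g u x y) \<or> (\<forall>y. P u x y = 0)"
  shows "nabP u v x x = 0"
proof -
  have bounds: "0 \<le> P q x x" "P q x x \<le> g q x x" if q: "q \<in> V" for q
  proof -
    obtain f where f: "inner_form.orthonormal (g q) DIM('a) f"
      "\<And>x y. P q x y = g q x (f 1) * g q y (f 1) + g q x (f 2) * g q y (f 2)"
      using P_frame[OF q] by blast
    interpret q: inner_form "g q" by (rule inner_form[OF in_S[OF q]])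
    have on: "g q (f 1) (f 1) = 1" "g q (f 2) (f 2) = 1" "g q (f 1) (f 2) = 0" "g q (f 2) (f 1) = 0"
      using q.orthonormalD[OF f(1), of 1 1] q.orthonormalD[OF f(1), of 2 2] q.orthonormalD[OF f(1), of 1 2]
        q.orthonormalD[OF f(1), of 2 1] dim5 by auto
    show "0 \<le> P q x x" by (simp add: f(2))
    have "0 \<le> g q (x - g q x (f 1) *\<^sub>R f 1 - g q x (f 2) *\<^sub>R f 2) (x - g q x (f 1) *\<^sub>R f 1 - g q x (f 2) *\<^sub>R f 2)"
      by (rule q.nonneg)
    also have "\<dots> = g q x x - P q x x"
      by (simp add: f(2) on[simplified] q.sym[of "f (Suc 0)" x] q.sym[of "f 2" x] algebra_simps)
    finally show "P q x x \<le> g q x x" by simp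
  qed
  have dP: "((\<lambda>q. P q x x) has_derivative dderiv (\<lambda>q. P q x x) u) (at u)"
    by (rule smooth_on_has_derivative[OF smooth_P V(1) u])
  have dg: "((\<lambda>q. g q x x) has_derivative dderiv (\<lambda>q. g q x x) u) (at u)"
    by (rule smooth_on_has_derivative[OF smooth_g open_S in_S[OF u]])
  from x show ?thesis
  proof
    assume *: "\<forall>y. P u x y = 0"
    have "dderiv (\<lambda>q. P q x x) u = (\<lambda>v. 0)"
      by (rule differential_zero_maxmin[OF u V(1) dP]) (use bounds * in auto)
    then show ?thesis using * P_sym[OF u, of "christoffel g u v x" x] by (simp add: nabP_def)
  next
    assume *: "\<forall>y. P u x y = g u x y"
    have "(\<lambda>v. dderiv (\<lambda>q. g q x x) u v - dderiv (\<lambda>q. P q x x) u v) = (\<lambda>v. 0)"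
      by (rule differential_zero_maxmin[OF u V(1) has_derivative_diff[OF dg dP]]) (use bounds * in auto)
    then have "dderiv (\<lambda>q. P q x x) u v = dderiv (\<lambda>q. g q x x) u v"
      by (metis eq_iff_diff_eq_0)
    then show ?thesis
      using * P_sym[OF u, of "christoffel g u v x" x] u.sym[of "christoffel g u v x" x]
      by (simp add: nabP_def metric_compat[OF in_S[OF u]])
  qed
qed

text \<open>Polarisation of \<open>nabP_diag\<close>: the derivative of an orthogonal projection
  maps the plane into its complement and conversely.\<close>

lemma nabP_same:
  assumes "a \<in> {1..DIM('a)}" "b \<in> {1..DIM('a)}" "a \<le> 2 \<longleftrightarrow> b \<le> 2"
  shows "nabP u v (e a) (e b) = 0"
proof -
  have 12: "1 \<in> {1..DIM('a)}" "2 \<in> {1..DIM('a)}" using dim5 by auto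
  have lo: "P u (e i) y = g u (e i) y" if "i \<in> {1..DIM('a)}" "i \<le> 2" for i y
  proof -
    have "i = 1 \<or> i = 2" using that by auto
    then show ?thesis
      unfolding P_eq g_e[OF that(1) 12(1)] g_e[OF that(1) 12(2)] by (auto simp: u.sym[of y])
  qed
  have hi: "P u (e i) y = 0" if "i \<in> {1..DIM('a)}" "\<not> i \<le> 2" for i y
    unfolding P_eq g_e[OF that(1) 12(1)] g_e[OF that(1) 12(2)] using that(2) by auto
  have add: "P u (x + y) z = P u x z + P u y z" for x y z by (rule bilinear_ladd[OF bilinear_P[OF u]])
  have z: "nabP u v (e a) (e a) = 0" "nabP u v (e b) (e b) = 0" "nabP u v (e a + e b) (e a + e b) = 0"
    using lo[OF assms(1)] lo[OF assms(2)] hi[OF assms(1)] hi[OF assms(2)] assms(3)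
    by (intro nabP_diag; simp add: add; fastforce)+
  have "nabP u v (e a + e b) (e a + e b) =
      nabP u v (e a) (e a) + 2 * nabP u v (e a) (e b) + nabP u v (e b) (e b)"
    using linear_add[OF linear_nabP(2)[OF u]] linear_add[OF linear_nabP(3)[OF u]] nabP_sym[OF u, of v "e b" "e a"]
    by simp
  then show ?thesis using z by simp
qed

lemmas bianchi_e = bianchi[OF u, unfolded nabla_riem4_formula[OF u]]

text \<open>Where n \<ge> 5 is decisive: the complement of the plane contains three different
  directions.\<close>

lemma other_indices:
  assumes "j \<in> {3..DIM('a)}"
  shows "\<exists>k l. k \<in> {3..DIM('a)} \<and> l \<in> {3..DIM('a)} \<and> j \<noteq> k \<and> j \<noteq> l \<and> k \<noteq> l"
proof -
  consider "j = 3" | "j = 4" | "j \<noteq> 3" "j \<noteq> 4" by blast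
  then show ?thesis
  proof cases
    case 1 then show ?thesis using dim5 by (intro exI[of _ 4] exI[of _ 5]) auto
  next
    case 2 then show ?thesis using dim5 by (intro exI[of _ 3] exI[of _ 5]) auto
  next
    case 3 then show ?thesis using dim5 by (intro exI[of _ 3] exI[of _ 4]) auto
  qed
qed

text \<open>Schur's argument on the complement, where planes have curvature
  \<open>c + 4 * X u\<close>; it takes three orthogonal complementary directions.\<close>

lemma dX_complement:
  assumes "j \<in> {3..DIM('a)}"
  shows "dderiv X u (e j) = 0"
proof -
  obtain k l where kl: "k \<in> {3..DIM('a)}" "l \<in> {3..DIM('a)}" "j \<noteq> k" "j \<noteq> l" "k \<noteq> l"
    using other_indices[OF assms] by blast
  show ?thesis
    using bianchi_e[where v = "e j" and x = "e k" and y = "e l" and z = "e l" and w = "e k"] assms kl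
    by (simp add: g_e P_e nabP_same)
qed

lemma dX_plane:
  assumes "i \<in> {1, 2}" "j \<in> {3..DIM('a)}" "k \<in> {3..DIM('a)}" "j \<noteq> k"
  shows "2 * dderiv X u (e i) + X u * (nabP u (e j) (e i) (e j) + nabP u (e k) (e i) (e k)) = 0"
proof -
  have i: "i \<in> {1..DIM('a)}" "i \<le> 2" using assms(1) dim5 by auto
  show ?thesis
    using bianchi_e[where v = "e i" and x = "e j" and y = "e k" and z = "e k" and w = "e j"] assms(2-4) i
      nabP_sym[OF u, of "e j" "e i" "e j"] nabP_sym[OF u, of "e k" "e i" "e k"]
    by (simp add: g_e P_e nabP_same algebra_simps)
qed

text \<open>\<open>dX_plane\<close> gives one equation for each pair of complementary directions.
  The three equations of a triple determine each unknown separately.\<close>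

lemma dX_plane_each:
  assumes "i \<in> {1, 2}" "j \<in> {3..DIM('a)}"
  shows "dderiv X u (e i) + X u * nabP u (e j) (e i) (e j) = 0"
proof -
  obtain k l where kl: "k \<in> {3..DIM('a)}" "l \<in> {3..DIM('a)}" "j \<noteq> k" "j \<noteq> l" "k \<noteq> l"
    using other_indices[OF assms(2)] by blast
  define D where "D = dderiv X u (e i)"
  define N where "N r = X u * nabP u (e r) (e i) (e r)" for r
  have "2 * D + (N j + N k) = 0" "2 * D + (N j + N l) = 0" "2 * D + (N k + N l) = 0"
    using dX_plane[OF assms(1)] assms(2) kl by (simp_all add: D_def N_def algebra_simps)
  then have "D + N j = 0" by argo
  then show ?thesis by (simp add: D_def N_def)
qed

text \<open>Bianchi with both plane directions and \<open>e 3\<close> yields q N = 2 (dX + X N),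
  where N is the mixed derivative of \<open>P\<close>. By \<open>dX_plane_each\<close> the
  right-hand side vanishes and dX = - X N, so q dX = - X (q N) = 0.\<close>

lemma q_dX_plane:
  assumes "i \<in> {1, 2}"
  shows "q u * dderiv X u (e i) = 0"
proof -
  define i' :: nat where "i' = 3 - i"
  have i: "i \<in> {1..DIM('a)}" "i \<le> 2" "i' \<in> {1..DIM('a)}" "i' \<le> 2" "i \<noteq> i'"
    using assms dim5 by (auto simp: i'_def)
  have j: "3 \<in> {1..DIM('a)}" "3 \<in> {3..DIM('a)}" using dim5 by auto
  have ne: "i \<noteq> 3" "i' \<noteq> 3" using i by auto
  have "(q u - 2 * X u) * nabP u (e 3) (e i) (e 3) - 2 * dderiv X u (e i) = 0"
    using bianchi_e[where v = "e 3" and x = "e i'" and y = "e i" and z = "e 3" and w = "e i'"] i j ne dX_complement[OF j(2)]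
      nabP_sym[OF u, of "e 3" "e 3" "e i"]
    by (simp add: g_e P_e nabP_same algebra_simps)
  then have 1: "q u * nabP u (e 3) (e i) (e 3) = 2 * (dderiv X u (e i) + X u * nabP u (e 3) (e i) (e 3))"
    by (simp add: algebra_simps)
  then have "q u * nabP u (e 3) (e i) (e 3) = 0" using dX_plane_each[OF assms j(2)] by simp
  moreover have "q u * dderiv X u (e i) = - (X u * (q u * nabP u (e 3) (e i) (e 3)))"
  proof -
    have "dderiv X u (e i) = - (X u * nabP u (e 3) (e i) (e 3))" using dX_plane_each[OF assms j(2)] by simp
    then show ?thesis by simp
  qed
  ultimately show ?thesis by simp
qed

lemma q_dX: "q u * dderiv X u v = 0"
proof -
  have "dderiv X u v = (\<Sum>a\<in>{1..DIM('a)}. g u v (e a) *\<^sub>R dderiv X u (e a))"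
    by (rule u.frame_linear_expand[OF frame linear_dderiv[OF smooth_X V(1) u]])
  then have "q u * dderiv X u v = (\<Sum>a\<in>{1..DIM('a)}. g u v (e a) * (q u * dderiv X u (e a)))"
    by (simp add: sum_distrib_left mult_ac)
  also have "\<dots> = 0"
  proof (intro sum.neutral ballI)
    fix a assume "a \<in> {1..DIM('a)}"
    then have "a \<in> {1, 2} \<or> a \<in> {3..DIM('a)}" by auto
    then show "g u v (e a) * (q u * dderiv X u (e a)) = 0"
      using q_dX_plane[of a] dX_complement[of a] by auto
  qed
  finally show ?thesis .
qed

text \<open>With \<open>X\<close> stationary, each mixed component times \<open>X u\<close> is
  isolated by a Bianchi identity with a spare complementary direction \<open>e k\<close>; for r = j
  the component is already given by \<open>dX_plane_each\<close>.\<close>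

lemma nabP_mixed:
  assumes dX: "\<And>v. dderiv X u v = 0" and r: "r \<in> {1..DIM('a)}" and i: "i \<in> {1, 2}" and j: "j \<in> {3..DIM('a)}"
  shows "nabP u (e r) (e i) (e j) = 0"
proof -
  obtain k where k: "k \<in> {3..DIM('a)}" "k \<noteq> j" "k \<noteq> r"
    using other_indices[OF j] by metis
  have i': "i \<in> {1..DIM('a)}" "i \<le> 2" using i dim5 by auto
  have ne: "\<not> j \<le> 2" "\<not> k \<le> 2" "i \<noteq> j" "i \<noteq> k" "j \<in> {1..DIM('a)}" "k \<in> {1..DIM('a)}"
    using i' j k by auto
  consider "r \<le> 2" | "r = j" | "r \<in> {3..DIM('a)}" "r \<noteq> j" using r by force
  then show ?thesis
  proof cases
    case 1
    have "X u * nabP u (e r) (e j) (e i) = 0"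
      using bianchi_e[where v = "e r" and x = "e j" and y = "e k" and z = "e i" and w = "e k"] r 1 k ne i'
        nabP_sym[OF u, of "e r" "e i" "e j"]
      by (simp add: g_e P_e nabP_same dX)
    then show ?thesis using X_nz[OF u] nabP_sym[OF u, of "e r" "e i" "e j"] by simp
  next
    case 2
    then show ?thesis using dX_plane_each[OF i j] X_nz[OF u] by (simp add: dX)
  next
    case 3
    have "X u * nabP u (e r) (e i) (e j) = 0"
      using bianchi_e[where v = "e i" and x = "e r" and y = "e k" and z = "e k" and w = "e j"] r 3 k ne i'
      by (simp add: g_e P_e nabP_same dX)
    then show ?thesis using X_nz[OF u] by simp
  qed
qed

lemma nabP_zero:
  assumes dX: "\<And>v. dderiv X u v = 0"
  shows "nabP u v x y = 0"
proof -
  have e: "nabP u (e r) (e a) (e b) = 0"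
    if r: "r \<in> {1..DIM('a)}" and a: "a \<in> {1..DIM('a)}" and b: "b \<in> {1..DIM('a)}" for r a b
  proof -
    consider "a \<le> 2 \<longleftrightarrow> b \<le> 2" | "a \<in> {1, 2}" "b \<in> {3..DIM('a)}" | "b \<in> {1, 2}" "a \<in> {3..DIM('a)}"
      using a b by force
    then show ?thesis
    proof cases
      case 1 then show ?thesis using nabP_same[OF a b] by blast
    next
      case 2 then show ?thesis using nabP_mixed[OF dX r] by blast
    next
      case 3 then show ?thesis using nabP_mixed[OF dX r] nabP_sym[OF u, of "e r" "e a" "e b"] by simp
    qed
  qed
  let ?I = "{1..DIM('a)}"
  note ex = u.frame_linear_expand[OF frame]
  have 1: "nabP u (e r) (e a) y = 0" if "r \<in> ?I" "a \<in> ?I" for r a y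
  proof -
    have "nabP u (e r) (e a) y = (\<Sum>b\<in>?I. g u y (e b) *\<^sub>R nabP u (e r) (e a) (e b))"
      by (rule ex[OF linear_nabP(3)[OF u]])
    then show ?thesis using e that by simp
  qed
  have 2: "nabP u (e r) x y = 0" if "r \<in> ?I" for r x y
  proof -
    have "nabP u (e r) x y = (\<Sum>b\<in>?I. g u x (e b) *\<^sub>R nabP u (e r) (e b) y)"
      by (rule ex[OF linear_nabP(2)[OF u]])
    then show ?thesis using 1 that by simp
  qed
  have "nabP u v x y = (\<Sum>b\<in>?I. g u v (e b) *\<^sub>R nabP u (e b) x y)"
    by (rule ex[OF linear_nabP(1)[OF u]])
  then show ?thesis using 2 by simp
qed

text \<open>For a parallel projection the curvature operators preserve the plane and its complement,
  so \<open>riem g u (e 1) (e 3) (e 3)\<close> has no component along \<open>e 1\<close>. The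
  curvature formula evaluates that component to \<open>c + 2 * X u\<close>.\<close>

lemma parallel_curvature:
  assumes "\<And>x y z w. P u (riem g u x y z) w + P u z (riem g u x y w) = 0"
  shows "c + 2 * X u = 0"
proof -
  have 1: "1 \<in> {1..DIM('a)}" "2 \<in> {1..DIM('a)}" "3 \<in> {1..DIM('a)}" using dim5 by auto
  have "P u (e 3) y = 0" for y unfolding P_eq g_e[OF 1(3,1)] g_e[OF 1(3,2)] by simp
  moreover have "P u y (e 1) = g u y (e 1)" for y unfolding P_eq g_e[OF 1(1,1)] g_e[OF 1(1,2)] by simp
  ultimately have "riem4 g u (e 1) (e 3) (e 3) (e 1) = 0"
    using assms[of "e 1" "e 3" "e 3" "e 1"] by (simp add: riem4_def)
  then show ?thesis
    unfolding riem4_formula[OF u] g_e[OF 1(1,1)] g_e[OF 1(3,3)] g_e[OF 1(1,3)] g_e[OF 1(3,1)]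
      P_e[OF 1(1,1)] P_e[OF 1(3,3)] P_e[OF 1(1,3)] P_e[OF 1(3,1)]
    by simp
qed

end

text \<open>
  Where \<open>X\<close> is not stationary \<open>q\<close> vanishes, and then the algebraic relation makes \<open>X\<close> constant. Hence \<open>P\<close> is
  parallel, so the planes spanned by a vector in the plane field and one orthogonal to it are flat.
\<close>

lemma flat_mixed_planes:
  assumes rel: "\<And>u. u \<in> V \<Longrightarrow>
      (c + q u)\<^sup>2 = (4 - real DIM('a)) * (c + 2 * X u)\<^sup>2 + (real DIM('a) - 3) * (c + 4 * X u)\<^sup>2"
    and u: "u \<in> V"
  shows "c + 2 * X u = 0"
proof -
  have dX: "dderiv X u v = 0" if u: "u \<in> V" for u v
  proof (rule ccontr)
    assume nz: "dderiv X u v \<noteq> 0"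
    let ?U = "{u \<in> V. dderiv X u v \<noteq> 0}"
    have "open (V \<inter> (\<lambda>u. dderiv X u v) -` (- {0}))"
      by (rule continuous_open_preimage[OF smooth_on_continuous_on[OF smooth_on_dderiv[OF smooth_X V(1)]] V(1)])
        (simp add: open_Compl)
    moreover have "V \<inter> (\<lambda>u. dderiv X u v) -` (- {0}) = ?U" by auto
    ultimately have U: "open ?U" by simp
    \<comment> \<open>With q = 0 the relation reduces to X (c (4n - 8) + X (12n - 32)) = 0. A
      function that is constant on the open set where it is not stationary contradicts
      itself.\<close>
    have const: "X p = - c * (4 * real DIM('a) - 8) / (12 * real DIM('a) - 32)" if p: "p \<in> ?U" for p
    proof -
      obtain e where "adapted_frame p e" using ex_adapted_frame p by blast
      then have "q p = 0" using q_dX[of p e v] p by simp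
      then have "X p * (c * (4 * real DIM('a) - 8) + X p * (12 * real DIM('a) - 32)) = 0"
        using rel[of p] p by (simp add: power2_eq_square algebra_simps)
      then have "c * (4 * real DIM('a) - 8) + X p * (12 * real DIM('a) - 32) = 0" using X_nz[of p] p by simp
      moreover have "12 * real DIM('a) - 32 \<noteq> 0" using dim5 by simp
      ultimately show ?thesis by (simp add: field_simps)
    qed
    have "((\<lambda>_. - c * (4 * real DIM('a) - 8) / (12 * real DIM('a) - 32)) has_derivative (\<lambda>v. 0)) (at u)"
      by simp
    then have "(X has_derivative (\<lambda>v. 0)) (at u)"
      by (rule has_derivative_transform_within_open[OF _ U]) (use u nz const in auto)
    then show False using nz dderiv_eq(1) by fastforce
  qed
  have par: "dderiv (\<lambda>q. P q y z) u x = P u (christoffel g u x y) z + P u y (christoffel g u x z)"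
    if u: "u \<in> V" for u x y z
  proof -
    obtain e where "adapted_frame u e" using ex_adapted_frame u by blast
    from nabP_zero[OF this dX[OF u], of x y z] show ?thesis by (simp add: nabP_def)
  qed
  obtain e where e: "adapted_frame u e" using ex_adapted_frame u by blast
  have "P u (riem g u x y z) w + P u z (riem g u x y w) = 0" for x y z w
    by (rule parallel_form[of V P, OF V bilinear_P smooth_P par u])
  then show ?thesis by (rule parallel_curvature[OF e])
qed

end

section \<open>Submanifolds of space forms in charts\<close>

lemma not_spans_plane_cases:
  assumes "\<not> spans_plane x y"
  shows "x = y \<or> x = 0 \<or> (\<exists>k. y = k *\<^sub>R x)"
proof -
  have "independent (insert y {x}) \<longleftrightarrow> independent {x} \<and> y \<notin> span {x}" if "x \<noteq> y"
    using independent_insert[of y "{x}"] that by auto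
  with assms have "x = y \<or> x = 0 \<or> y \<in> span {x}"
    by (auto simp: spans_plane_def insert_commute)
  then show ?thesis by (auto simp: span_singleton)
qed

lemma (in inner_form) spans_plane_gram:
  assumes "spans_plane x y"
  shows "G x x * G y y - (G x y)\<^sup>2 > 0"
proof -
  have "y \<notin> span {x}" "x \<noteq> 0"
    using assms independent_insert[of y "{x}"] unfolding spans_plane_def
    by (auto simp: insert_commute)
  define r where "r = y - (G x y / G x x) *\<^sub>R x"
  have "r \<noteq> 0"
  proof
    assume "r = 0"
    then have "y = (G x y / G x x) *\<^sub>R x" by (simp add: r_def)
    then show False using \<open>y \<notin> span {x}\<close> by (auto simp: span_singleton)
  qed
  have xx: "G x x > 0" by (rule pos[OF \<open>x \<noteq> 0\<close>])
  have "G x x * G r r = G x x * G y y - (G x y)\<^sup>2"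
    using xx by (simp add: r_def sym[of y x] power2_eq_square field_simps)
  then show ?thesis using mult_pos_pos[OF xx pos[OF \<open>r \<noteq> 0\<close>]] by simp
qed

context metric_chart
begin

text \<open>The difference \<open>T\<close> from the model tensor has all curvature symmetries and
  vanishes on every pair (x, y), independent or not. Polarisation makes it totally skew, and the
  first Bianchi identity then says that three times \<open>T\<close> is zero.\<close>

lemma riem4_constant_curvature:
  assumes u: "u \<in> S" and K: "\<And>x y. spans_plane x y \<Longrightarrow> sec_curv g u x y = c"
  shows "riem4 g u x y z w = c * (g u y z * g u x w - g u x z * g u y w)"
proof -
  interpret u: inner_form "g u" by (rule inner_form[OF u])
  define T where "T x y z w = riem4 g u x y z w - c * (g u y z * g u x w - g u x z * g u y w)" for x y z w
  note lin = linear_riem4[OF u, THEN linear_add] linear_riem4[OF u, THEN linear_scale]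
  have s12: "T x y z w = - T y x z w" for x y z w
    using riem4_swap12[OF u, of x y z w] by (simp add: T_def algebra_simps)
  have s34: "T x y z w = - T x y w z" for x y z w
    using riem4_swap34[OF u, of x y z w] by (simp add: T_def algebra_simps)
  have ps: "T x y z w = T z w x y" for x y z w
    using riem4_pair_sym[OF u, of x y z w] u.sym[of y z] u.sym[of x w] u.sym[of x z] u.sym[of y w]
    by (simp add: T_def mult.commute)
  have b1: "T x y z w + T y z x w + T z x y w = 0" for x y z w
    using riem4_bianchi1[OF u, of x y z w] u.sym[of y x] u.sym[of z x] u.sym[of z y]
    by (simp add: T_def algebra_simps)
  have add: "T (x + x') y z w = T x y z w + T x' y z w" "T x (y + y') z w = T x y z w + T x y' z w"
    "T x y (z + z') w = T x y z w + T x y z' w" "T x y z (w + w') = T x y z w + T x y z w'" for x x' y y' z z' w w'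
    by (simp_all add: T_def lin algebra_simps)
  have scale: "T (r *\<^sub>R x) y z w = r * T x y z w" "T x (r *\<^sub>R y) z w = r * T x y z w" for x y z w r
    by (simp_all add: T_def lin algebra_simps)
  have xx: "T x x z w = 0" for x z w using s12[of x x z w] by simp
  have sec: "T x y y x = 0" for x y
  proof (cases "spans_plane x y")
    case True
    from K[OF this] u.spans_plane_gram[OF this] show ?thesis
      by (simp add: sec_curv_def T_def field_simps power2_eq_square u.sym[of y x])
  next
    case False
    then consider "x = y" | "x = 0" | k where "y = k *\<^sub>R x" using not_spans_plane_cases by blast
    then show ?thesis
    proof cases
      case 2
      then show ?thesis using scale(1)[of 0 0 y y x] by simp
    next
      case 3
      then show ?thesis using scale(2)[of x k x y x] xx by simp
    qed (simp add: xx)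
  qed
  \<comment> \<open>Polarises in the inner argument; \<open>s14\<close> then polarises in the outer
    one.\<close>
  have pol: "T x y z x = 0" for x y z
    using sec[of x "y + z"] sec[of x y] sec[of x z] ps[of x z y x] s12[of y x x z] s34[of x y x z]
    by (simp add: add)
  have s14: "T x y z w = - T w y z x" for x y z w
    using pol[of "x + w" y z] pol[of x y z] pol[of w y z] by (simp add: add)
  have s23: "T x y z w = - T x z y w" for x y z w
    using s14[of x y z w] ps[of w y z x] s12[of z x w y] s34[of x z w y] by simp
  \<comment> \<open>Cyclic shifts of the first three arguments are even permutations, so the three
    summands of the Bianchi identity agree.\<close>
  have "T x y z w = T y z x w" "T x y z w = T z x y w"
    using s12[of x y z w] s23[of y x z w] s23[of x y z w] s12[of x z y w] by simp_all
  then have "T x y z w = 0" using b1[of x y z w] by argo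
  then show ?thesis by (simp add: T_def)
qed

lemma ricci_frame:
  assumes u: "u \<in> S" and e: "inner_form.orthonormal (g u) DIM('a) e"
  shows "ricci g u x y = (\<Sum>j\<in>{1..DIM('a)}. riem4 g u (e j) x y (e j))"
  unfolding ricci_def riem4_def
  by (rule inner_form.lin_trace_frame[OF inner_form[OF u] e linear_riem(1)[OF u]])

lemma bilinear_ricci:
  assumes u: "u \<in> S"
  shows "bilinear (ricci g u)"
  unfolding bilinear_def ricci_frame[OF u frame_some_frame[where g = g and u = u, OF inner_form[OF u]]]
  using linear_riem4(2,3)[OF u] by (auto intro!: linear_compose_sum)

lemma scalar_curv_frame:
  assumes u: "u \<in> S" and e: "inner_form.orthonormal (g u) DIM('a) e"
  shows "scalar_curv g u = (\<Sum>i\<in>{1..DIM('a)}. \<Sum>j\<in>{1..DIM('a)}. riem4 g u (e j) (e i) (e i) (e j))"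
  unfolding scalar_curv_def
    metric_trace_frame[where g = g and u = u, OF inner_form[OF u] e bilinear_ricci[OF u]]
    ricci_frame[OF u e] ..

text \<open>Replaces the frame chosen by \<open>SOME\<close> with data that vary smoothly.\<close>

lemma metric_trace_sharp:
  assumes u: "u \<in> S" and B: "bilinear B"
  shows "metric_trace g u B = (\<Sum>b\<in>Basis. B b (sharp u b))"
proof -
  interpret u: inner_form "g u" by (rule inner_form[OF u])
  obtain e where e: "u.frame e" using u.ex_frame by blast
  show ?thesis
    unfolding metric_trace_frame[where g = g and u = u, OF inner_form[OF u] e B]
    by (rule u.trace_dual_basis[OF e _ _ g_sharp[OF u]]) (use B in \<open>auto simp: bilinear_def\<close>)
qed

lemma smooth_ricci: "smooth_on S (\<lambda>u. ricci g u x y)"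
  unfolding ricci_def lin_trace_def
  by (intro smooth_on_sum smooth_on_inner smooth_on_const open_S smooth_riem)

lemma smooth_scalar_curv: "smooth_on S (scalar_curv g)"
proof -
  have "smooth_on S (\<lambda>u. ricci g u b (sharp u b))" for b
    by (rule smooth_form_fields[OF open_S bilinear_ricci smooth_ricci smooth_on_const[OF open_S] smooth_sharp])
  then have "smooth_on S (\<lambda>u. \<Sum>b\<in>Basis. ricci g u b (sharp u b))"
    by (intro smooth_on_sum open_S)
  then show ?thesis
    by (rule smooth_on_congI[OF open_S]) (simp add: scalar_curv_def metric_trace_sharp bilinear_ricci)
qed

end

locale space_form_chart = immersion_chart S g T gb F
  for S :: "'a::euclidean_space set" and g :: "'a coord_metric"
    and T :: "'b::euclidean_space set" and gb :: "'b coord_metric" and F +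
  fixes c :: real
  assumes const_curv: "q \<in> T \<Longrightarrow> spans_plane x y \<Longrightarrow> sec_curv gb q x y = c"
    and dim3: "DIM('a) \<ge> 3" and codim: "DIM('b) > DIM('a)"
begin

lemma gauss_point:
  assumes u: "u \<in> S"
  shows "gauss_point (g u) (gb (F u)) (h u) (dderiv F u) c (riem4 g u)"
proof -
  have "riem4 g u x y z w = c * (g u y z * g u x w - g u x z * g u y w)
      + gb (F u) (h u y z) (h u x w) - gb (F u) (h u x z) (h u y w)" for x y z w
    unfolding gauss_equation[OF u] induced[OF u]
    by (subst N.riem4_constant_curvature[OF F_in[OF u] const_curv[OF F_in[OF u]]]) simp_all
  then show ?thesis
    by (intro gauss_point.intro gauss_point_axioms.intro M.inner_form[OF u] N.inner_form[OF F_in[OF u]]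
        bilinear_h[OF u] h_sym[OF u] linear_dF[OF u] induced[OF u, symmetric] h_normal[OF u] dim3)
qed

lemma inf_sec_curv_eq: "u \<in> S \<Longrightarrow>
    inf_sec_curv g u = Inf {gauss_point.sec (g u) (riem4 g u) x y | x y. spans_plane x y}"
  using gauss_point.sec_def[OF gauss_point] by (simp add: inf_sec_curv_def sec_curv_def)

lemma scalar_curv_eq:
  assumes u: "u \<in> S" and e: "inner_form.orthonormal (g u) DIM('a) e"
  shows "scalar_curv g u = gauss_point.tau (riem4 g u) e"
  using M.scalar_curv_frame[OF assms] gauss_point.tau_def[OF gauss_point[OF u]] by simp

lemma mean_curv_eq:
  assumes u: "u \<in> S" and e: "inner_form.orthonormal (g u) DIM('a) e"
  shows "mean_curv g gb F u = (1 / real DIM('a)) *\<^sub>R gauss_point.trace_h (h u) e"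
  unfolding mean_curv_def
    metric_trace_frame[where g = g and u = u, OF M.inner_form[OF u] e bilinear_h[OF u]]
    gauss_point.trace_h_def[OF gauss_point[OF u]] ..

lemma smooth_mean_curv: "smooth_on S (mean_curv g gb F)"
proof -
  have "smooth_on S (\<lambda>u. h u b (M.sharp u b))" for b
    by (rule smooth_form_fields[OF M.open_S bilinear_h smooth_h smooth_on_const[OF M.open_S] M.smooth_sharp])
  then have "smooth_on S (\<lambda>u. (1 / real DIM('a)) *\<^sub>R (\<Sum>b\<in>Basis. h u b (M.sharp u b)))"
    by (intro smooth_on_scaleR smooth_on_const smooth_on_sum M.open_S)
  then show ?thesis
    by (rule smooth_on_congI[OF M.open_S]) (simp add: mean_curv_def M.metric_trace_sharp bilinear_h)
qed

lemma riem_check_eq: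
  assumes u: "u \<in> S" and e: "inner_form.orthonormal (g u) DIM('a) e"
  shows "riem_check g u x y = gauss_point.check (riem4 g u) e x y"
  using gauss_point.check_frame[OF gauss_point[OF u] frame_some_frame[where g = g and u = u, OF M.inner_form[OF u]] e]
  by (simp add: riem_check_def Let_def gauss_point.check_def[OF gauss_point[OF u]])

lemma shape_op_eq: "u \<in> S \<Longrightarrow> shape_op g gb F u = gauss_point.shape (g u) (gb (F u)) (h u)"
  by (intro ext) (simp add: shape_op_def gauss_point.shape_def[OF gauss_point])

lemma normal_form_eq:
  assumes u: "u \<in> S"
  shows "normal_form g gb F u a b \<longleftrightarrow> gauss_point.normal_form_at (g u) (gb (F u)) (h u) (dderiv F u) a b"
  unfolding normal_form_def normal_frame_def Let_def shape_op_eq[OF u]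
    orthonormal_frame_iff[where g = g and u = u, OF M.inner_form[OF u]]
    gauss_point.normal_form_at_def[OF gauss_point[OF u]] gauss_point.normal_form_with_def[OF gauss_point[OF u]]
  by (simp only: conj_assoc)

definition chen_at :: "'a \<Rightarrow> bool" where
  "chen_at u \<longleftrightarrow> scalar_curv g u / 2 - inf_sec_curv g u =
     (real DIM('a))\<^sup>2 * (real DIM('a) - 2) / (2 * (real DIM('a) - 1))
       * gb (F u) (mean_curv g gb F u) (mean_curv g gb F u)
     + (real DIM('a) + 1) * (real DIM('a) - 2) * c / 2"

text \<open>The frame is started with a plane of minimal sectional curvature, which turns Chen's
  equality at the point into the hypothesis of \<open>chen_equality_ideal\<close>.\<close>

lemma ex_normal_form:
  assumes u: "u \<in> S" and chen: "chen_at u"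
  shows "\<exists>a b. normal_form g gb F u a b"
proof -
  interpret p: gauss_point "g u" "gb (F u)" "h u" "dderiv F u" c "riem4 g u" by (rule gauss_point[OF u])
  obtain x y where xy: "p.orthonormal_pair x y"
    "Inf {p.sec x y | x y. spans_plane x y} = riem4 g u x y y x"
    using p.inf_sec_attained by blast
  obtain e where e: "p.frame e" "e 1 = x" "e 2 = y" using p.orthonormal_pair_frame[OF xy(1)] by blast
  have n: "real DIM('a) > 0" by simp
  have "p.tau e / 2 - riem4 g u (e 1) (e 2) (e 2) (e 1) =
      (real DIM('a) - 2) / (2 * (real DIM('a) - 1)) * gb (F u) (p.trace_h e) (p.trace_h e)
      + (real DIM('a) + 1) * (real DIM('a) - 2) * c / 2"
  proof -
    have "gb (F u) (mean_curv g gb F u) (mean_curv g gb F u)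
        = gb (F u) (p.trace_h e) (p.trace_h e) / (real DIM('a))\<^sup>2"
      unfolding mean_curv_eq[OF u e(1)] by (simp add: power2_eq_square)
    then have H: "(real DIM('a))\<^sup>2 * (real DIM('a) - 2) / (2 * (real DIM('a) - 1))
        * gb (F u) (mean_curv g gb F u) (mean_curv g gb F u) =
        (real DIM('a) - 2) / (2 * (real DIM('a) - 1)) * gb (F u) (p.trace_h e) (p.trace_h e)"
      using n by simp
    show ?thesis
      using chen[unfolded chen_at_def H inf_sec_curv_eq[OF u] scalar_curv_eq[OF u e(1)] xy(2)]
      unfolding e(2,3) .
  qed
  from p.chen_equality_ideal[OF e(1) this] obtain \<eta> where "p.ideal e \<eta>" by blast
  from p.ideal_normal_form[OF this codim] show ?thesis unfolding normal_form_eq[OF u] .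
qed

text \<open>With \<open>a\<close>, \<open>b\<close> as in the normal form this is \<open>(a + b)\<^sup>2\<close>.\<close>

definition mu_sq :: "'a \<Rightarrow> real" where
  "mu_sq u = (real DIM('a) / (real DIM('a) - 1))\<^sup>2 * gb (F u) (mean_curv g gb F u) (mean_curv g gb F u)"

lemma smooth_mu_sq: "smooth_on S mu_sq"
  unfolding mu_sq_def[abs_def]
  by (intro smooth_on_mult smooth_on_const M.open_S
      smooth_form_fields[of S "\<lambda>q. gb (F q)", OF M.open_S bilinear_gb compose_F(1)[OF N.smooth_g]
        smooth_mean_curv smooth_mean_curv])

definition weakly_einstein_chart :: "'a \<Rightarrow> bool" where
  "weakly_einstein_chart u \<longleftrightarrow>
    (\<forall>x y. riem_check g u x y = riem_norm_sq g u / real DIM('a) * g u x y)"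

text \<open>Gathers what a normal form yields at one weakly Einstein point, with the number s of the
  overview written out. The equation for the mean curvature vector ties the pointwise data to a
  smooth field.\<close>

lemma normal_form_point:
  assumes u: "u \<in> S" and nf: "normal_form g gb F u a b" and we: "weakly_einstein_chart u"
  shows "\<exists>e \<xi> \<gamma> \<delta>. gauss_point.adapted (g u) (gb (F u)) (h u) e \<xi> \<gamma> \<delta> a b \<and>
      (real DIM('a) / (real DIM('a) - 1)) *\<^sub>R mean_curv g gb F u = (a + b) *\<^sub>R \<xi> \<and>
      mu_sq u = (a + b)\<^sup>2 \<and>
      (DIM('b) = DIM('a) + 1 \<longrightarrow> gb (F u) \<gamma> \<gamma> + gb (F u) \<delta> \<delta> = 0) \<and>
      gb (F u) \<gamma> \<gamma> + gb (F u) \<delta> \<delta> \<ge> 0 \<and>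
      (c + a * (a + b))\<^sup>2 = (c + b * (a + b))\<^sup>2 \<and>
      (c + a * b - (gb (F u) \<gamma> \<gamma> + gb (F u) \<delta> \<delta>))\<^sup>2 + (real DIM('a) - 2) * (c + a * (a + b))\<^sup>2 =
        (c + a * (a + b))\<^sup>2 + (c + b * (a + b))\<^sup>2 + (real DIM('a) - 3) * (c + (a + b)\<^sup>2)\<^sup>2"
proof -
  interpret p: gauss_point "g u" "gb (F u)" "h u" "dderiv F u" c "riem4 g u" by (rule gauss_point[OF u])
  obtain e \<xi> \<gamma> \<delta> where ad: "p.adapted e \<xi> \<gamma> \<delta> a b" and z: "DIM('b) = DIM('a) + 1 \<longrightarrow> \<gamma> = 0 \<and> \<delta> = 0"
    using p.normal_form_adapted[OF nf[unfolded normal_form_eq[OF u]] codim] by blast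
  note e = p.adapted_frame[OF ad]
  have H: "(real DIM('a) / (real DIM('a) - 1)) *\<^sub>R mean_curv g gb F u = (a + b) *\<^sub>R \<xi>"
    unfolding mean_curv_eq[OF u e] p.adapted_trace_h[OF ad] using dim3 by simp
  have "mu_sq u = gb (F u) ((real DIM('a) / (real DIM('a) - 1)) *\<^sub>R mean_curv g gb F u)
      ((real DIM('a) / (real DIM('a) - 1)) *\<^sub>R mean_curv g gb F u)"
    by (simp add: mu_sq_def power2_eq_square)
  also have "\<dots> = (a + b)\<^sup>2" unfolding H using ad by (simp add: p.adapted_def power2_eq_square)
  finally have mu: "mu_sq u = (a + b)\<^sup>2" .
  have W: "p.check e x y = riem_norm_sq g u / real DIM('a) * g u x y" for x y
    using we unfolding weakly_einstein_chart_def riem_check_eq[OF u e] by blast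
  note rel = p.weakly_einstein_at[OF ad W refl refl refl refl]
  have "gb (F u) \<gamma> \<gamma> + gb (F u) \<delta> \<delta> \<ge> 0" using p.B.nonneg[of \<gamma>] p.B.nonneg[of \<delta>] by simp
  then show ?thesis using ad H mu z rel by (intro exI[of _ e] exI[of _ \<xi>] exI[of _ \<gamma>] exI[of _ \<delta>]) simp
qed

end

text \<open>When a + b = 0, only the plane of \<open>e 1\<close> and \<open>e 2\<close> deviates
  from curvature \<open>c\<close>; it is counted twice in the scalar curvature.\<close>

lemma (in gauss_point) adapted_minimal_tau:
  assumes ad: "adapted e \<xi> \<gamma> \<delta> a b" and ab: "a + b = 0"
  shows "tau e = real DIM('a) * (real DIM('a) - 1) * c + 2 * (a * b - (Gb \<gamma> \<gamma> + Gb \<delta> \<delta>))"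
proof -
  let ?I = "{1..DIM('a)}" and ?J = "{3..DIM('a)}" and ?s = "Gb \<gamma> \<gamma> + Gb \<delta> \<delta>"
  note f = adapted_frame[OF ad]
  define k where "k i j = (if i \<noteq> j \<and> i \<le> 2 \<and> j \<le> 2 then a * b - ?s else 0)" for i j :: nat
  have "R (e j) (e i) (e i) (e j) = c * (if i = j then 0 else 1) + k j i" if "i \<in> ?I" "j \<in> ?I" for i j
    unfolding adapted_curvature[OF ad that(2,1)]
    using orthonormalD[OF f that(1,1)] orthonormalD[OF f that(2,2)] orthonormalD[OF f that] ab
    by (auto simp: curv_entry_def k_def)
  then have "tau e = (\<Sum>i\<in>?I. \<Sum>j\<in>?I. c * (if i = j then 0 else 1) + k j i)"
    unfolding tau_def by (intro sum.cong refl) blast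
  also have "\<dots> = (\<Sum>i\<in>?I. \<Sum>j\<in>?I. c * (if i = j then 0 else 1)) + (\<Sum>i\<in>?I. \<Sum>j\<in>?I. k j i)"
    by (simp add: sum.distrib)
  also have "(\<Sum>i\<in>?I. \<Sum>j\<in>?I. c * (if i = j then 0 else 1)) = real DIM('a) * (real DIM('a) - 1) * c"
  proof -
    have "(\<Sum>j\<in>?I. c * (if i = j then 0 else 1)) = c * (real DIM('a) - 1)" if "i \<in> ?I" for i
    proof -
      have "(\<Sum>j\<in>?I. c * (if i = j then 0 else 1)) = (\<Sum>j\<in>?I. c - (if i = j then c else 0))"
        by (intro sum.cong refl) simp
      then show ?thesis using that by (simp add: sum_subtractf algebra_simps)
    qed
    then have "(\<Sum>i\<in>?I. \<Sum>j\<in>?I. c * (if i = j then 0 else 1)) = (\<Sum>i\<in>?I. c * (real DIM('a) - 1))"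
      by (intro sum.cong refl)
    then show ?thesis by simp
  qed
  also have "(\<Sum>i\<in>?I. \<Sum>j\<in>?I. k j i) = 2 * (a * b - ?s)"
  proof -
    have 3: "(\<Sum>j\<in>?J. k j i) = 0" for i by (intro sum.neutral ballI) (auto simp: k_def)
    have 4: "(\<Sum>i\<in>?J. k 1 i + (k 2 i + 0)) = 0" by (intro sum.neutral ballI) (auto simp: k_def)
    show ?thesis unfolding sum_split12 3 4 by (simp add: k_def)
  qed
  finally show ?thesis .
qed

lemma umbilic_principal_curvature:
  fixes a c n :: real
  assumes "(c + a * a)\<^sup>2 + (n - 2) * (c + a * (a + a))\<^sup>2 =
      (c + a * (a + a))\<^sup>2 + (c + a * (a + a))\<^sup>2 + (n - 3) * (c + (a + a)\<^sup>2)\<^sup>2"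
    and "a \<noteq> 0" "n \<ge> 3"
  shows "a\<^sup>2 = - (c * (4 * n - 10) / (12 * n - 33))"
proof -
  \<comment> \<open>The terms in c^2 cancel; the coefficient of c a^2 is 2 + 4(n - 4) - 8(n - 3),
    that of a^4 is 1 + 4(n - 4) - 16(n - 3), both up to a common sign.\<close>
  have "a\<^sup>2 * (c * (4 * n - 10) + a\<^sup>2 * (12 * n - 33)) = 0"
    using assms(1) by (simp add: power2_eq_square algebra_simps)
  then have "c * (4 * n - 10) + a\<^sup>2 * (12 * n - 33) = 0" using assms(2) by simp
  moreover have "12 * n - 33 > 0" using assms(3) by simp
  ultimately show ?thesis by (simp add: field_simps)
qed

section \<open>The kinds of points permitted by the weakly Einstein condition\<close>

context space_form_chart
begin

lemma normal_form_cases: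
  assumes u: "u \<in> S" and nf: "normal_form g gb F u a b" and we: "weakly_einstein_chart u"
  shows "mu_sq u = (a + b)\<^sup>2" "mu_sq u = 0 \<or> mu_sq u = - 2 * c \<or> a = b"
proof -
  show mu: "mu_sq u = (a + b)\<^sup>2" using normal_form_point[OF assms] by blast
  have "(c + a * (a + b))\<^sup>2 = (c + b * (a + b))\<^sup>2" using normal_form_point[OF assms] by blast
  \<comment> \<open>The difference of the squares factors: the curvatures differ by (a - b)(a + b)
    and have sum 2c + (a + b)^2.\<close>
  then have "(a + b) * ((a - b) * (2 * c + (a + b)\<^sup>2)) = 0" by (simp add: power2_eq_square algebra_simps)
  then show "mu_sq u = 0 \<or> mu_sq u = - 2 * c \<or> a = b" unfolding mu by auto
qed

lemma minimal_point:
  assumes u: "u \<in> S" and nf: "normal_form g gb F u a b" and we: "weakly_einstein_chart u"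
    and mu: "mu_sq u = 0"
  shows "\<exists>s\<ge>0. a + b = 0 \<and> (DIM('b) = DIM('a) + 1 \<longrightarrow> s = 0) \<and> mean_curv g gb F u = 0 \<and>
    (a * b - s = 0 \<or> a * b - s = - 2 * c) \<and>
    scalar_curv g u = real DIM('a) * (real DIM('a) - 1) * c + 2 * (a * b - s) \<and>
    (a * b - s = 0 \<longrightarrow> (\<forall>x y. spans_plane x y \<longrightarrow> sec_curv g u x y = c)) \<and>
    (c > 0 \<longrightarrow> (\<forall>x. ricci g u x x \<ge> 0))"
proof -
  interpret p: gauss_point "g u" "gb (F u)" "h u" "dderiv F u" c "riem4 g u" by (rule gauss_point[OF u])
  obtain e \<xi> \<gamma> \<delta> where ad: "p.adapted e \<xi> \<gamma> \<delta> a b"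
    and H: "(real DIM('a) / (real DIM('a) - 1)) *\<^sub>R mean_curv g gb F u = (a + b) *\<^sub>R \<xi>"
    and mu': "mu_sq u = (a + b)\<^sup>2"
    and s: "DIM('b) = DIM('a) + 1 \<longrightarrow> gb (F u) \<gamma> \<gamma> + gb (F u) \<delta> \<delta> = 0" "gb (F u) \<gamma> \<gamma> + gb (F u) \<delta> \<delta> \<ge> 0"
    and rel: "(c + a * b - (gb (F u) \<gamma> \<gamma> + gb (F u) \<delta> \<delta>))\<^sup>2 + (real DIM('a) - 2) * (c + a * (a + b))\<^sup>2 =
        (c + a * (a + b))\<^sup>2 + (c + b * (a + b))\<^sup>2 + (real DIM('a) - 3) * (c + (a + b)\<^sup>2)\<^sup>2"
    using normal_form_point[OF u nf we] by blast
  define t where "t = gb (F u) \<gamma> \<gamma> + gb (F u) \<delta> \<delta>"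
  have ab: "a + b = 0" using mu mu' by simp
  note e = p.adapted_frame[OF ad]
  have mean: "mean_curv g gb F u = 0" using H dim3 unfolding ab by simp
  \<comment> \<open>For a + b = 0 all curvatures in the relation except that of the plane of
    \<open>e 1\<close> and \<open>e 2\<close> equal \<open>c\<close>.\<close>
  have "(c + a * b - t)\<^sup>2 = c\<^sup>2"
    using rel unfolding ab t_def[symmetric] by (simp add: algebra_simps)
  then have alt: "a * b - t = 0 \<or> a * b - t = - 2 * c"
    unfolding power2_eq_iff by (auto simp: algebra_simps)
  have tau: "scalar_curv g u = real DIM('a) * (real DIM('a) - 1) * c + 2 * (a * b - t)"
    unfolding scalar_curv_eq[OF u e] t_def by (rule p.adapted_minimal_tau[OF ad ab])
  have sec: "sec_curv g u x y = c" if "a * b - t = 0" "spans_plane x y" for x y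
  proof -
    have "a * b = gb (F u) \<gamma> \<gamma> + gb (F u) \<delta> \<delta>" using that(1) by (simp add: t_def)
    note R = p.adapted_totally_geodesic[OF ad ab this, of x y y x]
    have "g u x x * g u y y - (g u x y)\<^sup>2 > 0" by (rule p.spans_plane_gram[OF that(2)])
    then show ?thesis unfolding sec_curv_def R by (simp add: power2_eq_square p.sym[of y x] mult.commute)
  qed
  have ric: "ricci g u x x \<ge> 0" if "c > 0" for x
  proof -
    have "c + a * b - (gb (F u) \<gamma> \<gamma> + gb (F u) \<delta> \<delta>) \<ge> - c" using alt that unfolding t_def[symmetric] by auto
    then show ?thesis
      unfolding M.ricci_frame[OF u e] by (rule p.adapted_minimal_ricci_nonneg[OF ad ab that])
  qed
  show ?thesis using ab mean alt tau sec ric s unfolding t_def[symmetric] by (intro exI[of _ t]) blast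
qed

lemma hypersurface_umbilic_point:
  assumes u: "u \<in> S" and nf: "normal_form g gb F u a b" and we: "weakly_einstein_chart u"
    and hyp: "DIM('b) = DIM('a) + 1" and mu: "mu_sq u \<noteq> 0" "mu_sq u \<noteq> - 2 * c"
  shows "a = b \<and> a\<^sup>2 = - (c * (4 * real DIM('a) - 10) / (12 * real DIM('a) - 33)) \<and> mu_sq u = 4 * a\<^sup>2"
proof -
  obtain e \<xi> \<gamma> \<delta> where 0: "gb (F u) \<gamma> \<gamma> + gb (F u) \<delta> \<delta> = 0"
    and rel: "(c + a * b - (gb (F u) \<gamma> \<gamma> + gb (F u) \<delta> \<delta>))\<^sup>2 + (real DIM('a) - 2) * (c + a * (a + b))\<^sup>2 =
        (c + a * (a + b))\<^sup>2 + (c + b * (a + b))\<^sup>2 + (real DIM('a) - 3) * (c + (a + b)\<^sup>2)\<^sup>2"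
    using normal_form_point[OF u nf we] hyp by blast
  have ab: "a = b" and m: "mu_sq u = (a + b)\<^sup>2" using normal_form_cases[OF u nf we] mu by auto
  then have "a \<noteq> 0" using mu by auto
  have "a\<^sup>2 = - (c * (4 * real DIM('a) - 10) / (12 * real DIM('a) - 33))"
    by (rule umbilic_principal_curvature) (use rel 0 ab \<open>a \<noteq> 0\<close> dim3 in simp_all)
  then show ?thesis using ab m by (simp add: power2_eq_square)
qed

text \<open>Assembles a \<open>plane_structure\<close> near a supposed exceptional point. The
  difficulty is regularity: \<open>P\<close> and \<open>q\<close> have to be smooth although the
  frames that describe them are only chosen pointwise.\<close>

lemma umbilic_excluded:
  assumes dim5: "DIM('a) \<ge> 5" and U: "open U" "U \<subseteq> S"
    and pt: "\<And>u. u \<in> U \<Longrightarrow> weakly_einstein_chart u \<and> chen_at u"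
    and u0: "u0 \<in> U"
  shows "mu_sq u0 = 0 \<or> mu_sq u0 = - 2 * c"
proof (rule ccontr)
  assume neg: "\<not> ?thesis"
  define U' where "U' = U \<inter> mu_sq -` (- {0, - 2 * c})"
  have "open U'"
    unfolding U'_def
    by (rule continuous_open_preimage[OF continuous_on_subset[OF smooth_on_continuous_on[OF smooth_mu_sq] U(2)] U(1)])
      (intro open_Compl finite_imp_closed, simp)
  have u0': "u0 \<in> U'" using neg u0 by (simp add: U'_def)
  have inS: "u \<in> S" if "u \<in> U'" for u using that U by (auto simp: U'_def)
  define X where "X u = mu_sq u / 4" for u
  \<comment> \<open>At an umbilic point \<open>X u\<close> is a^2 and the rescaled mean curvature
    vector is 2a times the first normal vector, so its product with \<open>h u x y\<close> is 2 X
    (2g - P) by \<open>adapted_umbilic_structure\<close>. Solving for the projection expresses it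
    through smooth tensors.\<close>
  define P where "P u x y = 2 * g u x y -
      gb (F u) (h u x y) ((real DIM('a) / (real DIM('a) - 1)) *\<^sub>R mean_curv g gb F u) / (2 * X u)" for u x y
  have X0: "X u \<noteq> 0" if "u \<in> U'" for u using that by (simp add: X_def U'_def)
  have "\<exists>e r. inner_form.orthonormal (g u) DIM('a) e \<and>
      (\<forall>x y. P u x y = g u x (e 1) * g u y (e 1) + g u x (e 2) * g u y (e 2)) \<and>
      (\<forall>x y z w. riem4 g u x y z w =
        (c + 4 * X u) * (g u y z * g u x w - g u x z * g u y w)
        - 2 * X u * (P u y z * g u x w + g u y z * P u x w - P u x z * g u y w - g u x z * P u y w)
        + r * (P u y z * P u x w - P u x z * P u y w)) \<and>
      (c + r)\<^sup>2 = (4 - real DIM('a)) * (c + 2 * X u)\<^sup>2 + (real DIM('a) - 3) * (c + 4 * X u)\<^sup>2"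
    if u': "u \<in> U'" for u
  proof -
    note u = inS[OF u']
    interpret p: gauss_point "g u" "gb (F u)" "h u" "dderiv F u" c "riem4 g u" by (rule gauss_point[OF u])
    have we: "weakly_einstein_chart u" and ch: "chen_at u" using pt u' by (auto simp: U'_def)
    obtain a b where nf: "normal_form g gb F u a b" using ex_normal_form[OF u ch] by blast
    have ab: "b = a" using normal_form_cases[OF u nf we] u' by (auto simp: U'_def)
    obtain e \<xi> \<gamma> \<delta> where ad: "p.adapted e \<xi> \<gamma> \<delta> a b"
      and H: "(real DIM('a) / (real DIM('a) - 1)) *\<^sub>R mean_curv g gb F u = (a + b) *\<^sub>R \<xi>"
      and mu: "mu_sq u = (a + b)\<^sup>2"
      and rel: "(c + a * b - (gb (F u) \<gamma> \<gamma> + gb (F u) \<delta> \<delta>))\<^sup>2 + (real DIM('a) - 2) * (c + a * (a + b))\<^sup>2 =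
        (c + a * (a + b))\<^sup>2 + (c + b * (a + b))\<^sup>2 + (real DIM('a) - 3) * (c + (a + b)\<^sup>2)\<^sup>2"
      using normal_form_point[OF u nf we] by blast
    have Xa: "X u = a\<^sup>2" using mu by (simp add: X_def ab power2_eq_square)
    have "a \<noteq> 0" using X0[OF u'] Xa by simp
    note ad = ad[unfolded ab]
    have a2: "a + b = 2 * a" by (simp add: ab)
    have P: "P u x y = g u x (e 1) * g u y (e 1) + g u x (e 2) * g u y (e 2)" for x y
      unfolding P_def H a2 p.adapted_umbilic_structure(1)[OF ad refl] Xa using \<open>a \<noteq> 0\<close> by simp
    have "(c + (a\<^sup>2 - (gb (F u) \<gamma> \<gamma> + gb (F u) \<delta> \<delta>)))\<^sup>2 =
        (4 - real DIM('a)) * (c + 2 * X u)\<^sup>2 + (real DIM('a) - 3) * (c + 4 * X u)\<^sup>2"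
    proof -
      define s where "s = gb (F u) \<gamma> \<gamma> + gb (F u) \<delta> \<delta>"
      have "c + a * b - s = c + (a\<^sup>2 - s)" "c + a * (a + b) = c + 2 * X u" "c + b * (a + b) = c + 2 * X u"
        "c + (a + b)\<^sup>2 = c + 4 * X u"
        by (simp_all add: ab Xa power2_eq_square)
      from rel[folded s_def, unfolded this] show ?thesis
        unfolding s_def[symmetric] by (simp add: algebra_simps)
    qed
    then show ?thesis
      using p.adapted_frame[OF ad] P p.adapted_umbilic_structure(2)[OF ad P] unfolding Xa
      by (intro exI[of _ e] exI[of _ "a\<^sup>2 - (gb (F u) \<gamma> \<gamma> + gb (F u) \<delta> \<delta>)"]) blast
  qed
  then obtain e q' where frame: "\<And>u. u \<in> U' \<Longrightarrow> inner_form.orthonormal (g u) DIM('a) (e u)"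
    and P: "\<And>u x y. u \<in> U' \<Longrightarrow> P u x y = g u x (e u 1) * g u y (e u 1) + g u x (e u 2) * g u y (e u 2)"
    and R: "\<And>u x y z w. u \<in> U' \<Longrightarrow> riem4 g u x y z w =
        (c + 4 * X u) * (g u y z * g u x w - g u x z * g u y w)
        - 2 * X u * (P u y z * g u x w + g u y z * P u x w - P u x z * g u y w - g u x z * P u y w)
        + q' u * (P u y z * P u x w - P u x z * P u y w)"
    and rel: "\<And>u. u \<in> U' \<Longrightarrow>
        (c + q' u)\<^sup>2 = (4 - real DIM('a)) * (c + 2 * X u)\<^sup>2 + (real DIM('a) - 3) * (c + 4 * X u)\<^sup>2"
    by metis
  note sub = smooth_on_subset[OF M.open_S \<open>open U'\<close>]
  have U'S: "U' \<subseteq> S" using inS by blast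
  have smX: "smooth_on U' X"
    unfolding X_def[abs_def] divide_inverse
    by (intro smooth_on_mult smooth_on_const \<open>open U'\<close> sub[OF U'S smooth_mu_sq])
  have smP: "smooth_on U' (\<lambda>u. P u x y)" for x y
  proof -
    have "smooth_on S (\<lambda>u. gb (F u) (h u x y) ((real DIM('a) / (real DIM('a) - 1)) *\<^sub>R mean_curv g gb F u))"
      by (rule smooth_form_fields[of S "\<lambda>q. gb (F q)", OF M.open_S bilinear_gb compose_F(1)[OF N.smooth_g]
            smooth_h smooth_on_scaleR[OF M.open_S smooth_on_const[OF M.open_S] smooth_mean_curv]])
    note 1 = sub[OF U'S this] and 2 = sub[OF U'S M.smooth_g]
    show ?thesis
      unfolding P_def
      by (intro smooth_on_diff smooth_on_divide smooth_on_mult smooth_on_const \<open>open U'\<close> 1 2 smX)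
        (simp add: X0)
  qed
  have bilP: "bilinear (P u)" if u: "u \<in> U'" for u
    using bilinear_ladd[OF M.bilinear_g[OF inS[OF u]]] bilinear_lmul[OF M.bilinear_g[OF inS[OF u]]]
    unfolding bilinear_def P[OF u]
    by (auto intro!: linearI simp: algebra_simps)
  \<comment> \<open>The frame at \<open>u0\<close>, extended by constant vectors. \<open>K\<close>
    is the factor of \<open>q\<close> in the curvature formula for these vectors and
    \<open>Z\<close> is the curvature minus the other terms, so \<open>Z = q * K\<close>.\<close>
  define E where "E = e u0"
  define K where "K u = P u (E 2) (E 2) * P u (E 1) (E 1) - P u (E 1) (E 2) * P u (E 2) (E 1)" for u
  define Z where "Z u = riem4 g u (E 1) (E 2) (E 2) (E 1)
      - (c + 4 * X u) * (g u (E 2) (E 2) * g u (E 1) (E 1) - g u (E 1) (E 2) * g u (E 2) (E 1))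
      + 2 * X u * (P u (E 2) (E 2) * g u (E 1) (E 1) + g u (E 2) (E 2) * P u (E 1) (E 1)
        - P u (E 1) (E 2) * g u (E 2) (E 1) - g u (E 1) (E 2) * P u (E 2) (E 1))" for u
  have smK: "smooth_on U' K"
    unfolding K_def[abs_def] by (intro smooth_on_diff smooth_on_mult \<open>open U'\<close> smP)
  note 2 = sub[OF U'S M.smooth_g] and 3 = sub[OF U'S M.smooth_riem4]
  have smZ: "smooth_on U' Z"
    unfolding Z_def[abs_def]
    by (intro smooth_on_add smooth_on_diff smooth_on_mult smooth_on_const \<open>open U'\<close> smP smX 2 3)
  have ZK: "Z u = q' u * K u" if "u \<in> U'" for u
    unfolding Z_def K_def R[OF that] by simp
  \<comment> \<open>On this neighbourhood the pointwise value \<open>q' u\<close> is the smooth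
    quotient \<open>Z u / K u\<close>; it contains \<open>u0\<close> because
    \<open>K u0 = 1\<close>.\<close>
  define V where "V = U' \<inter> K -` (- {0})"
  have "open V"
    unfolding V_def
    by (rule continuous_open_preimage[OF smooth_on_continuous_on[OF smK] \<open>open U'\<close>]) (simp add: open_Compl)
  have VU: "V \<subseteq> U'" by (auto simp: V_def)
  note subV = smooth_on_subset[OF \<open>open U'\<close> \<open>open V\<close> VU]
  have q': "q' u = Z u / K u" if "u \<in> V" for u
    using ZK[of u] that by (auto simp: V_def)
  have smq: "smooth_on V (\<lambda>u. Z u / K u)"
    by (intro smooth_on_divide \<open>open V\<close> subV smZ smK) (auto simp: V_def)
  have u0V: "u0 \<in> V"
  proof -
    interpret p: inner_form "g u0" by (rule M.inner_form[OF inS[OF u0']])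
    have "g u0 (E 1) (E 1) = 1" "g u0 (E 2) (E 2) = 1" "g u0 (E 1) (E 2) = 0" "g u0 (E 2) (E 1) = 0"
      using p.orthonormalD[OF frame[OF u0'], of 1 1] p.orthonormalD[OF frame[OF u0'], of 2 2]
        p.orthonormalD[OF frame[OF u0'], of 1 2] p.orthonormalD[OF frame[OF u0'], of 2 1] dim3
      by (auto simp: E_def)
    then have "K u0 = 1" unfolding K_def P[OF u0'] E_def[symmetric] by simp
    then show ?thesis using u0' by (simp add: V_def)
  qed
  interpret ps: plane_structure S g V P X "\<lambda>u. Z u / K u" c
  proof (intro plane_structure.intro plane_structure_axioms.intro M.metric_chart_axioms dim5 \<open>open V\<close>)
    show "V \<subseteq> S" using VU U'S by blast
  next
    fix u assume "u \<in> V"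
    then show "bilinear (P u)" "X u \<noteq> 0" using VU bilP X0 by auto
  next
    fix x y show "smooth_on V (\<lambda>u. P u x y)" by (rule subV[OF smP])
  next
    show "smooth_on V X" by (rule subV[OF smX])
  next
    show "smooth_on V (\<lambda>u. Z u / K u)" by (rule smq)
  next
    fix u assume u: "u \<in> V"
    then have "u \<in> U'" using VU by blast
    then show "\<exists>e. inner_form.orthonormal (g u) DIM('a) e \<and>
      (\<forall>x y. P u x y = g u x (e 1) * g u y (e 1) + g u x (e 2) * g u y (e 2))"
      using frame P by blast
    fix x y z w
    show "riem4 g u x y z w =
      (c + 4 * X u) * (g u y z * g u x w - g u x z * g u y w)
      - 2 * X u * (P u y z * g u x w + g u y z * P u x w - P u x z * g u y w - g u x z * P u y w)
      + Z u / K u * (P u y z * P u x w - P u x z * P u y w)"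
      unfolding q'[OF u, symmetric] by (rule R[OF \<open>u \<in> U'\<close>])
  qed
  have "c + 2 * X u0 = 0"
  proof (rule ps.flat_mixed_planes[OF _ u0V])
    fix u assume u: "u \<in> V"
    then have "u \<in> U'" using VU by blast
    show "(c + Z u / K u)\<^sup>2 = (4 - real DIM('a)) * (c + 2 * X u)\<^sup>2 + (real DIM('a) - 3) * (c + 4 * X u)\<^sup>2"
      unfolding q'[OF u, symmetric] by (rule rel[OF \<open>u \<in> U'\<close>])
  qed
  then show False using neg by (simp add: X_def)
qed

end

section \<open>From charts to manifolds\<close>

lemma (in inner_form) spans_plane_iff_gram:
  "spans_plane x y \<longleftrightarrow> G x x * G y y - (G x y)\<^sup>2 > 0"
proof
  assume gram: "G x x * G y y - (G x y)\<^sup>2 > 0"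
  show "spans_plane x y"
  proof (rule ccontr)
    assume "\<not> spans_plane x y"
    then consider "x = y" | "x = 0" | k where "y = k *\<^sub>R x" using not_spans_plane_cases by blast
    then have "G x x * G y y - (G x y)\<^sup>2 = 0" by cases (simp_all add: power2_eq_square)
    then show False using gram by simp
  qed
qed (rule spans_plane_gram)

text \<open>
  A change of coordinates is an isometric immersion of codimension zero, so the Gauss equation shows
  that curvature quantities do not depend on the chart.
\<close>

locale isometry_chart = immersion_chart S g T gb F
  for S :: "'a::euclidean_space set" and g T and gb :: "'a coord_metric" and F
begin

lemma surj_dF:
  assumes u: "u \<in> S"
  shows "surj (dderiv F u)"
proof (rule linear_inj_imp_surj[OF linear_dF[OF u]])
  have "x = 0" if "dderiv F u x = 0" for x
  proof -
    have "g u x x = 0" unfolding induced[OF u] that by (simp add: bilinear_lzero[OF bilinear_gb[OF u]])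
    then show ?thesis using inner_form.eq_zero_iff[OF M.inner_form[OF u]] by blast
  qed
  then show "inj (dderiv F u)" using linear_injective_0[OF linear_dF[OF u]] by blast
qed

text \<open>The differential is onto, so a vector orthogonal to its image is zero; hence
  \<open>h\<close> vanishes in the Gauss equation.\<close>

lemma riem4_isometry:
  assumes u: "u \<in> S"
  shows "riem4 g u x y z w = riem4 gb (F u) (dderiv F u x) (dderiv F u y) (dderiv F u z) (dderiv F u w)"
proof -
  have "h u x y = 0" for x y
  proof (rule inner_form.nondegenerate[OF N.inner_form[OF F_in[OF u]]])
    fix z
    obtain z' where "z = dderiv F u z'" using surj_dF[OF u] by (metis surjD)
    then show "gb (F u) (h u x y) z = gb (F u) 0 z"
      by (simp add: h_normal[OF u] bilinear_lzero[OF bilinear_gb[OF u]])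
  qed
  then show ?thesis
    unfolding gauss_equation[OF u] by (simp add: bilinear_lzero[OF bilinear_gb[OF u]])
qed

lemma scalar_curv_isometry:
  assumes u: "u \<in> S"
  shows "scalar_curv g u = scalar_curv gb (F u)"
proof -
  interpret G: inner_form "g u" by (rule M.inner_form[OF u])
  interpret B: inner_form "gb (F u)" by (rule N.inner_form[OF F_in[OF u]])
  obtain e where e: "G.frame e" using G.ex_frame by blast
  then have "B.frame (\<lambda>i. dderiv F u (e i))"
    by (simp add: G.orthonormal_def B.orthonormal_def induced[OF u])
  from N.scalar_curv_frame[OF F_in[OF u] this] M.scalar_curv_frame[OF u e] show ?thesis
    by (simp add: riem4_isometry[OF u])
qed

lemma inf_sec_curv_isometry:
  assumes u: "u \<in> S"
  shows "inf_sec_curv g u = inf_sec_curv gb (F u)"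
proof -
  interpret G: inner_form "g u" by (rule M.inner_form[OF u])
  interpret B: inner_form "gb (F u)" by (rule N.inner_form[OF F_in[OF u]])
  have sec: "sec_curv g u x y = sec_curv gb (F u) (dderiv F u x) (dderiv F u y)" for x y
    by (simp add: sec_curv_def riem4_isometry[OF u] induced[OF u])
  have spans: "spans_plane x y \<longleftrightarrow> spans_plane (dderiv F u x) (dderiv F u y)" for x y
    using G.spans_plane_iff_gram[of x y] B.spans_plane_iff_gram[of "dderiv F u x" "dderiv F u y"]
    by (simp add: induced[OF u])
  have "{sec_curv g u x y | x y. spans_plane x y} = {sec_curv gb (F u) x y | x y. spans_plane x y}"
  proof (intro equalityI subsetI)
    fix s assume "s \<in> {sec_curv g u x y | x y. spans_plane x y}"
    then show "s \<in> {sec_curv gb (F u) x y | x y. spans_plane x y}" using sec spans by blast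
  next
    fix s assume "s \<in> {sec_curv gb (F u) x y | x y. spans_plane x y}"
    then obtain x y where xy: "s = sec_curv gb (F u) x y" "spans_plane x y" by blast
    obtain x' y' where "x = dderiv F u x'" "y = dderiv F u y'" using surj_dF[OF u] by (metis surjD)
    then have "s = sec_curv g u x' y'" "spans_plane x' y'"
      using xy sec[of x' y'] spans[of x' y'] by simp_all
    then show "s \<in> {sec_curv g u x y | x y. spans_plane x y}" by blast
  qed
  then show ?thesis by (simp add: inf_sec_curv_def)
qed

end

section \<open>Charts and locally constant functions on a connected manifold\<close>

context
  fixes M :: "('m, 'a::euclidean_space) riem_space"
  assumes M: "smooth_manifold M"
begin

lemma chart_openin: "\<kappa> \<in> atlas M \<Longrightarrow> openin (top_of M) (fst \<kappa>)"
  using M by (simp add: smooth_manifold_def)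

lemma chart_homeo:
  "\<kappa> \<in> atlas M \<Longrightarrow> homeomorphic_map (subtopology (top_of M) (fst \<kappa>)) (top_of_set (coord_range \<kappa>)) (snd \<kappa>)"
  using M by (simp add: smooth_manifold_def)

lemma open_coord_range: "\<kappa> \<in> atlas M \<Longrightarrow> open (coord_range \<kappa>)"
  using M by (simp add: smooth_manifold_def)

lemma chart_topspace: "\<kappa> \<in> atlas M \<Longrightarrow> topspace (subtopology (top_of M) (fst \<kappa>)) = fst \<kappa>"
  using openin_subset[OF chart_openin] by (simp add: Int_absorb1)

lemma chart_inj: "\<kappa> \<in> atlas M \<Longrightarrow> inj_on (snd \<kappa>) (fst \<kappa>)"
  using homeomorphic_imp_injective_map[OF chart_homeo] chart_topspace by metis

lemma coord_map_apply: "\<kappa> \<in> atlas M \<Longrightarrow> m \<in> fst \<kappa> \<Longrightarrow> coord_map \<kappa> \<kappa>' f (snd \<kappa> m) = snd \<kappa>' (f m)"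
  by (simp add: coord_map_def inv_into_f_f[OF chart_inj])

lemma open_chart_image:
  assumes \<kappa>: "\<kappa> \<in> atlas M" and D: "openin (top_of M) D" "D \<subseteq> fst \<kappa>"
  shows "open (snd \<kappa> ` D)"
proof -
  have "openin (subtopology (top_of M) (fst \<kappa>)) D"
    using D openin_open_subtopology[OF chart_openin[OF \<kappa>]] by blast
  then have "openin (top_of_set (coord_range \<kappa>)) (snd \<kappa> ` D)"
    using homeomorphic_imp_open_map[OF chart_homeo[OF \<kappa>]] by (simp add: open_map_def)
  then show ?thesis using openin_open_eq[OF open_coord_range[OF \<kappa>]] by blast
qed

lemma openin_chart_preimage:
  assumes \<kappa>: "\<kappa> \<in> atlas M" and W: "open W"
  shows "openin (top_of M) {m \<in> fst \<kappa>. snd \<kappa> m \<in> W}"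
proof -
  have "openin (top_of_set (coord_range \<kappa>)) (coord_range \<kappa> \<inter> W)"
    using W by (simp add: openin_open_Int)
  then have "openin (subtopology (top_of M) (fst \<kappa>))
      {m \<in> topspace (subtopology (top_of M) (fst \<kappa>)). snd \<kappa> m \<in> coord_range \<kappa> \<inter> W}"
    by (rule openin_continuous_map_preimage[OF homeomorphic_imp_continuous_map[OF chart_homeo[OF \<kappa>]]])
  moreover have "{m \<in> topspace (subtopology (top_of M) (fst \<kappa>)). snd \<kappa> m \<in> coord_range \<kappa> \<inter> W} =
      {m \<in> fst \<kappa>. snd \<kappa> m \<in> W}"
    unfolding chart_topspace[OF \<kappa>] by (auto simp: coord_range_def)
  ultimately show ?thesis using openin_open_subtopology[OF chart_openin[OF \<kappa>]] by simp
qed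

lemma smooth_map_id: "smooth_map M M id"
  unfolding smooth_map_def
proof (intro conjI ballI)
  fix \<kappa> \<kappa>' assume k: "\<kappa> \<in> atlas M" "\<kappa>' \<in> atlas M"
  have "\<forall>\<kappa>\<in>atlas M. \<forall>\<kappa>'\<in>atlas M. smooth_on (snd \<kappa> ` (fst \<kappa> \<inter> fst \<kappa>')) (coord_map \<kappa> \<kappa>' id)"
    using M unfolding smooth_manifold_def by blast
  from bspec[OF bspec[OF this k(1)] k(2)]
  have "smooth_on (snd \<kappa> ` (fst \<kappa> \<inter> fst \<kappa>')) (coord_map \<kappa> \<kappa>' id)" .
  moreover have "{x \<in> fst \<kappa>. id x \<in> fst \<kappa>'} = fst \<kappa> \<inter> fst \<kappa>'" by auto
  ultimately show "smooth_on (snd \<kappa> ` {x \<in> fst \<kappa>. id x \<in> fst \<kappa>'}) (coord_map \<kappa> \<kappa>' id)"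
    by simp
qed simp

text \<open>A continuous function with finitely many values has open level sets. Independence of the
  chart makes these disjoint, so each is also closed, and connectedness leaves only one that is
  nonempty.\<close>

lemma locally_constant_invariant:
  fixes \<Phi> :: "('m, 'a) chart \<Rightarrow> 'm \<Rightarrow> real"
  assumes inv: "\<And>\<kappa>1 \<kappa>2 m. \<kappa>1 \<in> atlas M \<Longrightarrow> \<kappa>2 \<in> atlas M \<Longrightarrow> m \<in> fst \<kappa>1 \<Longrightarrow> m \<in> fst \<kappa>2 \<Longrightarrow> \<Phi> \<kappa>1 m = \<Phi> \<kappa>2 m"
    and cont: "\<And>\<kappa> m. \<kappa> \<in> atlas M \<Longrightarrow> m \<in> fst \<kappa> \<Longrightarrow> \<exists>U \<psi>. open U \<and> snd \<kappa> m \<in> U \<and> continuous_on U \<psi> \<and>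
      (\<forall>m'\<in>fst \<kappa>. snd \<kappa> m' \<in> U \<longrightarrow> \<Phi> \<kappa> m' = \<psi> (snd \<kappa> m'))"
    and A: "finite A" and vals: "\<And>\<kappa> m. \<kappa> \<in> atlas M \<Longrightarrow> m \<in> fst \<kappa> \<Longrightarrow> \<Phi> \<kappa> m \<in> A"
    and \<kappa>0: "\<kappa>0 \<in> atlas M" "m0 \<in> fst \<kappa>0" and \<kappa>: "\<kappa> \<in> atlas M" "m \<in> fst \<kappa>"
  shows "\<Phi> \<kappa> m = \<Phi> \<kappa>0 m0"
proof -
  define lev where "lev v = {m. \<exists>\<kappa>\<in>atlas M. m \<in> fst \<kappa> \<and> \<Phi> \<kappa> m = v}" for v
  have top: "topspace (top_of M) = (\<Union>\<kappa>\<in>atlas M. fst \<kappa>)" using M by (simp add: smooth_manifold_def)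
  have op: "openin (top_of M) (lev v)" for v
  proof (subst openin_subopen, intro ballI)
    fix m assume "m \<in> lev v"
    then obtain \<kappa> where k: "\<kappa> \<in> atlas M" "m \<in> fst \<kappa>" "\<Phi> \<kappa> m = v" by (auto simp: lev_def)
    obtain U \<psi> where U: "open U" "snd \<kappa> m \<in> U" "continuous_on U \<psi>"
      "\<forall>m'\<in>fst \<kappa>. snd \<kappa> m' \<in> U \<longrightarrow> \<Phi> \<kappa> m' = \<psi> (snd \<kappa> m')"
      using cont[OF k(1,2)] by blast
    \<comment> \<open>Removing the finitely many other values leaves an open condition that forces
      the value \<open>v\<close>.\<close>
    define W where "W = U \<inter> \<psi> -` (- (A - {v}))"
    have "open W"
      unfolding W_def
      by (rule continuous_open_preimage[OF U(3,1)]) (intro open_Compl finite_imp_closed finite_Diff A)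
    have "openin (top_of M) {m' \<in> fst \<kappa>. snd \<kappa> m' \<in> W}" by (rule openin_chart_preimage[OF k(1) \<open>open W\<close>])
    moreover have "m \<in> {m' \<in> fst \<kappa>. snd \<kappa> m' \<in> W}" using k U by (auto simp: W_def)
    moreover have "{m' \<in> fst \<kappa>. snd \<kappa> m' \<in> W} \<subseteq> lev v"
    proof
      fix m' assume "m' \<in> {m' \<in> fst \<kappa>. snd \<kappa> m' \<in> W}"
      then have "m' \<in> fst \<kappa>" "\<Phi> \<kappa> m' = v" using U(4) vals[OF k(1), of m'] by (auto simp: W_def)
      then show "m' \<in> lev v" using k(1) by (auto simp: lev_def)
    qed
    ultimately show "\<exists>T. openin (top_of M) T \<and> m \<in> T \<and> T \<subseteq> lev v" by blast
  qed
  define r where "r = \<Phi> \<kappa>0 m0"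
  have "topspace (top_of M) - lev r = (\<Union>v\<in>- {r}. lev v)"
  proof (intro equalityI subsetI)
    fix x assume "x \<in> topspace (top_of M) - lev r"
    then show "x \<in> (\<Union>v\<in>- {r}. lev v)" by (auto simp: top lev_def)
  next
    fix x assume "x \<in> (\<Union>v\<in>- {r}. lev v)"
    then obtain k where k: "k \<in> atlas M" "x \<in> fst k" "\<Phi> k x \<noteq> r" by (auto simp: lev_def)
    have "x \<notin> lev r"
    proof
      assume "x \<in> lev r"
      then obtain k' where k': "k' \<in> atlas M" "x \<in> fst k'" "\<Phi> k' x = r" by (auto simp: lev_def)
      then show False using inv[OF k(1) k'(1) k(2) k'(2)] k(3) by simp
    qed
    then show "x \<in> topspace (top_of M) - lev r" using k by (auto simp: top)
  qed
  moreover have "openin (top_of M) (\<Union>v\<in>- {r}. lev v)" using op by (intro openin_Union) blast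
  ultimately have "closedin (top_of M) (lev r)"
    using openin_subset[OF op] by (simp add: closedin_def)
  moreover have "m0 \<in> lev r" unfolding lev_def r_def using \<kappa>0 by blast
  moreover have "connected_space (top_of M)" using M by (simp add: smooth_manifold_def)
  ultimately have "lev r = topspace (top_of M)"
    using op[of r] unfolding connected_space_clopen_in by blast
  then have "m \<in> lev r" using \<kappa> by (auto simp: top)
  then obtain k where k: "k \<in> atlas M" "m \<in> fst k" "\<Phi> k m = r" by (auto simp: lev_def)
  then show ?thesis using inv[OF \<kappa>(1) k(1) \<kappa>(2) k(2)] by (simp add: r_def)
qed

end

text \<open>The metric condition is required only for the two charts at hand, so the lemma covers
  the immersion as well as the identity map, i.e. a change of coordinates.\<close>

lemma immersion_chart_manifold:
  fixes M :: "('m, 'a::euclidean_space) riem_space" and N :: "('q, 'b::euclidean_space) riem_space"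
  assumes M: "riemannian_manifold M" and N: "riemannian_manifold N" and f: "smooth_map M N f"
    and \<kappa>: "\<kappa> \<in> atlas M" and \<kappa>': "\<kappa>' \<in> atlas N"
    and iso: "\<And>m x y. m \<in> fst \<kappa> \<Longrightarrow> f m \<in> fst \<kappa>' \<Longrightarrow> metric M \<kappa> (snd \<kappa> m) x y =
           metric N \<kappa>' (snd \<kappa>' (f m)) (dderiv (coord_map \<kappa> \<kappa>' f) (snd \<kappa> m) x)
                                      (dderiv (coord_map \<kappa> \<kappa>' f) (snd \<kappa> m) y)"
  shows "immersion_chart (snd \<kappa> ` {x \<in> fst \<kappa>. f x \<in> fst \<kappa>'}) (metric M \<kappa>) (coord_range \<kappa>') (metric N \<kappa>')
    (coord_map \<kappa> \<kappa>' f)"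
proof -
  have sM: "smooth_manifold M" and sN: "smooth_manifold N"
    using M N by (simp_all add: riemannian_manifold_def)
  let ?D = "{x \<in> fst \<kappa>. f x \<in> fst \<kappa>'}"
  have "openin (top_of M) {x \<in> topspace (top_of M). f x \<in> fst \<kappa>'}"
    using f chart_openin[OF sN \<kappa>'] by (auto simp: smooth_map_def intro: openin_continuous_map_preimage)
  then have "openin (top_of M) (fst \<kappa> \<inter> {x \<in> topspace (top_of M). f x \<in> fst \<kappa>'})"
    by (rule openin_Int[OF chart_openin[OF sM \<kappa>]])
  moreover have "fst \<kappa> \<inter> {x \<in> topspace (top_of M). f x \<in> fst \<kappa>'} = ?D"
    using openin_subset[OF chart_openin[OF sM \<kappa>]] by blast
  ultimately have open_S: "open (snd \<kappa> ` ?D)"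
    using open_chart_image[OF sM \<kappa>, of ?D] by auto
  have sub: "snd \<kappa> ` ?D \<subseteq> coord_range \<kappa>" by (auto simp: coord_range_def)
  have inner: "inner_form (metric R k u)" if "riemannian_manifold R" "k \<in> atlas R" "u \<in> coord_range k"
    for R :: "('r, 'd::euclidean_space) riem_space" and k u
    using that unfolding riemannian_manifold_def inner_form_def by blast
  have smooth: "smooth_on (coord_range k) (\<lambda>u. metric R k u x y)" if "riemannian_manifold R" "k \<in> atlas R"
    for R :: "('r, 'd::euclidean_space) riem_space" and k x y
    using that unfolding riemannian_manifold_def by blast
  interpret MM: metric_chart "snd \<kappa> ` ?D" "metric M \<kappa>"
    using inner[OF M \<kappa>] sub
    by (intro metric_chart.intro open_S smooth_on_subset[OF open_coord_range[OF sM \<kappa>] open_S sub smooth[OF M \<kappa>]])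
      blast
  interpret NN: metric_chart "coord_range \<kappa>'" "metric N \<kappa>'"
    by (intro metric_chart.intro open_coord_range[OF sN \<kappa>'] inner[OF N \<kappa>'] smooth[OF N \<kappa>'])
  note ap = coord_map_apply[OF sM \<kappa>, where \<kappa>' = \<kappa>' and f = f]
  show ?thesis
  proof unfold_locales
    show "smooth_on (snd \<kappa> ` ?D) (coord_map \<kappa> \<kappa>' f)"
      using f \<kappa> \<kappa>' by (simp add: smooth_map_def)
  next
    fix u assume "u \<in> snd \<kappa> ` ?D"
    then show "coord_map \<kappa> \<kappa>' f u \<in> coord_range \<kappa>'"
      by (auto simp: ap coord_range_def)
  next
    fix u x y assume "u \<in> snd \<kappa> ` ?D"
    then show "metric M \<kappa> u x y = metric N \<kappa>' (coord_map \<kappa> \<kappa>' f u)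
        (dderiv (coord_map \<kappa> \<kappa>' f) u x) (dderiv (coord_map \<kappa> \<kappa>' f) u y)"
      using iso by (auto simp: ap)
  qed
qed

lemma curvature_chart_independent:
  fixes M :: "('m, 'a::euclidean_space) riem_space"
  assumes M: "riemannian_manifold M" and \<kappa>: "\<kappa>1 \<in> atlas M" "\<kappa>2 \<in> atlas M" and m: "m \<in> fst \<kappa>1" "m \<in> fst \<kappa>2"
  shows "scalar_curv (metric M \<kappa>1) (snd \<kappa>1 m) = scalar_curv (metric M \<kappa>2) (snd \<kappa>2 m)"
    and "inf_sec_curv (metric M \<kappa>1) (snd \<kappa>1 m) = inf_sec_curv (metric M \<kappa>2) (snd \<kappa>2 m)"
proof -
  have sM: "smooth_manifold M" using M by (simp add: riemannian_manifold_def)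
  have "immersion_chart (snd \<kappa>1 ` {x \<in> fst \<kappa>1. id x \<in> fst \<kappa>2}) (metric M \<kappa>1) (coord_range \<kappa>2) (metric M \<kappa>2)
    (coord_map \<kappa>1 \<kappa>2 id)"
  proof (rule immersion_chart_manifold[OF M M smooth_map_id[OF sM] \<kappa>])
    fix m x y assume "m \<in> fst \<kappa>1" "id m \<in> fst \<kappa>2"
    then have "m \<in> fst \<kappa>1 \<inter> fst \<kappa>2" by simp
    then show "metric M \<kappa>1 (snd \<kappa>1 m) x y = metric M \<kappa>2 (snd \<kappa>2 (id m))
        (dderiv (coord_map \<kappa>1 \<kappa>2 id) (snd \<kappa>1 m) x) (dderiv (coord_map \<kappa>1 \<kappa>2 id) (snd \<kappa>1 m) y)"
      using M \<kappa> unfolding riemannian_manifold_def id_apply by blast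
  qed
  then interpret isometry_chart "snd \<kappa>1 ` {x \<in> fst \<kappa>1. id x \<in> fst \<kappa>2}" "metric M \<kappa>1" "coord_range \<kappa>2"
    "metric M \<kappa>2" "coord_map \<kappa>1 \<kappa>2 id"
    by (simp add: isometry_chart_def)
  have u: "snd \<kappa>1 m \<in> snd \<kappa>1 ` {x \<in> fst \<kappa>1. id x \<in> fst \<kappa>2}" using m by auto
  have F: "coord_map \<kappa>1 \<kappa>2 id (snd \<kappa>1 m) = snd \<kappa>2 m" by (simp add: coord_map_apply[OF sM \<kappa>(1) m(1)])
  show "scalar_curv (metric M \<kappa>1) (snd \<kappa>1 m) = scalar_curv (metric M \<kappa>2) (snd \<kappa>2 m)"
    using scalar_curv_isometry[OF u] unfolding F .
  show "inf_sec_curv (metric M \<kappa>1) (snd \<kappa>1 m) = inf_sec_curv (metric M \<kappa>2) (snd \<kappa>2 m)"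
    using inf_sec_curv_isometry[OF u] unfolding F .
qed

section \<open>The global case distinction\<close>

locale chen_submanifold =
  fixes M :: "('m, 'a::euclidean_space) riem_space" and N :: "('q, 'b::euclidean_space) riem_space"
    and f :: "'m \<Rightarrow> 'q" and c :: real
  assumes dim3: "DIM('a) \<ge> 3" and codim: "DIM('b) > DIM('a)"
    and N: "space_form N c" and M: "riemannian_manifold M" and iso: "isometric_immersion M N f"
    and we: "weakly_einstein M" and chen: "chen_equality M N f c"
begin

abbreviation dom :: "('m, 'a) chart \<Rightarrow> ('q, 'b) chart \<Rightarrow> 'a set" where
  "dom \<kappa> \<kappa>' \<equiv> snd \<kappa> ` {x \<in> fst \<kappa>. f x \<in> fst \<kappa>'}"

lemma smooth_M: "smooth_manifold M" and smooth_N: "smooth_manifold N"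
  using M N by (simp_all add: riemannian_manifold_def space_form_def)

lemma chart:
  assumes "\<kappa> \<in> atlas M" "\<kappa>' \<in> atlas N"
  shows "space_form_chart (dom \<kappa> \<kappa>') (metric M \<kappa>) (coord_range \<kappa>') (metric N \<kappa>') (coord_map \<kappa> \<kappa>' f) c"
proof -
  have "riemannian_manifold N" "smooth_map M N f" using N iso by (simp_all add: space_form_def isometric_immersion_def)
  then have "immersion_chart (dom \<kappa> \<kappa>') (metric M \<kappa>) (coord_range \<kappa>') (metric N \<kappa>') (coord_map \<kappa> \<kappa>' f)"
    using iso assms by (intro immersion_chart_manifold M) (auto simp: isometric_immersion_def)
  moreover have "space_form_chart_axioms TYPE('a) (coord_range \<kappa>') (metric N \<kappa>') c"
    using N assms(2) dim3 codim
    by (intro space_form_chart_axioms.intro) (auto simp: space_form_def constant_curvature_def at_every_point_def)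
  ultimately show ?thesis by (rule space_form_chart.intro)
qed

text \<open>Ensures that the sets \<open>dom\<close> cover every chart of \<open>M\<close>, so that
  properties checked on them hold at every point.\<close>

lemma ambient_chart: "\<kappa> \<in> atlas M \<Longrightarrow> m \<in> fst \<kappa> \<Longrightarrow> \<exists>\<kappa>'\<in>atlas N. f m \<in> fst \<kappa>'"
proof -
  assume "\<kappa> \<in> atlas M" "m \<in> fst \<kappa>"
  then have "m \<in> topspace (top_of M)" using openin_subset[OF chart_openin[OF smooth_M]] by blast
  moreover have "continuous_map (top_of M) (top_of N) f"
    using iso by (simp add: isometric_immersion_def smooth_map_def)
  ultimately have "f m \<in> topspace (top_of N)" by (auto simp: continuous_map_def)
  then show ?thesis using smooth_N by (auto simp: smooth_manifold_def)
qed

lemma point: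
  assumes "\<kappa> \<in> atlas M" "\<kappa>' \<in> atlas N" "u \<in> dom \<kappa> \<kappa>'"
  shows "space_form_chart.weakly_einstein_chart (metric M \<kappa>) u"
    and "space_form_chart.chen_at (metric M \<kappa>) (metric N \<kappa>') (coord_map \<kappa> \<kappa>' f) c u"
proof -
  have "u \<in> coord_range \<kappa>" using assms(3) by (auto simp: coord_range_def)
  then show "space_form_chart.weakly_einstein_chart (metric M \<kappa>) u"
    using we assms(1) unfolding space_form_chart.weakly_einstein_chart_def[OF chart[OF assms(1,2)]]
    by (auto simp: weakly_einstein_def at_every_point_def)
  show "space_form_chart.chen_at (metric M \<kappa>) (metric N \<kappa>') (coord_map \<kappa> \<kappa>' f) c u"
    using chen assms unfolding space_form_chart.chen_at_def[OF chart[OF assms(1,2)]]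
    by (auto simp: chen_equality_def at_every_point_of_immersion_def Let_def)
qed

abbreviation mu :: "('m, 'a) chart \<Rightarrow> ('q, 'b) chart \<Rightarrow> 'a \<Rightarrow> real" where
  "mu \<kappa> \<kappa>' \<equiv> space_form_chart.mu_sq (metric M \<kappa>) (metric N \<kappa>') (coord_map \<kappa> \<kappa>' f)"

abbreviation nf :: "('m, 'a) chart \<Rightarrow> ('q, 'b) chart \<Rightarrow> 'a \<Rightarrow> real \<Rightarrow> real \<Rightarrow> bool" where
  "nf \<kappa> \<kappa>' \<equiv> normal_form (metric M \<kappa>) (metric N \<kappa>') (coord_map \<kappa> \<kappa>' f)"

lemma mem_dom: "\<kappa> \<in> atlas M \<Longrightarrow> m \<in> fst \<kappa> \<Longrightarrow> snd \<kappa> m \<in> dom \<kappa> \<kappa>' \<longleftrightarrow> f m \<in> fst \<kappa>'"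
  using chart_inj[OF smooth_M, of \<kappa>] by (auto simp: inj_on_def)

text \<open>By Chen's equality \<open>mu\<close> is intrinsic; solving the equality for it gives this formula.\<close>

definition mu_intrinsic :: "('m, 'a) chart \<Rightarrow> 'm \<Rightarrow> real" where
  "mu_intrinsic \<kappa> m = 2 / ((real DIM('a) - 1) * (real DIM('a) - 2)) *
    (scalar_curv (metric M \<kappa>) (snd \<kappa> m) / 2 - inf_sec_curv (metric M \<kappa>) (snd \<kappa> m)
      - (real DIM('a) + 1) * (real DIM('a) - 2) * c / 2)"

lemma mu_eq:
  assumes "\<kappa> \<in> atlas M" "\<kappa>' \<in> atlas N" "m \<in> fst \<kappa>" "f m \<in> fst \<kappa>'"
  shows "mu \<kappa> \<kappa>' (snd \<kappa> m) = mu_intrinsic \<kappa> m"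
proof -
  interpret C: space_form_chart "dom \<kappa> \<kappa>'" "metric M \<kappa>" "coord_range \<kappa>'" "metric N \<kappa>'" "coord_map \<kappa> \<kappa>' f" c
    by (rule chart[OF assms(1,2)])
  have u: "snd \<kappa> m \<in> dom \<kappa> \<kappa>'" using mem_dom assms by blast
  \<comment> \<open>Compares the factor in \<open>mu_sq\<close> with the coefficient of the mean
    curvature term in Chen's equality.\<close>
  have n: "(n / (n - 1))\<^sup>2 * H = 2 / ((n - 1) * (n - 2)) * (n\<^sup>2 * (n - 2) / (2 * (n - 1)) * H)"
    if "n \<ge> 3" for n H :: real
  proof -
    have "n - 1 \<noteq> 0" "n - 2 \<noteq> 0" using that by auto
    then show ?thesis by (simp add: power2_eq_square divide_simps)
  qed
  show ?thesis
    using point(2)[OF assms(1,2) u] unfolding C.chen_at_def C.mu_sq_def mu_intrinsic_def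
    by (subst n) (use dim3 in simp_all)
qed

text \<open>\<psi> is a local expression that may use an ambient chart, \<Phi> an intrinsic function
  on \<open>M\<close>. Continuity and the finite range are read off from \<psi>, independence of the
  chart from \<Phi>. For a manifold without points the claim is vacuous.\<close>

lemma locally_constant:
  assumes inv: "\<And>\<kappa>1 \<kappa>2 m. \<kappa>1 \<in> atlas M \<Longrightarrow> \<kappa>2 \<in> atlas M \<Longrightarrow> m \<in> fst \<kappa>1 \<Longrightarrow> m \<in> fst \<kappa>2 \<Longrightarrow> \<Phi> \<kappa>1 m = \<Phi> \<kappa>2 m"
    and \<psi>: "\<And>\<kappa> \<kappa>' m. \<kappa> \<in> atlas M \<Longrightarrow> \<kappa>' \<in> atlas N \<Longrightarrow> m \<in> fst \<kappa> \<Longrightarrow> f m \<in> fst \<kappa>' \<Longrightarrow>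
      \<psi> \<kappa> \<kappa>' (snd \<kappa> m) = (\<Phi> \<kappa> m :: real)"
    and cont: "\<And>\<kappa> \<kappa>'. \<kappa> \<in> atlas M \<Longrightarrow> \<kappa>' \<in> atlas N \<Longrightarrow> continuous_on (dom \<kappa> \<kappa>') (\<psi> \<kappa> \<kappa>')"
    and A: "finite A" and vals: "\<And>\<kappa> \<kappa>' u. \<kappa> \<in> atlas M \<Longrightarrow> \<kappa>' \<in> atlas N \<Longrightarrow> u \<in> dom \<kappa> \<kappa>' \<Longrightarrow> \<psi> \<kappa> \<kappa>' u \<in> A"
  shows "\<exists>r. \<forall>\<kappa>\<in>atlas M. \<forall>\<kappa>'\<in>atlas N. \<forall>u\<in>dom \<kappa> \<kappa>'. \<psi> \<kappa> \<kappa>' u = r"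
proof (cases "\<exists>\<kappa>0\<in>atlas M. \<exists>m0. m0 \<in> fst \<kappa>0")
  case True
  then obtain \<kappa>0 m0 where 0: "\<kappa>0 \<in> atlas M" "m0 \<in> fst \<kappa>0" by blast
  have "\<Phi> \<kappa> m = \<Phi> \<kappa>0 m0" if "\<kappa> \<in> atlas M" "m \<in> fst \<kappa>" for \<kappa> m
  proof (rule locally_constant_invariant[OF smooth_M inv _ A _ 0 that])
    fix \<kappa> m assume k: "\<kappa> \<in> atlas M" "m \<in> fst \<kappa>"
    then obtain \<kappa>' where k': "\<kappa>' \<in> atlas N" "f m \<in> fst \<kappa>'" using ambient_chart by blast
    interpret C: space_form_chart "dom \<kappa> \<kappa>'" "metric M \<kappa>" "coord_range \<kappa>'" "metric N \<kappa>'" "coord_map \<kappa> \<kappa>' f" c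
      by (rule chart[OF k(1) k'(1)])
    have "\<forall>m'\<in>fst \<kappa>. snd \<kappa> m' \<in> dom \<kappa> \<kappa>' \<longrightarrow> \<Phi> \<kappa> m' = \<psi> \<kappa> \<kappa>' (snd \<kappa> m')"
      using mem_dom[OF k(1)] \<psi>[OF k(1) k'(1)] by simp
    moreover have "snd \<kappa> m \<in> dom \<kappa> \<kappa>'" using mem_dom[OF k] k'(2) by simp
    ultimately show "\<exists>U \<psi>. open U \<and> snd \<kappa> m \<in> U \<and> continuous_on U \<psi> \<and>
        (\<forall>m'\<in>fst \<kappa>. snd \<kappa> m' \<in> U \<longrightarrow> \<Phi> \<kappa> m' = \<psi> (snd \<kappa> m'))"
      using C.M.open_S cont[OF k(1) k'(1)] by (intro exI[of _ "dom \<kappa> \<kappa>'"] exI[of _ "\<psi> \<kappa> \<kappa>'"]) simp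
    show "\<Phi> \<kappa> m \<in> A"
      using vals[OF k(1) k'(1), of "snd \<kappa> m"] \<psi>[OF k(1) k'(1) k(2) k'(2)] mem_dom[OF k] k'(2) by simp
  qed
  then show ?thesis using \<psi> by (intro exI[of _ "\<Phi> \<kappa>0 m0"]) auto
qed auto

lemma mu_constant:
  assumes "finite A" "\<And>\<kappa> \<kappa>' u. \<kappa> \<in> atlas M \<Longrightarrow> \<kappa>' \<in> atlas N \<Longrightarrow> u \<in> dom \<kappa> \<kappa>' \<Longrightarrow> mu \<kappa> \<kappa>' u \<in> A"
  shows "\<exists>r. \<forall>\<kappa>\<in>atlas M. \<forall>\<kappa>'\<in>atlas N. \<forall>u\<in>dom \<kappa> \<kappa>'. mu \<kappa> \<kappa>' u = r"
proof (rule locally_constant[where \<psi> = mu and \<Phi> = mu_intrinsic, OF _ mu_eq _ assms])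
  fix \<kappa>1 \<kappa>2 m assume "\<kappa>1 \<in> atlas M" "\<kappa>2 \<in> atlas M" "m \<in> fst \<kappa>1" "m \<in> fst \<kappa>2"
  then show "mu_intrinsic \<kappa>1 m = mu_intrinsic \<kappa>2 m"
    using curvature_chart_independent[OF M, of \<kappa>1 \<kappa>2 m] by (simp add: mu_intrinsic_def)
next
  fix \<kappa> \<kappa>' assume "\<kappa> \<in> atlas M" "\<kappa>' \<in> atlas N"
  then show "continuous_on (dom \<kappa> \<kappa>') (mu \<kappa> \<kappa>')"
    by (intro smooth_on_continuous_on space_form_chart.smooth_mu_sq[OF chart])
qed

lemma scalar_curv_constant:
  assumes "finite A" "\<And>\<kappa> \<kappa>' u. \<kappa> \<in> atlas M \<Longrightarrow> \<kappa>' \<in> atlas N \<Longrightarrow> u \<in> dom \<kappa> \<kappa>' \<Longrightarrow> scalar_curv (metric M \<kappa>) u \<in> A"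
  shows "\<exists>r. \<forall>\<kappa>\<in>atlas M. \<forall>\<kappa>'\<in>atlas N. \<forall>u\<in>dom \<kappa> \<kappa>'. scalar_curv (metric M \<kappa>) u = r"
proof (rule locally_constant[where \<psi> = "\<lambda>\<kappa> \<kappa>'. scalar_curv (metric M \<kappa>)"
      and \<Phi> = "\<lambda>\<kappa> m. scalar_curv (metric M \<kappa>) (snd \<kappa> m)", OF _ refl _ assms])
  fix \<kappa>1 \<kappa>2 m assume "\<kappa>1 \<in> atlas M" "\<kappa>2 \<in> atlas M" "m \<in> fst \<kappa>1" "m \<in> fst \<kappa>2"
  then show "scalar_curv (metric M \<kappa>1) (snd \<kappa>1 m) = scalar_curv (metric M \<kappa>2) (snd \<kappa>2 m)"
    by (rule curvature_chart_independent(1)[OF M])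
next
  fix \<kappa> \<kappa>' assume k: "\<kappa> \<in> atlas M" "\<kappa>' \<in> atlas N"
  interpret C: space_form_chart "dom \<kappa> \<kappa>'" "metric M \<kappa>" "coord_range \<kappa>'" "metric N \<kappa>'" "coord_map \<kappa> \<kappa>' f" c
    by (rule chart[OF k])
  show "continuous_on (dom \<kappa> \<kappa>') (scalar_curv (metric M \<kappa>))"
    by (rule smooth_on_continuous_on[OF C.M.smooth_scalar_curv])
qed

lemma ex_nf:
  assumes "\<kappa> \<in> atlas M" "\<kappa>' \<in> atlas N" "u \<in> dom \<kappa> \<kappa>'"
  shows "\<exists>a b. nf \<kappa> \<kappa>' u a b"
  by (rule space_form_chart.ex_normal_form[OF chart[OF assms(1,2)] assms(3) point(2)[OF assms]])

lemma nf_cases: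
  assumes "\<kappa> \<in> atlas M" "\<kappa>' \<in> atlas N" "u \<in> dom \<kappa> \<kappa>'" "nf \<kappa> \<kappa>' u a b"
  shows "mu \<kappa> \<kappa>' u = (a + b)\<^sup>2" "mu \<kappa> \<kappa>' u = 0 \<or> mu \<kappa> \<kappa>' u = - 2 * c \<or> a = b"
  using space_form_chart.normal_form_cases[OF chart[OF assms(1,2)] assms(3,4) point(1)[OF assms(1-3)]] .

lemma nf_minimal:
  assumes "\<kappa> \<in> atlas M" "\<kappa>' \<in> atlas N" "u \<in> dom \<kappa> \<kappa>'" "nf \<kappa> \<kappa>' u a b" "mu \<kappa> \<kappa>' u = 0"
  shows "\<exists>s\<ge>0. a + b = 0 \<and> (DIM('b) = DIM('a) + 1 \<longrightarrow> s = 0) \<and>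
    mean_curv (metric M \<kappa>) (metric N \<kappa>') (coord_map \<kappa> \<kappa>' f) u = 0 \<and>
    (a * b - s = 0 \<or> a * b - s = - 2 * c) \<and>
    scalar_curv (metric M \<kappa>) u = real DIM('a) * (real DIM('a) - 1) * c + 2 * (a * b - s) \<and>
    (a * b - s = 0 \<longrightarrow> (\<forall>x y. spans_plane x y \<longrightarrow> sec_curv (metric M \<kappa>) u x y = c)) \<and>
    (c > 0 \<longrightarrow> (\<forall>x. ricci (metric M \<kappa>) u x x \<ge> 0))"
  by (rule space_form_chart.minimal_point[OF chart[OF assms(1,2)] assms(3,4) point(1)[OF assms(1-3)] assms(5)])

lemma nf_hypersurface:
  assumes "\<kappa> \<in> atlas M" "\<kappa>' \<in> atlas N" "u \<in> dom \<kappa> \<kappa>'" "nf \<kappa> \<kappa>' u a b"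
    and "DIM('b) = DIM('a) + 1" "mu \<kappa> \<kappa>' u \<noteq> 0" "mu \<kappa> \<kappa>' u \<noteq> - 2 * c"
  shows "a = b \<and> a\<^sup>2 = - (c * (4 * real DIM('a) - 10) / (12 * real DIM('a) - 33)) \<and> mu \<kappa> \<kappa>' u = 4 * a\<^sup>2"
  by (rule space_form_chart.hypersurface_umbilic_point[OF chart[OF assms(1,2)] assms(3,4) point(1)[OF assms(1-3)] assms(5-7)])

lemma mu_dim5:
  assumes "DIM('a) \<ge> 5" "\<kappa> \<in> atlas M" "\<kappa>' \<in> atlas N" "u \<in> dom \<kappa> \<kappa>'"
  shows "mu \<kappa> \<kappa>' u = 0 \<or> mu \<kappa> \<kappa>' u = - 2 * c"
proof -
  interpret C: space_form_chart "dom \<kappa> \<kappa>'" "metric M \<kappa>" "coord_range \<kappa>'" "metric N \<kappa>'" "coord_map \<kappa> \<kappa>' f" c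
    by (rule chart[OF assms(2,3)])
  show ?thesis
    using point[OF assms(2,3)] by (intro C.umbilic_excluded[OF assms(1) C.M.open_S order_refl _ assms(4)]) blast
qed

text \<open>For c > 0 a square cannot equal - 2c. The umbilic case is closed by the dimension if n
  \<ge> 5, and for hypersurfaces because it would give a^2 a negative value.\<close>

lemma mu_positive_c:
  assumes "c > 0" "DIM('b) = DIM('a) + 1 \<or> DIM('a) \<ge> 5" "\<kappa> \<in> atlas M" "\<kappa>' \<in> atlas N" "u \<in> dom \<kappa> \<kappa>'"
  shows "mu \<kappa> \<kappa>' u = 0"
proof (rule ccontr)
  assume nz: "mu \<kappa> \<kappa>' u \<noteq> 0"
  obtain a b where ab: "nf \<kappa> \<kappa>' u a b" using ex_nf[OF assms(3-5)] by blast
  have "mu \<kappa> \<kappa>' u \<ge> 0" using nf_cases(1)[OF assms(3-5) ab] by simp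
  then have ne: "mu \<kappa> \<kappa>' u \<noteq> - 2 * c" using assms(1) by auto
  then have hyp: "DIM('b) = DIM('a) + 1" using mu_dim5[OF _ assms(3-5)] nz assms(2) by blast
  have "c * (4 * real DIM('a) - 10) / (12 * real DIM('a) - 33) > 0"
    using assms(1) dim3 by (intro divide_pos_pos mult_pos_pos) auto
  moreover have "a\<^sup>2 = - (c * (4 * real DIM('a) - 10) / (12 * real DIM('a) - 33))"
    using nf_hypersurface[OF assms(3-5) ab hyp nz ne] by blast
  ultimately show False using zero_le_power2[of a] by linarith
qed

lemma constant_curvatureI:
  assumes "\<And>\<kappa> \<kappa>' u x y. \<kappa> \<in> atlas M \<Longrightarrow> \<kappa>' \<in> atlas N \<Longrightarrow> u \<in> dom \<kappa> \<kappa>' \<Longrightarrow> spans_plane x y \<Longrightarrow>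
      sec_curv (metric M \<kappa>) u x y = c"
  shows "constant_curvature M c"
  unfolding constant_curvature_def at_every_point_def coord_range_def
proof (intro ballI allI impI)
  fix \<kappa> u and x y :: 'a assume k: "\<kappa> \<in> atlas M" "u \<in> snd \<kappa> ` fst \<kappa>" "spans_plane x y"
  then obtain m \<kappa>' where "u = snd \<kappa> m" "m \<in> fst \<kappa>" "\<kappa>' \<in> atlas N" "f m \<in> fst \<kappa>'" using ambient_chart by blast
  then show "sec_curv (metric M \<kappa>) u x y = c" using assms[OF k(1) _ _ k(3), of \<kappa>' u] by blast
qed

lemma nonneg_ricciI:
  assumes "\<And>\<kappa> \<kappa>' u x. \<kappa> \<in> atlas M \<Longrightarrow> \<kappa>' \<in> atlas N \<Longrightarrow> u \<in> dom \<kappa> \<kappa>' \<Longrightarrow> ricci (metric M \<kappa>) u x x \<ge> 0"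
  shows "nonneg_ricci M"
  unfolding nonneg_ricci_def at_every_point_def coord_range_def
proof (intro ballI allI)
  fix \<kappa> u and x :: 'a assume k: "\<kappa> \<in> atlas M" "u \<in> snd \<kappa> ` fst \<kappa>"
  then obtain m \<kappa>' where "u = snd \<kappa> m" "m \<in> fst \<kappa>" "\<kappa>' \<in> atlas N" "f m \<in> fst \<kappa>'" using ambient_chart by blast
  then show "ricci (metric M \<kappa>) u x x \<ge> 0" using assms[OF k(1), of \<kappa>' u] by blast
qed

lemma minimal_immersionI:
  assumes "\<And>\<kappa> \<kappa>' u. \<kappa> \<in> atlas M \<Longrightarrow> \<kappa>' \<in> atlas N \<Longrightarrow> u \<in> dom \<kappa> \<kappa>' \<Longrightarrow>
      mean_curv (metric M \<kappa>) (metric N \<kappa>') (coord_map \<kappa> \<kappa>' f) u = 0"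
  shows "minimal_immersion M N f"
  unfolding minimal_immersion_def at_every_point_of_immersion_def using assms by blast

lemma normal_form_entriesI:
  assumes "\<And>\<kappa> \<kappa>' u a b. \<kappa> \<in> atlas M \<Longrightarrow> \<kappa>' \<in> atlas N \<Longrightarrow> u \<in> dom \<kappa> \<kappa>' \<Longrightarrow> nf \<kappa> \<kappa>' u a b \<Longrightarrow> Q a b"
  shows "normal_form_entries M N f Q"
  unfolding normal_form_entries_def at_every_point_of_immersion_def using assms ex_nf by blast

lemma minimal_case:
  assumes "c > 0" "\<And>\<kappa> \<kappa>' u. \<kappa> \<in> atlas M \<Longrightarrow> \<kappa>' \<in> atlas N \<Longrightarrow> u \<in> dom \<kappa> \<kappa>' \<Longrightarrow> mu \<kappa> \<kappa>' u = 0"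
  shows "minimal_immersion M N f" "nonneg_ricci M"
proof -
  have "mean_curv (metric M \<kappa>) (metric N \<kappa>') (coord_map \<kappa> \<kappa>' f) u = 0 \<and> (\<forall>x. ricci (metric M \<kappa>) u x x \<ge> 0)"
    if k: "\<kappa> \<in> atlas M" "\<kappa>' \<in> atlas N" "u \<in> dom \<kappa> \<kappa>'" for \<kappa> \<kappa>' u
    using ex_nf[OF k] nf_minimal[OF k _ assms(2)[OF k]] assms(1) by blast
  then show "minimal_immersion M N f" "nonneg_ricci M"
    by (auto intro!: minimal_immersionI nonneg_ricciI)
qed

text \<open>With b = - a and s \<ge> 0 the quantity ab - s is at most zero, whereas - 2c is
  positive; only the totally geodesic alternative remains.\<close>

lemma mu_zero_negative_c:
  assumes "c < 0" "\<And>\<kappa> \<kappa>' u. \<kappa> \<in> atlas M \<Longrightarrow> \<kappa>' \<in> atlas N \<Longrightarrow> u \<in> dom \<kappa> \<kappa>' \<Longrightarrow> mu \<kappa> \<kappa>' u = 0"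
  shows "constant_curvature M c"
proof (rule constant_curvatureI)
  fix \<kappa> \<kappa>' u and x y :: 'a assume k: "\<kappa> \<in> atlas M" "\<kappa>' \<in> atlas N" "u \<in> dom \<kappa> \<kappa>'" and xy: "spans_plane x y"
  obtain a b where ab: "nf \<kappa> \<kappa>' u a b" using ex_nf[OF k] by blast
  obtain s where s: "s \<ge> 0" "a + b = 0" "a * b - s = 0 \<or> a * b - s = - 2 * c"
    "a * b - s = 0 \<longrightarrow> (\<forall>x y. spans_plane x y \<longrightarrow> sec_curv (metric M \<kappa>) u x y = c)"
    using nf_minimal[OF k ab assms(2)[OF k]] by blast
  have "b = - a" using s(2) by simp
  then have "a * b \<le> 0" by simp
  then have "a * b - s = 0" using s(1,3) assms(1) by auto
  then show "sec_curv (metric M \<kappa>) u x y = c" using s(4) xy by blast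
qed

lemma mu_special_entries:
  assumes "\<And>\<kappa> \<kappa>' u. \<kappa> \<in> atlas M \<Longrightarrow> \<kappa>' \<in> atlas N \<Longrightarrow> u \<in> dom \<kappa> \<kappa>' \<Longrightarrow> mu \<kappa> \<kappa>' u = - 2 * c"
  shows "normal_form_entries M N f (\<lambda>a b. b = - a + sqrt (- 2 * c) \<or> b = - a - sqrt (- 2 * c))"
proof (rule normal_form_entriesI)
  fix \<kappa> \<kappa>' u a b assume k: "\<kappa> \<in> atlas M" "\<kappa>' \<in> atlas N" "u \<in> dom \<kappa> \<kappa>'" and ab: "nf \<kappa> \<kappa>' u a b"
  have "(a + b)\<^sup>2 = - 2 * c" using nf_cases(1)[OF k ab] assms[OF k] by simp
  then have "\<bar>a + b\<bar> = sqrt (- 2 * c)" by (metis real_sqrt_abs)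
  then show "b = - a + sqrt (- 2 * c) \<or> b = - a - sqrt (- 2 * c)" by (auto simp: abs_if split: if_splits)
qed

text \<open>With s = 0 the product ab is 0 or - 2c at each point. The corresponding scalar
  curvatures n(n - 1)c and n(n - 1)c - 4c differ, so by continuity one alternative holds on all of
  \<open>M\<close>.\<close>

lemma hypersurface_positive:
  assumes c: "c > 0" and hyp: "DIM('b) = DIM('a) + 1"
  shows "constant_curvature M c \<or>
    (minimal_immersion M N f \<and> nonneg_ricci M \<and>
     normal_form_entries M N f (\<lambda>a b.
       (a = sqrt (2 * c) \<and> b = - sqrt (2 * c)) \<or> (a = - sqrt (2 * c) \<and> b = sqrt (2 * c))))"
proof -
  let ?t = "real DIM('a) * (real DIM('a) - 1) * c"
  have mu0: "mu \<kappa> \<kappa>' u = 0" if "\<kappa> \<in> atlas M" "\<kappa>' \<in> atlas N" "u \<in> dom \<kappa> \<kappa>'" for \<kappa> \<kappa>' u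
    using mu_positive_c[OF c _ that] hyp by blast
  have pt: "a + b = 0 \<and> (a * b = 0 \<or> a * b = - 2 * c) \<and> scalar_curv (metric M \<kappa>) u = ?t + 2 * (a * b) \<and>
      (a * b = 0 \<longrightarrow> (\<forall>x y. spans_plane x y \<longrightarrow> sec_curv (metric M \<kappa>) u x y = c))"
    if k: "\<kappa> \<in> atlas M" "\<kappa>' \<in> atlas N" "u \<in> dom \<kappa> \<kappa>'" and ab: "nf \<kappa> \<kappa>' u a b" for \<kappa> \<kappa>' u a b
    using nf_minimal[OF k ab mu0[OF k]] hyp by auto
  have "\<exists>r. \<forall>\<kappa>\<in>atlas M. \<forall>\<kappa>'\<in>atlas N. \<forall>u\<in>dom \<kappa> \<kappa>'. scalar_curv (metric M \<kappa>) u = r"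
  proof (rule scalar_curv_constant[where A = "{?t, ?t + 2 * (- 2 * c)}"])
    fix \<kappa> \<kappa>' u assume k: "\<kappa> \<in> atlas M" "\<kappa>' \<in> atlas N" "u \<in> dom \<kappa> \<kappa>'"
    obtain a b where "nf \<kappa> \<kappa>' u a b" using ex_nf[OF k] by blast
    from pt[OF k this] show "scalar_curv (metric M \<kappa>) u \<in> {?t, ?t + 2 * (- 2 * c)}" by auto
  qed simp
  then obtain r where "\<forall>\<kappa>\<in>atlas M. \<forall>\<kappa>'\<in>atlas N. \<forall>u\<in>dom \<kappa> \<kappa>'. scalar_curv (metric M \<kappa>) u = r" ..
  note r = bspec[OF bspec[OF bspec[OF this]]]
  show ?thesis
  proof (cases "r = ?t")
    case True
    have "constant_curvature M c"
    proof (rule constant_curvatureI)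
      fix \<kappa> \<kappa>' u and x y :: 'a assume k: "\<kappa> \<in> atlas M" "\<kappa>' \<in> atlas N" "u \<in> dom \<kappa> \<kappa>'" and xy: "spans_plane x y"
      obtain a b where ab: "nf \<kappa> \<kappa>' u a b" using ex_nf[OF k] by blast
      have "a * b = 0" using pt[OF k ab] r[OF k] True by linarith
      then show "sec_curv (metric M \<kappa>) u x y = c" using pt[OF k ab] xy by blast
    qed
    then show ?thesis ..
  next
    case False
    have "normal_form_entries M N f (\<lambda>a b.
       (a = sqrt (2 * c) \<and> b = - sqrt (2 * c)) \<or> (a = - sqrt (2 * c) \<and> b = sqrt (2 * c)))"
    proof (rule normal_form_entriesI)
      fix \<kappa> \<kappa>' u a b assume k: "\<kappa> \<in> atlas M" "\<kappa>' \<in> atlas N" "u \<in> dom \<kappa> \<kappa>'" and ab: "nf \<kappa> \<kappa>' u a b"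
      have b: "b = - a" and "a * b = - 2 * c" using pt[OF k ab] r[OF k] False by auto
      then have "a\<^sup>2 = 2 * c" by (simp add: power2_eq_square)
      then have "\<bar>a\<bar> = sqrt (2 * c)" by (metis real_sqrt_abs)
      then show "(a = sqrt (2 * c) \<and> b = - sqrt (2 * c)) \<or> (a = - sqrt (2 * c) \<and> b = sqrt (2 * c))"
        using b by (auto simp: abs_if split: if_splits)
    qed
    with minimal_case[OF c mu0] show ?thesis by blast
  qed
qed

text \<open>Finitely many values make \<open>mu\<close> constant. The third alternative is kept as a
  condition at every point; callers turn it into the umbilic case or refute it.\<close>

lemma negative_dichotomy:
  assumes c: "c < 0" and A: "finite A"
    "\<And>\<kappa> \<kappa>' u. \<kappa> \<in> atlas M \<Longrightarrow> \<kappa>' \<in> atlas N \<Longrightarrow> u \<in> dom \<kappa> \<kappa>' \<Longrightarrow> mu \<kappa> \<kappa>' u \<in> A"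
  shows "constant_curvature M c \<or>
    normal_form_entries M N f (\<lambda>a b. b = - a + sqrt (- 2 * c) \<or> b = - a - sqrt (- 2 * c)) \<or>
    (\<forall>\<kappa>\<in>atlas M. \<forall>\<kappa>'\<in>atlas N. \<forall>u\<in>dom \<kappa> \<kappa>'. mu \<kappa> \<kappa>' u \<noteq> 0 \<and> mu \<kappa> \<kappa>' u \<noteq> - 2 * c)"
proof -
  obtain r where "\<forall>\<kappa>\<in>atlas M. \<forall>\<kappa>'\<in>atlas N. \<forall>u\<in>dom \<kappa> \<kappa>'. mu \<kappa> \<kappa>' u = r"
    using mu_constant[OF A] ..
  note r = bspec[OF bspec[OF bspec[OF this]]]
  consider "r = 0" | "r = - 2 * c" | "r \<noteq> 0" "r \<noteq> - 2 * c" by blast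
  then show ?thesis
  proof cases
    case 1
    then show ?thesis using mu_zero_negative_c[OF c] r by blast
  next
    case 2
    then show ?thesis using mu_special_entries r by blast
  next
    case 3
    then show ?thesis using r by blast
  qed
qed

lemma hypersurface_negative:
  assumes c: "c < 0" and hyp: "DIM('b) = DIM('a) + 1"
  shows "constant_curvature M c \<or>
    ((DIM('a) = 3 \<or> DIM('a) = 4) \<and>
     normal_form_entries M N f (\<lambda>a b. a = b \<and>
       (a = sqrt (- (c * (4 * real DIM('a) - 10) / (12 * real DIM('a) - 33))) \<or>
        a = - sqrt (- (c * (4 * real DIM('a) - 10) / (12 * real DIM('a) - 33)))))) \<or>
    normal_form_entries M N f (\<lambda>a b. b = - a + sqrt (- 2 * c) \<or> b = - a - sqrt (- 2 * c))"
proof -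
  let ?x = "- (c * (4 * real DIM('a) - 10) / (12 * real DIM('a) - 33))"
  \<comment> \<open>The third value is (a + b)^2 = 4a^2 at an umbilic point, determined by
    \<open>umbilic_principal_curvature\<close>.\<close>
  have "mu \<kappa> \<kappa>' u \<in> {0, - 2 * c, 4 * ?x}"
    if k: "\<kappa> \<in> atlas M" "\<kappa>' \<in> atlas N" "u \<in> dom \<kappa> \<kappa>'" for \<kappa> \<kappa>' u
  proof -
    obtain a b where ab: "nf \<kappa> \<kappa>' u a b" using ex_nf[OF k] by blast
    show ?thesis using nf_hypersurface[OF k ab hyp] by (metis insertCI)
  qed
  note dich = negative_dichotomy[OF c _ this]
  have "(DIM('a) = 3 \<or> DIM('a) = 4) \<and>
     normal_form_entries M N f (\<lambda>a b. a = b \<and> (a = sqrt ?x \<or> a = - sqrt ?x))"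
    if ne: "\<forall>\<kappa>\<in>atlas M. \<forall>\<kappa>'\<in>atlas N. \<forall>u\<in>dom \<kappa> \<kappa>'. mu \<kappa> \<kappa>' u \<noteq> 0 \<and> mu \<kappa> \<kappa>' u \<noteq> - 2 * c"
      and nonempty: "\<not> constant_curvature M c"
  proof
    \<comment> \<open>Failure of constant curvature supplies a point; \<open>ne\<close> alone holds
      vacuously when there is none.\<close>
    obtain \<kappa> \<kappa>' u where k: "\<kappa> \<in> atlas M" "\<kappa>' \<in> atlas N" "u \<in> dom \<kappa> \<kappa>'"
      using constant_curvatureI nonempty by blast
    then have "\<not> DIM('a) \<ge> 5" using ne mu_dim5[OF _ k] by blast
    then show "DIM('a) = 3 \<or> DIM('a) = 4" using dim3 by auto
    show "normal_form_entries M N f (\<lambda>a b. a = b \<and> (a = sqrt ?x \<or> a = - sqrt ?x))"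
    proof (rule normal_form_entriesI)
      fix \<kappa> \<kappa>' u a b assume k: "\<kappa> \<in> atlas M" "\<kappa>' \<in> atlas N" "u \<in> dom \<kappa> \<kappa>'" and ab: "nf \<kappa> \<kappa>' u a b"
      have 1: "a = b" "a\<^sup>2 = ?x" using nf_hypersurface[OF k ab hyp] ne k by blast+
      then have "\<bar>a\<bar> = sqrt ?x" by (metis real_sqrt_abs)
      then show "a = b \<and> (a = sqrt ?x \<or> a = - sqrt ?x)" using 1(1) by (metis abs_if minus_minus)
    qed
  qed
  with dich show ?thesis by blast
qed

end

theorem theorem2p5:
  fixes M :: "('m, 'a::euclidean_space) riem_space"
    and N :: "('q, 'b::euclidean_space) riem_space"
    and f :: "'m \<Rightarrow> 'q"
    and c :: real
    and n p :: nat
  assumes "DIM('a) = n" and "DIM('b) = n + p"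
    and "n \<ge> 3" and "p \<ge> 1" and "c \<noteq> 0"
    and "space_form N c"
    and "riemannian_manifold M"
    and "isometric_immersion M N f"
    and "weakly_einstein M"
    and "chen_equality M N f c"
  shows
    "(p = 1 \<longrightarrow>
       (c > 0 \<longrightarrow>
          constant_curvature M c \<or>
          (minimal_immersion M N f \<and> nonneg_ricci M \<and>
           normal_form_entries M N f (\<lambda>a b.
             (a = sqrt (2 * c) \<and> b = - sqrt (2 * c)) \<or>
             (a = - sqrt (2 * c) \<and> b = sqrt (2 * c))))) \<and>
       (c < 0 \<longrightarrow>
          constant_curvature M c \<or>
          ((n = 3 \<or> n = 4) \<and>
           normal_form_entries M N f (\<lambda>a b. a = b \<and>
             (a = sqrt (- (c * (4 * real n - 10) / (12 * real n - 33))) \<or>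
              a = - sqrt (- (c * (4 * real n - 10) / (12 * real n - 33)))))) \<or>
          normal_form_entries M N f (\<lambda>a b.
             b = - a + sqrt (- 2 * c) \<or> b = - a - sqrt (- 2 * c)))) \<and>
     (p \<ge> 2 \<longrightarrow>
       (c > 0 \<longrightarrow>
          constant_curvature M c \<or>
          (minimal_immersion M N f \<and> nonneg_ricci M) \<or>
          (n = 3 \<or> n = 4)) \<and>
       (c < 0 \<longrightarrow>
          constant_curvature M c \<or>
          (n = 3 \<or> n = 4) \<or>
          normal_form_entries M N f (\<lambda>a b.
             b = - a + sqrt (- 2 * c) \<or> b = - a - sqrt (- 2 * c))))"
proof -
  interpret chen_submanifold M N f c using assms by unfold_locales auto
  have hyp: "p = 1 \<Longrightarrow> DIM('b) = DIM('a) + 1" using assms(1,2) by simp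
  \<comment> \<open>For p \<ge> 2 the conclusion admits n = 3 and n = 4 outright, so only n \<ge> 5
    is left, where the umbilic points are excluded.\<close>
  have dims: "n = 3 \<or> n = 4 \<or> DIM('a) \<ge> 5" using assms(1,3) by auto
  have pos: "minimal_immersion M N f \<and> nonneg_ricci M" if "c > 0" "DIM('a) \<ge> 5"
    using minimal_case[OF that(1) mu_positive_c[OF that(1)]] that(2) by blast
  have neg: "constant_curvature M c \<or>
      normal_form_entries M N f (\<lambda>a b. b = - a + sqrt (- 2 * c) \<or> b = - a - sqrt (- 2 * c))"
    if "c < 0" "DIM('a) \<ge> 5"
  proof (rule ccontr)
    assume contra: "\<not> ?thesis"
    \<comment> \<open>The point is needed to contradict the third alternative of
      \<open>negative_dichotomy\<close>, which speaks about all points.\<close>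
    then obtain \<kappa> \<kappa>' u where k: "\<kappa> \<in> atlas M" "\<kappa>' \<in> atlas N" "u \<in> dom \<kappa> \<kappa>'"
      using constant_curvatureI by blast
    have "finite {0, - 2 * c}" by simp
    moreover have "mu \<kappa> \<kappa>' u \<in> {0, - 2 * c}" if "\<kappa> \<in> atlas M" "\<kappa>' \<in> atlas N" "u \<in> dom \<kappa> \<kappa>'" for \<kappa> \<kappa>' u
      using mu_dim5[OF \<open>DIM('a) \<ge> 5\<close> that] by blast
    ultimately have "mu \<kappa> \<kappa>' u \<noteq> 0 \<and> mu \<kappa> \<kappa>' u \<noteq> - 2 * c"
      using negative_dichotomy[OF \<open>c < 0\<close>, of "{0, - 2 * c}"] contra k by blast
    then show False using mu_dim5[OF \<open>DIM('a) \<ge> 5\<close> k] by blast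
  qed
  show ?thesis
    using hypersurface_positive hypersurface_negative hyp dims pos neg unfolding assms(1) by blast
qed

end
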